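(* Let $n\ge 2$ be an integer and let $f \in L^1(\mathbb{R})$ be nonnegative with $t^{2n-2} f(t) \in L^1(\mathbb{R})$. Let $\nu_{n,a}(x):= \nu_n(f;x+a)$, $a\in\mathbb{R}$. (1) $W_n(\mathcal{F} f; x)$ has no real zeros if and only if the span of $\{\nu_{n,a}: a\in \mathbb{R}\}$ is dense in $L^1(\mathbb{R})$. (2) If $\nu_n(f) \in L^2(\mathbb{R})$, then the set of real zeros of $W_n(\mathcal{F} f; x)$ has Lebesgue measure zero if and only if the span of $\{\nu_{n,a}: a\in \mathbb{R}\}$ is dense in $L^2(\mathbb{R})$.
   Context: $\mathcal{F} f(x) = \int_{\mathbb{R}} e^{-ixt} f(t)\,dt$; $W_n(h;x) = \det[h^{(i+j)}(x)]_{i,j=0}^{n-1}$. The correlation function is $$ \nu_n(f;t) = \int_{\mathbb{R}^{n-1}} \prod_{1 \le i<j \le n}(s_i-s_j)^2\, f(s_1)\cdots f(s_n)\, ds_1\cdots ds_{n-1}, \qquad s_n := t-s_1-\cdots-s_{n-1}. $$ *)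

theory Defs
  imports "HOL-Analysis.Analysis"
begin

definition fourier :: "(real \<Rightarrow> real) \<Rightarrow> real \<Rightarrow> complex" where
  "fourier f x = (\<integral>t. exp (- \<i> * complex_of_real (x * t)) * complex_of_real (f t) \<partial>lborel)"

fun higher_deriv :: "nat \<Rightarrow> (real \<Rightarrow> complex) \<Rightarrow> real \<Rightarrow> complex" where
  "higher_deriv 0 h = h"
| "higher_deriv (Suc k) h = (\<lambda>x. vector_derivative (higher_deriv k h) (at x))"

definition det_n :: "nat \<Rightarrow> (nat \<Rightarrow> nat \<Rightarrow> complex) \<Rightarrow> complex" where
  "det_n n A = (\<Sum>p | p permutes {..<n}. of_int (sign p) * (\<Prod>i<n. A i (p i)))"

definition W :: "nat \<Rightarrow> (real \<Rightarrow> complex) \<Rightarrow> real \<Rightarrow> complex" where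
  "W n h x = det_n n (\<lambda>i j. higher_deriv (i + j) h x)"

text \<open>Full coordinate vector s_0,...,s_{n-1} with s_{n-1} := t - s_0 - ... - s_{n-2}
  (0-indexed version of the paper's s_1,...,s_n).\<close>
definition sfull :: "nat \<Rightarrow> real \<Rightarrow> (nat \<Rightarrow> real) \<Rightarrow> nat \<Rightarrow> real" where
  "sfull n t s i = (if i < n - 1 then s i else t - (\<Sum>j<n - 1. s j))"

definition nu :: "nat \<Rightarrow> (real \<Rightarrow> real) \<Rightarrow> real \<Rightarrow> real" where
  "nu n f t = (\<integral>s. (\<Prod>j<n. \<Prod>i<j. (sfull n t s i - sfull n t s j)^2)
                     * (\<Prod>i<n. f (sfull n t s i))
              \<partial>(\<Pi>\<^sub>M i\<in>{..<n - 1}. lborel))"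

definition translates_dense_L1 :: "(real \<Rightarrow> real) \<Rightarrow> bool" where
  "translates_dense_L1 g \<longleftrightarrow>
     (\<forall>h::real \<Rightarrow> real. integrable lborel h \<longrightarrow>
        (\<forall>\<epsilon>>0. \<exists>(m::nat) (c::nat \<Rightarrow> real) (a::nat \<Rightarrow> real).
           (\<integral>\<^sup>+x. ennreal \<bar>h x - (\<Sum>k<m. c k * g (x + a k))\<bar> \<partial>lborel) < ennreal \<epsilon>))"

definition translates_dense_L2 :: "(real \<Rightarrow> real) \<Rightarrow> bool" where
  "translates_dense_L2 g \<longleftrightarrow>
     (\<forall>h::real \<Rightarrow> real. h \<in> borel_measurable lborel \<longrightarrow> integrable lborel (\<lambda>x. (h x)^2) \<longrightarrow>
        (\<forall>\<epsilon>>0. \<exists>(m::nat) (c::nat \<Rightarrow> real) (a::nat \<Rightarrow> real).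
           (\<integral>\<^sup>+x. ennreal ((h x - (\<Sum>k<m. c k * g (x + a k)))^2) \<partial>lborel) < ennreal \<epsilon>))"

end

(* Expanding the square of the Vandermonde product and integrating termwise (Andreief's identity)
   shows that W n (fourier f) is a nonzero constant multiple of the Fourier transform of nu n f,
   so both claims reduce to Wiener's closure theorems for g = nu n f.

   L^1: the closed span of the translates of g contains every convolution with g.  If ft g has no
   zeros, a de la Vallee Poussin kernel concentrated near a frequency x_0 yields an integrable u of
   norm at most 1/2 with ft u = 1 - ft g / ft g x_0 near x_0; iterating convolution with u
   approximates every function with spectrum near x_0, and the Fejer kernel is a finite sum of such
   pieces.  The size of the neighbourhood is uniform for x_0 in a compact interval.

   L^2: Gaussian damping gives the Plancherel inequality.  A function with transform H is
   approximated by the convolution of g with the inverse transform of a smoothed cut-off of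
   H / ft g.  Conversely, if ft g vanishes on a set of positive measure, the inverse transform of
   the indicator of a bounded part of it is orthogonal to all translates of g. *)

theory Submission
  imports Defs "HOL-Probability.Probability"
begin

section \<open>Translation continuity in the mean\<close>

text \<open>\<open>nu n f t\<close> integrates over the coordinates with sum \<open>t\<close>. The
  character at frequency \<open>x\<close> therefore splits into one factor per coordinate, and
  transforming \<open>nu n f\<close> amounts to replacing \<open>f t\<close> by
  \<open>cis (- (x * t)) * f t\<close> in an integral over all coordinates. The moments of this
  function are, up to powers of \<open>- \<i>\<close>, the derivatives of \<open>fourier f\<close>
  at \<open>x\<close>; this is how a Hankel determinant of derivatives arises.

  The kernels that isolate a frequency are complex, so closed spans are studied with complex
  coefficients, and real parts are taken at the end. Distance is measured by the integral of the
  p-th power of the norm, without the root, so that one development serves p = 1 and p = 2; a factor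
  2 replaces the triangle inequality.

  In the L^2 part every spatial error is bounded by an error on the frequency side, and
  \<open>nu n f\<close> is itself integrable. One direction of Plancherel, with any finite constant,
  is then enough, and the transform never has to be extended from L^1 to L^2.\<close>

lemma measurable_cis [measurable]: "cis \<in> borel_measurable borel"
  by (intro borel_measurable_continuous_onI continuous_intros)

text \<open>The constant 2 is the one for p = 2, from \<open>(a - b)^2 \<ge> 0\<close>; it is kept
  for p = 1 so that both exponents share a single estimate.\<close>

lemma power_norm_add_le:
  fixes a b :: "'a::real_normed_vector"
  assumes "p = 1 \<or> p = (2::nat)"
  shows "norm (a + b) ^ p \<le> 2 * (norm a ^ p + norm b ^ p)"
proof -
  have t: "norm (a + b) \<le> norm a + norm b" by (rule norm_triangle_ineq)
  show ?thesis
  proof (cases "p = 1")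
    case True
    then show ?thesis using t by (simp add: add_increasing2 ) (smt (verit) norm_ge_zero)
  next
    case False
    then have p: "p = 2" using assms by simp
    have "norm (a + b) ^ 2 \<le> (norm a + norm b)^2"
      using t by (intro power_mono) auto
    also have "\<dots> \<le> 2 * (norm a ^ 2 + norm b ^ 2)"
      using sum_squares_ge_zero[of "norm a - norm b" 0] 
      by (simp add: power2_eq_square algebra_simps)
    finally show ?thesis using p by simp
  qed
qed

lemma nn_integral_norm_add_le:
  fixes u v :: "real \<Rightarrow> 'a::{real_normed_vector,second_countable_topology}"
  assumes "p = 1 \<or> p = (2::nat)" and [measurable]: "u \<in> borel_measurable borel" "v \<in> borel_measurable borel"
  shows "(\<integral>\<^sup>+x. ennreal (norm (u x + v x) ^ p) \<partial>lborel)
     \<le> 2 * ((\<integral>\<^sup>+x. ennreal (norm (u x) ^ p) \<partial>lborel) + (\<integral>\<^sup>+x. ennreal (norm (v x) ^ p) \<partial>lborel))"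
proof -
  have "(\<integral>\<^sup>+x. ennreal (norm (u x + v x) ^ p) \<partial>lborel)
     \<le> (\<integral>\<^sup>+x. 2 * (ennreal (norm (u x) ^ p) + ennreal (norm (v x) ^ p)) \<partial>lborel)"
  proof (rule nn_integral_mono)
    fix x
    have "ennreal (norm (u x + v x) ^ p) \<le> ennreal (2 * (norm (u x) ^ p + norm (v x) ^ p))"
      by (intro ennreal_leI power_norm_add_le assms)
    then show "ennreal (norm (u x + v x) ^ p) \<le> 2 * (ennreal (norm (u x) ^ p) + ennreal (norm (v x) ^ p))"
      by (simp add: ennreal_mult del: distrib_left_numeral)
  qed
  also have "\<dots> = 2 * ((\<integral>\<^sup>+x. ennreal (norm (u x) ^ p) \<partial>lborel) + (\<integral>\<^sup>+x. ennreal (norm (v x) ^ p) \<partial>lborel))"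
    by (simp add: nn_integral_cmult nn_integral_add)
  finally show ?thesis .
qed

lemma nn_integral_translate:
  assumes [measurable]: "f \<in> borel_measurable borel"
  shows "(\<integral>\<^sup>+x. f (x + a) \<partial>lborel) = (\<integral>\<^sup>+x. f x \<partial>(lborel :: real measure))"
  using nn_integral_real_affine[of f 1 a] by (simp add: add.commute)

text \<open>For an open set the negative part of the difference is controlled pointwise, and
  the positive part has the same integral by translation invariance.\<close>

lemma translation_continuous_open:
  fixes U :: "real set"
  assumes U: "open U" and fin: "emeasure lborel U < \<infinity>" and y: "y \<longlonglongrightarrow> 0"
  shows "(\<lambda>n. \<integral>\<^sup>+t. ennreal \<bar>indicator U (t + y n) - indicator U t\<bar> \<partial>lborel) \<longlonglongrightarrow> 0"
proof -
  have [measurable]: "U \<in> sets borel" using U by simp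
  let ?A = "\<lambda>n. \<integral>\<^sup>+t. indicator U t * (1 - indicator U (t + y n)) \<partial>lborel"
  have A: "?A \<longlonglongrightarrow> (\<integral>\<^sup>+(t::real). 0 \<partial>lborel)"
  proof (rule nn_integral_dominated_convergence)
    show "(\<integral>\<^sup>+ x. indicator U x \<partial>lborel) < \<infinity>" using fin by simp
    show "AE x in lborel. indicator U x * (1 - indicator U (x + y n)) \<le> (indicator U x :: ennreal)" for n
      by (auto simp: indicator_def)
    show "AE x in lborel. (\<lambda>n. indicator U x * (1 - indicator U (x + y n)) :: ennreal) \<longlonglongrightarrow> 0"
    proof (rule AE_I2)
      fix x :: real
      show "(\<lambda>n. indicator U x * (1 - indicator U (x + y n)) :: ennreal) \<longlonglongrightarrow> 0"
      proof (cases "x \<in> U")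
        case True
        have "(\<lambda>n. x + y n) \<longlonglongrightarrow> x + 0" by (intro tendsto_intros y)
        then have "eventually (\<lambda>n. x + y n \<in> U) sequentially"
          using U True by (simp add: topological_tendstoD)
        then show ?thesis by (intro tendsto_eventually) (erule eventually_mono, simp)
      qed simp
    qed
  qed auto
  have eq: "(\<integral>\<^sup>+t. ennreal \<bar>indicator U (t + y n) - indicator U t\<bar> \<partial>lborel) = ?A n + ?A n" for n
  proof -
    let ?B = "\<integral>\<^sup>+t. indicator U (t + y n) * (1 - indicator U t) \<partial>lborel"
    let ?C = "\<integral>\<^sup>+t. indicator U (t + y n) * indicator U t \<partial>lborel"
    have "?C + ?B = (\<integral>\<^sup>+t. indicator U (t + y n) \<partial>lborel)"
      by (subst nn_integral_add[symmetric]) (auto simp: indicator_def intro!: nn_integral_cong)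
    also have "\<dots> = (\<integral>\<^sup>+t. indicator U t \<partial>lborel)"
      by (rule nn_integral_translate) auto
    also have "\<dots> = ?C + ?A n"
      by (subst nn_integral_add[symmetric])
         (auto simp: indicator_def simp del: nn_integral_indicator intro!: nn_integral_cong)
    finally have "?C + ?B = ?C + ?A n" .
    \<comment> \<open>Cancelling \<open>?C\<close> in \<open>ennreal\<close> requires it to be
      finite; the finite measure of \<open>U\<close> enters here.\<close>
    moreover have "?C \<le> (\<integral>\<^sup>+t. indicator U t \<partial>lborel)"
      by (rule nn_integral_mono) (auto simp: indicator_def)
    then have "?C \<noteq> \<infinity>" using fin by (auto simp: top_unique)
    ultimately have "?B = ?A n" by (simp add: ennreal_add_left_cancel)
    moreover have "(\<integral>\<^sup>+t. ennreal \<bar>indicator U (t + y n) - indicator U t\<bar> \<partial>lborel) = ?A n + ?B"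
      by (subst nn_integral_add[symmetric]) (auto simp: indicator_def intro!: nn_integral_cong)
    ultimately show ?thesis by simp
  qed
  show ?thesis unfolding eq using tendsto_add[OF A A] by simp
qed

text \<open>The null sequence \<open>G\<close> may depend on \<epsilon>. This is the shape a density
  argument produces: an approximant with the desired limit, plus a fixed small error.\<close>

lemma tendsto_zero_ennreal_approx:
  fixes F :: "nat \<Rightarrow> ennreal"
  assumes "\<And>\<epsilon>::real. \<epsilon> > 0 \<Longrightarrow> \<exists>G. G \<longlonglongrightarrow> 0 \<and> (\<forall>n. F n \<le> G n + ennreal \<epsilon>)"
  shows "F \<longlonglongrightarrow> 0"
proof (rule tendsto_zero_ennreal)
  fix r :: real assume r: "0 < r"
  from assms[of "r/2"] r obtain G where G: "G \<longlonglongrightarrow> 0" "\<And>n. F n \<le> G n + ennreal (r/2)" by auto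
  have "eventually (\<lambda>n. G n < ennreal (r/2)) sequentially"
    using G(1) r by (intro order_tendstoD) auto
  then show "eventually (\<lambda>n. F n < ennreal r) sequentially"
  proof eventually_elim
    case (elim n)
    have "F n \<le> G n + ennreal (r/2)" by (rule G)
    also have "\<dots> < ennreal (r/2) + ennreal (r/2)"
      using elim by (simp add: ennreal_add_left_cancel_less add.commute)
    also have "\<dots> = ennreal r" using r by (simp add: ennreal_plus[symmetric] del: ennreal_plus)
    finally show ?case .
  qed
qed

text \<open>Replacing \<open>f\<close> by \<open>h\<close> costs their distance twice, once at
  \<open>t + y\<close> and once at \<open>t\<close>; the two costs agree by translation
  invariance.\<close>

lemma translation_diff_le:
  fixes f h :: "real \<Rightarrow> 'a::{real_normed_vector,second_countable_topology}"
  assumes [measurable]: "f \<in> borel_measurable borel" "h \<in> borel_measurable borel"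
  shows "(\<integral>\<^sup>+t. ennreal (norm (f (t + y) - f t)) \<partial>lborel)
    \<le> (\<integral>\<^sup>+t. ennreal (norm (h (t + y) - h t)) \<partial>lborel) + 2 * (\<integral>\<^sup>+t. ennreal (norm (f t - h t)) \<partial>lborel)"
proof -
  let ?d = "\<lambda>t. f t - h t"
  have "(\<integral>\<^sup>+t. ennreal (norm (f (t + y) - f t)) \<partial>lborel)
    \<le> (\<integral>\<^sup>+t. ennreal (norm (h (t + y) - h t)) + (ennreal (norm (?d (t + y))) + ennreal (norm (?d t))) \<partial>lborel)"
  proof (rule nn_integral_mono)
    fix t
    have "f (t + y) - f t = (h (t + y) - h t) + (?d (t + y) - ?d t)" by simp
    then have "norm (f (t + y) - f t) \<le> norm (h (t + y) - h t) + (norm (?d (t + y)) + norm (?d t))"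
      by (metis (no_types, lifting) norm_triangle_le norm_triangle_ineq4 add_left_mono order_refl order_trans)
    then show "ennreal (norm (f (t + y) - f t))
      \<le> ennreal (norm (h (t + y) - h t)) + (ennreal (norm (?d (t + y))) + ennreal (norm (?d t)))"
      by (simp add: ennreal_plus[symmetric] ennreal_leI del: ennreal_plus)
  qed
  also have "\<dots> = (\<integral>\<^sup>+t. ennreal (norm (h (t + y) - h t)) \<partial>lborel) +
     ((\<integral>\<^sup>+t. ennreal (norm (?d (t + y))) \<partial>lborel) + (\<integral>\<^sup>+t. ennreal (norm (?d t)) \<partial>lborel))"
    by (simp add: nn_integral_add)
  also have "(\<integral>\<^sup>+t. ennreal (norm (?d (t + y))) \<partial>lborel) = (\<integral>\<^sup>+t. ennreal (norm (?d t)) \<partial>lborel)"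
    by (rule nn_integral_translate) auto
  finally show ?thesis by (simp add: mult_2)
qed

text \<open>Induction over integrable functions leads to indicators of sets of finite measure, and
  outer regularity leads from these to open sets. The values lie in a general Banach space because
  the result is applied to complex kernels and to a real function.\<close>

theorem translation_continuous_L1:
  fixes h :: "real \<Rightarrow> 'a::{banach,second_countable_topology}"
  assumes h: "integrable lborel h" and y: "y \<longlonglongrightarrow> 0"
  shows "(\<lambda>n. \<integral>\<^sup>+t. ennreal (norm (h (t + y n) - h t)) \<partial>lborel) \<longlonglongrightarrow> 0"
  using h
proof (induction rule: integrable_induct)
  case (base A c)
  then have [measurable]: "A \<in> sets borel" by simp
  let ?f = "\<lambda>t. indicator A t *\<^sub>R c"
  show ?case
  proof (rule tendsto_zero_ennreal_approx)
    fix \<epsilon> :: real assume \<epsilon>: "\<epsilon> > 0"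
    \<comment> \<open>The 2 is the one of \<open>translation_diff_le\<close>; the added 1 keeps the
      denominator positive when \<open>c = 0\<close>.\<close>
    define \<delta> where "\<delta> = \<epsilon> / (2 * (norm c + 1))"
    have \<delta>: "\<delta> > 0" using \<epsilon> by (auto simp: \<delta>_def intro!: divide_pos_pos add_nonneg_pos)
    obtain U where U: "open U" "A \<subseteq> U" "emeasure lborel (U - A) < ennreal \<delta>"
      using outer_regular_lborel[of A \<delta>] \<delta> by auto
    have [measurable]: "U \<in> sets borel" using U by simp
    have "emeasure lborel U \<le> emeasure lborel A + emeasure lborel (U - A)"
      using U emeasure_subadditive[of A lborel "U - A"] by (simp add: Un_absorb1)
    also have "\<dots> < \<infinity>" using U(3) base(2) by (simp add: less_top[symmetric]) (metis ennreal_less_top less_top order.strict_trans)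
    finally have finU: "emeasure lborel U < \<infinity>" .
    let ?h = "\<lambda>t. indicator U t *\<^sub>R c"
    let ?G = "\<lambda>n. \<integral>\<^sup>+t. ennreal (norm (?h (t + y n) - ?h t)) \<partial>lborel"
    have "?G n = ennreal (norm c) * (\<integral>\<^sup>+t. ennreal \<bar>indicator U (t + y n) - indicator U t\<bar> \<partial>lborel)" for n
      by (subst nn_integral_cmult[symmetric])
         (auto simp: scaleR_diff_left[symmetric] ennreal_mult[symmetric] mult.commute intro!: nn_integral_cong)
    then have "?G \<longlonglongrightarrow> 0"
      using ennreal_tendsto_cmult[OF _ translation_continuous_open[OF U(1) finU y], of "ennreal (norm c)"] by simp
    moreover have "(\<integral>\<^sup>+t. ennreal (norm (?f (t + y n) - ?f t)) \<partial>lborel) \<le> ?G n + ennreal \<epsilon>" for n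
    proof -
      have "(\<integral>\<^sup>+t. ennreal (norm (?f (t + y n) - ?f t)) \<partial>lborel) \<le> ?G n + 2 * (\<integral>\<^sup>+t. ennreal (norm (?f t - ?h t)) \<partial>lborel)"
        by (rule translation_diff_le) auto
      also have "(\<integral>\<^sup>+t. ennreal (norm (?f t - ?h t)) \<partial>lborel) = (\<integral>\<^sup>+t. ennreal (norm c) * indicator (U - A) t \<partial>lborel)"
        using U(2) by (intro nn_integral_cong) (auto simp: indicator_def)
      also have "\<dots> = ennreal (norm c) * emeasure lborel (U - A)" by (simp add: nn_integral_cmult)
      also have "2 * (ennreal (norm c) * emeasure lborel (U - A)) \<le> 2 * (ennreal (norm c) * ennreal \<delta>)"
        using U(3) by (intro mult_left_mono) auto
      also have "\<dots> = ennreal (2 * (norm c * \<delta>))" using \<delta> by (simp add: ennreal_mult)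
      also have "\<dots> \<le> ennreal \<epsilon>"
      proof (rule ennreal_leI)
        have "norm c * \<epsilon> \<le> (norm c + 1) * \<epsilon>" using \<epsilon> by (intro mult_right_mono) auto
        moreover have "norm c + 1 > 0" by (simp add: add_nonneg_pos)
        ultimately show "2 * (norm c * \<delta>) \<le> \<epsilon>" by (simp add: \<delta>_def field_simps)
      qed
      finally show ?thesis by (simp add: add_left_mono)
    qed
    ultimately show "\<exists>G. G \<longlonglongrightarrow> 0 \<and> (\<forall>n. (\<integral>\<^sup>+t. ennreal (norm (?f (t + y n) - ?f t)) \<partial>lborel) \<le> G n + ennreal \<epsilon>)"
      by blast
  qed
next
  case (add f g)
  have [measurable]: "f \<in> borel_measurable borel" "g \<in> borel_measurable borel" using add(1,2) by auto
  show ?case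
  proof (rule tendsto_sandwich[OF _ _ tendsto_const])
    show "eventually (\<lambda>n. (\<integral>\<^sup>+t. ennreal (norm (f (t + y n) + g (t + y n) - (f t + g t))) \<partial>lborel)
      \<le> (\<integral>\<^sup>+t. ennreal (norm (f (t + y n) - f t)) \<partial>lborel) + (\<integral>\<^sup>+t. ennreal (norm (g (t + y n) - g t)) \<partial>lborel)) sequentially"
    proof (rule always_eventually, rule allI)
      fix n
      show "(\<integral>\<^sup>+t. ennreal (norm (f (t + y n) + g (t + y n) - (f t + g t))) \<partial>lborel)
      \<le> (\<integral>\<^sup>+t. ennreal (norm (f (t + y n) - f t)) \<partial>lborel) + (\<integral>\<^sup>+t. ennreal (norm (g (t + y n) - g t)) \<partial>lborel)"
        by (subst nn_integral_add[symmetric])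
           (auto intro!: nn_integral_mono ennreal_leI norm_diff_triangle_ineq simp: ennreal_plus[symmetric] simp del: ennreal_plus)
    qed
    show "(\<lambda>n. (\<integral>\<^sup>+t. ennreal (norm (f (t + y n) - f t)) \<partial>lborel) + (\<integral>\<^sup>+t. ennreal (norm (g (t + y n) - g t)) \<partial>lborel)) \<longlonglongrightarrow> 0"
      using tendsto_add[OF add(3,4)] by simp
  qed auto
next
  case (lim f s)
  have [measurable]: "f \<in> borel_measurable borel" "\<And>i. s i \<in> borel_measurable borel" using lim(1,4) by auto
  have "(\<lambda>i. \<integral>\<^sup>+t. ennreal (norm (f t - s i t)) \<partial>lborel) \<longlonglongrightarrow> (\<integral>\<^sup>+(t::real). 0 \<partial>lborel)"
  proof (rule nn_integral_dominated_convergence)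
    show "(\<integral>\<^sup>+t. ennreal (3 * norm (f t)) \<partial>lborel) < \<infinity>"
      using lim(4) by (simp add: ennreal_mult nn_integral_cmult integrable_iff_bounded ennreal_mult_less_top)
    show "AE x in lborel. ennreal (norm (f x - s i x)) \<le> ennreal (3 * norm (f x))" for i
    proof (rule AE_I2, rule ennreal_leI)
      fix x
      \<comment> \<open>The induction rule supplies simple functions with
        \<open>norm (s i x) \<le> 2 * norm (f x)\<close>, which accounts for the factor 3 in the
        dominating function.\<close>
      have "norm (f x - s i x) \<le> norm (f x) + norm (s i x)" by (rule norm_triangle_ineq4)
      then show "norm (f x - s i x) \<le> 3 * norm (f x)" using lim(3)[of x i] by simp
    qed
    show "AE x in lborel. (\<lambda>i. ennreal (norm (f x - s i x))) \<longlonglongrightarrow> 0"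
    proof (rule AE_I2)
      fix x :: real
      have "(\<lambda>i. norm (f x - s i x)) \<longlonglongrightarrow> norm (f x - f x)"
        using lim(2)[of x] by (intro tendsto_intros) auto
      then show "(\<lambda>i. ennreal (norm (f x - s i x))) \<longlonglongrightarrow> 0" using tendsto_ennrealI by fastforce
    qed
  qed auto
  then have lim0: "(\<lambda>i. \<integral>\<^sup>+t. ennreal (norm (f t - s i t)) \<partial>lborel) \<longlonglongrightarrow> 0" by simp
  show ?case
  proof (rule tendsto_zero_ennreal_approx)
    fix \<epsilon> :: real assume \<epsilon>: "\<epsilon> > 0"
    have "eventually (\<lambda>i. (\<integral>\<^sup>+t. ennreal (norm (f t - s i t)) \<partial>lborel) < ennreal (\<epsilon>/2)) sequentially"
      using lim0 \<epsilon> by (intro order_tendstoD) auto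
    then obtain i where i: "(\<integral>\<^sup>+t. ennreal (norm (f t - s i t)) \<partial>lborel) < ennreal (\<epsilon>/2)"
      by (auto simp: eventually_sequentially)
    have "(\<integral>\<^sup>+t. ennreal (norm (f (t + y n) - f t)) \<partial>lborel)
        \<le> (\<integral>\<^sup>+t. ennreal (norm (s i (t + y n) - s i t)) \<partial>lborel) + ennreal \<epsilon>" for n
    proof -
      have "(\<integral>\<^sup>+t. ennreal (norm (f (t + y n) - f t)) \<partial>lborel)
        \<le> (\<integral>\<^sup>+t. ennreal (norm (s i (t + y n) - s i t)) \<partial>lborel) + 2 * (\<integral>\<^sup>+t. ennreal (norm (f t - s i t)) \<partial>lborel)"
        by (rule translation_diff_le) auto
      also have "2 * (\<integral>\<^sup>+t. ennreal (norm (f t - s i t)) \<partial>lborel) \<le> 2 * ennreal (\<epsilon>/2)"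
        using i by (intro mult_left_mono) auto
      also have "\<dots> = ennreal (2 * (\<epsilon>/2))" using \<epsilon> by (subst ennreal_mult) auto
      also have "\<dots> = ennreal \<epsilon>" by simp
      finally show ?thesis by (simp add: add_left_mono)
    qed
    then show "\<exists>G. G \<longlonglongrightarrow> 0 \<and> (\<forall>n. (\<integral>\<^sup>+t. ennreal (norm (f (t + y n) - f t)) \<partial>lborel) \<le> G n + ennreal \<epsilon>)"
      using lim(5)[of i] by blast
  qed
qed

section \<open>Closed spans of translates\<close>

definition conv :: "(real \<Rightarrow> complex) \<Rightarrow> (real \<Rightarrow> complex) \<Rightarrow> real \<Rightarrow> complex" where
  "conv u h t = (\<integral>y. u y * h (t - y) \<partial>lborel)"

text \<open>Minkowski's integral inequality with powers instead of roots. For p = 2 the weight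
  \<open>norm (w y)\<close> is split into two square roots for Cauchy-Schwarz, which leaves one
  factor of the total mass of \<open>w\<close>; hence the exponent \<open>p - 1\<close>.\<close>

lemma nn_integral_mixture_le:
  fixes w :: "real \<Rightarrow> complex" and d :: "real \<Rightarrow> real \<Rightarrow> complex"
  assumes p: "p = 1 \<or> p = (2::nat)" and [measurable]: "w \<in> borel_measurable borel"
    "(\<lambda>(y, t). d y t) \<in> borel_measurable (borel \<Otimes>\<^sub>M borel)"
  shows "(\<integral>\<^sup>+t. ennreal (norm (\<integral>y. w y * d y t \<partial>lborel) ^ p) \<partial>lborel)
     \<le> (\<integral>\<^sup>+y. ennreal (norm (w y)) \<partial>lborel) ^ (p - 1) *
        (\<integral>\<^sup>+y. ennreal (norm (w y)) * (\<integral>\<^sup>+t. ennreal (norm (d y t) ^ p) \<partial>lborel) \<partial>lborel)"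
proof -
  let ?w = "\<integral>\<^sup>+y. ennreal (norm (w y)) \<partial>lborel"
  have 1: "ennreal (norm (\<integral>y. w y * d y t \<partial>lborel)) \<le> (\<integral>\<^sup>+y. ennreal (norm (w y)) * ennreal (norm (d y t)) \<partial>lborel)" for t
  \<comment> \<open>Where the integrand is not integrable its Bochner integral is 0 by convention,
    and the bound holds trivially.\<close>
  proof (cases "integrable lborel (\<lambda>y. w y * d y t)")
    case True
    from integral_norm_bound_ennreal[OF this] show ?thesis
      by (simp add: norm_mult ennreal_mult)
  qed (simp add: not_integrable_integral_eq)
  have 2: "ennreal (norm (\<integral>y. w y * d y t \<partial>lborel) ^ p)
      \<le> ?w ^ (p - 1) * (\<integral>\<^sup>+y. ennreal (norm (w y)) * ennreal (norm (d y t) ^ p) \<partial>lborel)" for t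
  proof (cases "p = 1")
    case True
    then show ?thesis using 1 by simp
  next
    case False
    then have p2: "p = 2" using p by simp
    have "ennreal (norm (\<integral>y. w y * d y t \<partial>lborel) ^ 2) = ennreal (norm (\<integral>y. w y * d y t \<partial>lborel)) ^ 2"
      by (simp add: ennreal_power)
    also have "\<dots> \<le> (\<integral>\<^sup>+y. ennreal (norm (w y)) * ennreal (norm (d y t)) \<partial>lborel) ^ 2"
      by (intro power_mono 1) auto
    also have "(\<integral>\<^sup>+y. ennreal (norm (w y)) * ennreal (norm (d y t)) \<partial>lborel)
       = (\<integral>\<^sup>+y. ennreal (sqrt (norm (w y))) * ennreal (sqrt (norm (w y)) * norm (d y t)) \<partial>lborel)"
      by (intro nn_integral_cong) (simp add: ennreal_mult[symmetric] mult.assoc[symmetric])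
    also have "\<dots> ^ 2 \<le> (\<integral>\<^sup>+y. ennreal (sqrt (norm (w y))) ^ 2 \<partial>lborel) *
        (\<integral>\<^sup>+y. ennreal (sqrt (norm (w y)) * norm (d y t)) ^ 2 \<partial>lborel)"
      by (rule Cauchy_Schwarz_nn_integral) auto
    also have "\<dots> = ?w * (\<integral>\<^sup>+y. ennreal (norm (w y)) * ennreal (norm (d y t) ^ p) \<partial>lborel)"
      by (simp add: ennreal_power power_mult_distrib ennreal_mult p2)
    finally show ?thesis by (simp add: p2)
  qed
  have "(\<integral>\<^sup>+t. ennreal (norm (\<integral>y. w y * d y t \<partial>lborel) ^ p) \<partial>lborel)
    \<le> (\<integral>\<^sup>+t. ?w ^ (p - 1) * (\<integral>\<^sup>+y. ennreal (norm (w y)) * ennreal (norm (d y t) ^ p) \<partial>lborel) \<partial>lborel)"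
    by (intro nn_integral_mono 2)
  also have "\<dots> = ?w ^ (p - 1) * (\<integral>\<^sup>+t. (\<integral>\<^sup>+y. ennreal (norm (w y)) * ennreal (norm (d y t) ^ p) \<partial>lborel) \<partial>lborel)"
    by (intro nn_integral_cmult) measurable
  also have "(\<integral>\<^sup>+t. (\<integral>\<^sup>+y. ennreal (norm (w y)) * ennreal (norm (d y t) ^ p) \<partial>lborel) \<partial>lborel)
     = (\<integral>\<^sup>+y. (\<integral>\<^sup>+t. ennreal (norm (w y)) * ennreal (norm (d y t) ^ p) \<partial>lborel) \<partial>lborel)"
    by (rule lborel_pair.Fubini') measurable
  also have "\<dots> = (\<integral>\<^sup>+y. ennreal (norm (w y)) * (\<integral>\<^sup>+t. ennreal (norm (d y t) ^ p) \<partial>lborel) \<partial>lborel)"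
    by (intro nn_integral_cong nn_integral_cmult) measurable
  finally show ?thesis .
qed

lemma nn_integral_power_translate:
  fixes g :: "real \<Rightarrow> complex"
  assumes [measurable]: "g \<in> borel_measurable borel"
  shows "(\<integral>\<^sup>+t. ennreal (norm (g (t - a)) ^ p) \<partial>lborel) = (\<integral>\<^sup>+t. ennreal (norm (g t) ^ p) \<partial>lborel)"
  using nn_integral_translate[of "\<lambda>t. ennreal (norm (g t) ^ p)" "- a"] by simp

text \<open>The shift \<phi> is general because several occur: the identity for convolutions,
  \<open>s * y\<close> for dilated kernels, a step function for grid approximations, and 0 for plain
  products.\<close>

lemma integrable_shift_pair:
  fixes u h :: "real \<Rightarrow> complex"
  assumes u: "integrable lborel u" and h: "integrable lborel h" and [measurable]: "\<phi> \<in> borel_measurable borel"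
  shows "integrable (lborel \<Otimes>\<^sub>M lborel) (\<lambda>(y, t). u y * h (t - \<phi> y))"
proof -
  have [measurable]: "u \<in> borel_measurable borel" "h \<in> borel_measurable borel" using u h by auto
  have "(\<integral>\<^sup>+z. ennreal (norm (case z of (y, t) \<Rightarrow> u y * h (t - \<phi> y))) \<partial>(lborel \<Otimes>\<^sub>M lborel))
     = (\<integral>\<^sup>+y. (\<integral>\<^sup>+t. ennreal (norm (u y * h (t - \<phi> y))) \<partial>lborel) \<partial>lborel)"
    by (subst lborel.nn_integral_fst[symmetric]) auto
  also have "\<dots> = (\<integral>\<^sup>+y. ennreal (norm (u y)) * (\<integral>\<^sup>+t. ennreal (norm (h t)) \<partial>lborel) \<partial>lborel)"
    using nn_integral_power_translate[of h _ 1] by (simp add: norm_mult ennreal_mult nn_integral_cmult)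
  also have "\<dots> < \<infinity>"
    using u h by (simp add: nn_integral_multc integrable_iff_bounded ennreal_mult_less_top)
  finally show ?thesis by (intro integrableI_bounded) auto
qed

lemma AE_integrable_shift:
  fixes u h :: "real \<Rightarrow> complex"
  assumes "integrable lborel u" "integrable lborel h" "\<phi> \<in> borel_measurable borel"
  shows "AE t in lborel. integrable lborel (\<lambda>y. u y * h (t - \<phi> y))"
  by (rule lborel_pair.AE_integrable_snd[OF integrable_shift_pair[OF assms]])

lemma conv_measurable [measurable]:
  assumes [measurable]: "u \<in> borel_measurable borel" "h \<in> borel_measurable borel"
  shows "conv u h \<in> borel_measurable borel"
  unfolding conv_def[abs_def] by measurable

lemma integrable_conv:
  assumes "integrable lborel u" "integrable lborel h"
  shows "integrable lborel (conv u h)"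
  unfolding conv_def[abs_def]
  by (rule lborel_pair.integrable_snd[OF integrable_shift_pair[OF assms]]) auto

lemma nn_integral_conv_le:
  assumes u: "integrable lborel u" and h: "integrable lborel h"
  shows "(\<integral>\<^sup>+t. ennreal (norm (conv u h t)) \<partial>lborel)
    \<le> (\<integral>\<^sup>+t. ennreal (norm (u t)) \<partial>lborel) * (\<integral>\<^sup>+t. ennreal (norm (h t)) \<partial>lborel)"
proof -
  have [measurable]: "u \<in> borel_measurable borel" "h \<in> borel_measurable borel" using u h by auto
  have "(\<integral>\<^sup>+t. ennreal (norm (conv u h t) ^ 1) \<partial>lborel)
    \<le> (\<integral>\<^sup>+y. ennreal (norm (u y)) \<partial>lborel) ^ (1 - 1) *
        (\<integral>\<^sup>+y. ennreal (norm (u y)) * (\<integral>\<^sup>+t. ennreal (norm (h (t - y)) ^ 1) \<partial>lborel) \<partial>lborel)"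
    unfolding conv_def by (rule nn_integral_mixture_le) auto
  then show ?thesis
    using nn_integral_power_translate[of h _ 1] by (simp add: nn_integral_multc)
qed

lemma ennreal_quarters: "\<epsilon> \<ge> 0 \<Longrightarrow> 2 * (ennreal (\<epsilon> / 4) + ennreal (\<epsilon> / 4)) = ennreal \<epsilon>"
  by (subst ennreal_plus[symmetric], simp, simp, subst ennreal_numeral[symmetric], subst ennreal_mult[symmetric]) auto

text \<open>Membership of \<open>h\<close> in the closed complex span of the translates of
  \<open>g\<close>. The exponent is a parameter so that L^1 and L^2 share the closure
  properties.\<close>

definition approx_translates :: "nat \<Rightarrow> (real \<Rightarrow> complex) \<Rightarrow> (real \<Rightarrow> complex) \<Rightarrow> bool" where
  "approx_translates p g h \<longleftrightarrow> (\<forall>\<epsilon>>0. \<exists>(m::nat) c a.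
     (\<integral>\<^sup>+x. ennreal (norm (h x - (\<Sum>k<m. c k * g (x + a k))) ^ p) \<partial>lborel) < ennreal \<epsilon>)"

context
  fixes p :: nat and g :: "real \<Rightarrow> complex"
  assumes p: "p = 1 \<or> p = 2" and g_meas [measurable]: "g \<in> borel_measurable borel"
begin

lemma approx_translates_closed:
  assumes [measurable]: "h \<in> borel_measurable borel"
    and "\<And>\<epsilon>. \<epsilon> > 0 \<Longrightarrow> \<exists>h'. h' \<in> borel_measurable borel \<and> approx_translates p g h' \<and>
      (\<integral>\<^sup>+x. ennreal (norm (h x - h' x) ^ p) \<partial>lborel) < ennreal \<epsilon>"
  shows "approx_translates p g h"
  unfolding approx_translates_def
proof (intro allI impI)
  fix \<epsilon> :: real assume \<epsilon>: "\<epsilon> > 0"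
  then obtain h' where [measurable]: "h' \<in> borel_measurable borel" and h': "approx_translates p g h'"
    and b: "(\<integral>\<^sup>+x. ennreal (norm (h x - h' x) ^ p) \<partial>lborel) < ennreal (\<epsilon> / 4)"
    using assms(2)[of "\<epsilon> / 4"] by auto
  from h' \<epsilon> obtain m c a where
    c: "(\<integral>\<^sup>+x. ennreal (norm (h' x - (\<Sum>k<(m::nat). c k * g (x + a k))) ^ p) \<partial>lborel) < ennreal (\<epsilon> / 4)"
    unfolding approx_translates_def by (meson divide_pos_pos zero_less_numeral)
  let ?s = "\<lambda>x. \<Sum>k<m. c k * g (x + a k)"
  have "(\<integral>\<^sup>+x. ennreal (norm (h x - ?s x) ^ p) \<partial>lborel)
    = (\<integral>\<^sup>+x. ennreal (norm ((h x - h' x) + (h' x - ?s x)) ^ p) \<partial>lborel)" by simp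
  also have "\<dots> \<le> 2 * ((\<integral>\<^sup>+x. ennreal (norm (h x - h' x) ^ p) \<partial>lborel) + (\<integral>\<^sup>+x. ennreal (norm (h' x - ?s x) ^ p) \<partial>lborel))"
    by (rule nn_integral_norm_add_le[OF p]) auto
  also have "\<dots> < 2 * (ennreal (\<epsilon>/4) + ennreal (\<epsilon>/4))"
    using add_strict_mono[OF b c] by (intro ennreal_mult_strict_left_mono) auto
  also have "\<dots> = ennreal \<epsilon>" using \<epsilon> by (intro ennreal_quarters) simp
  finally show "\<exists>(m::nat) c a. (\<integral>\<^sup>+x. ennreal (norm (h x - (\<Sum>k<m. c k * g (x + a k))) ^ p) \<partial>lborel) < ennreal \<epsilon>"
    by auto
qed

lemma approx_translates_self: "approx_translates p g (\<lambda>x. c * g (x + a))"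
  unfolding approx_translates_def
  using p by (intro allI impI exI[of _ 1] exI[of _ "\<lambda>_. c"] exI[of _ "\<lambda>_. a"]) auto

lemma approx_translates_zero: "approx_translates p g (\<lambda>x. 0)"
  using approx_translates_self[of 0 0] by simp

lemma approx_translates_add:
  assumes [measurable]: "h \<in> borel_measurable borel" "h' \<in> borel_measurable borel"
    and h: "approx_translates p g h" and h': "approx_translates p g h'"
  shows "approx_translates p g (\<lambda>x. h x + h' x)"
  unfolding approx_translates_def
proof (intro allI impI)
  fix \<epsilon> :: real assume \<epsilon>: "\<epsilon> > 0"
  from h \<epsilon> obtain m c a where
    b: "(\<integral>\<^sup>+x. ennreal (norm (h x - (\<Sum>k<(m::nat). c k * g (x + a k))) ^ p) \<partial>lborel) < ennreal (\<epsilon> / 4)"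
    unfolding approx_translates_def by (meson divide_pos_pos zero_less_numeral)
  from h' \<epsilon> obtain m' c' a' where
    c: "(\<integral>\<^sup>+x. ennreal (norm (h' x - (\<Sum>k<(m'::nat). c' k * g (x + a' k))) ^ p) \<partial>lborel) < ennreal (\<epsilon> / 4)"
    unfolding approx_translates_def by (meson divide_pos_pos zero_less_numeral)
  let ?s = "\<lambda>x. \<Sum>k<m. c k * g (x + a k)" and ?s' = "\<lambda>x. \<Sum>k<m'. c' k * g (x + a' k)"
  define C where "C k = (if k < m then c k else c' (k - m))" for k
  define A where "A k = (if k < m then a k else a' (k - m))" for k
  have "(\<Sum>k<m+m'. C k * g (x + A k)) = (\<Sum>k<m. C k * g (x + A k)) + (\<Sum>k<m'. C (m + k) * g (x + A (m + k)))" for x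
    by (induction m') (simp_all add: add.assoc)
  then have S: "(\<Sum>k<m+m'. C k * g (x + A k)) = ?s x + ?s' x" for x
    by (simp add: C_def A_def)
  have "(\<integral>\<^sup>+x. ennreal (norm (h x + h' x - (\<Sum>k<m+m'. C k * g (x + A k))) ^ p) \<partial>lborel)
    = (\<integral>\<^sup>+x. ennreal (norm ((h x - ?s x) + (h' x - ?s' x)) ^ p) \<partial>lborel)" unfolding S by (simp add: algebra_simps)
  also have "\<dots> \<le> 2 * ((\<integral>\<^sup>+x. ennreal (norm (h x - ?s x) ^ p) \<partial>lborel) + (\<integral>\<^sup>+x. ennreal (norm (h' x - ?s' x) ^ p) \<partial>lborel))"
    by (rule nn_integral_norm_add_le[OF p]) auto
  also have "\<dots> < 2 * (ennreal (\<epsilon>/4) + ennreal (\<epsilon>/4))"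
    using add_strict_mono[OF b c] by (intro ennreal_mult_strict_left_mono) auto
  also have "\<dots> = ennreal \<epsilon>" using \<epsilon> by (intro ennreal_quarters) simp
  finally show "\<exists>(m::nat) c a. (\<integral>\<^sup>+x. ennreal (norm (h x + h' x - (\<Sum>k<m. c k * g (x + a k))) ^ p) \<partial>lborel) < ennreal \<epsilon>"
    by auto
qed

lemma approx_translates_cmult:
  assumes [measurable]: "h \<in> borel_measurable borel" and h: "approx_translates p g h"
  shows "approx_translates p g (\<lambda>x. z * h x)"
proof (cases "z = 0")
  case True
  then show ?thesis using approx_translates_zero by simp
next
  case False
  show ?thesis
    unfolding approx_translates_def
  proof (intro allI impI)
    fix \<epsilon> :: real assume \<epsilon>: "\<epsilon> > 0"
    have z: "norm z ^ p > 0" using False by simp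
    then obtain m c a where
      b: "(\<integral>\<^sup>+x. ennreal (norm (h x - (\<Sum>k<(m::nat). c k * g (x + a k))) ^ p) \<partial>lborel) < ennreal (\<epsilon> / norm z ^ p)"
      using h \<epsilon> unfolding approx_translates_def by (meson divide_pos_pos)
    have eq: "ennreal (norm (z * h x - (\<Sum>k<m. z * c k * g (x + a k))) ^ p)
        = ennreal (norm z ^ p) * ennreal (norm (h x - (\<Sum>k<(m::nat). c k * g (x + a k))) ^ p)" for x
    proof -
      have "z * h x - (\<Sum>k<m. z * c k * g (x + a k)) = z * (h x - (\<Sum>k<m. c k * g (x + a k)))"
        by (simp add: sum_distrib_left algebra_simps)
      then show ?thesis by (simp add: norm_mult power_mult_distrib ennreal_mult)
    qed
    have "(\<integral>\<^sup>+x. ennreal (norm (z * h x - (\<Sum>k<m. z * c k * g (x + a k))) ^ p) \<partial>lborel)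
       = ennreal (norm z ^ p) * (\<integral>\<^sup>+x. ennreal (norm (h x - (\<Sum>k<(m::nat). c k * g (x + a k))) ^ p) \<partial>lborel)"
      unfolding eq by (rule nn_integral_cmult) measurable
    also have "\<dots> < ennreal (norm z ^ p) * ennreal (\<epsilon> / norm z ^ p)"
      using z by (intro ennreal_mult_strict_left_mono b) auto
    also have "\<dots> = ennreal \<epsilon>" using False \<epsilon> by (subst ennreal_mult[symmetric]) auto
    finally show "\<exists>(m::nat) c a. (\<integral>\<^sup>+x. ennreal (norm (z * h x - (\<Sum>k<m. c k * g (x + a k))) ^ p) \<partial>lborel) < ennreal \<epsilon>"
      by (intro exI[of _ m] exI[of _ "\<lambda>k. z * c k"] exI[of _ a]) simp
  qed
qed

lemma approx_translates_sum:
  assumes "finite S" "\<And>i. i \<in> S \<Longrightarrow> h i \<in> borel_measurable borel" "\<And>i. i \<in> S \<Longrightarrow> approx_translates p g (h i)"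
  shows "approx_translates p g (\<lambda>x. \<Sum>i\<in>S. h i x)"
  using assms
proof (induction S rule: finite_induct)
  case empty
  then show ?case using approx_translates_zero by simp
next
  case (insert i S)
  have "approx_translates p g (\<lambda>x. h i x + (\<Sum>j\<in>S. h j x))"
    using insert by (intro approx_translates_add borel_measurable_sum) auto
  then show ?case using insert(1,2) by simp
qed

text \<open>The convolution is approximated by replacing the translation parameter \<open>y\<close> by the
  nearest grid point below it, which turns the integral into a finite sum of translates.\<close>

theorem approx_translates_conv:
  assumes u: "integrable lborel u" and g: "integrable lborel g"
    and gp: "(\<integral>\<^sup>+t. ennreal (norm (g t) ^ p) \<partial>lborel) < \<infinity>"
    and cont: "\<And>y. y \<longlonglongrightarrow> 0 \<Longrightarrow> (\<lambda>n. \<integral>\<^sup>+t. ennreal (norm (g (t + y n) - g t) ^ p) \<partial>lborel) \<longlonglongrightarrow> 0"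
  shows "approx_translates p g (conv u g)"
proof -
  have [measurable]: "u \<in> borel_measurable borel" using u by auto
  define q :: "nat \<Rightarrow> real \<Rightarrow> real" where "q n y = real_of_int \<lfloor>real (Suc n) * y\<rfloor> / real (Suc n)" for n y
  have [measurable]: "q n \<in> borel_measurable borel" for n unfolding q_def[abs_def] by measurable
  \<comment> \<open>The window is half-open and its ends are multiples of the mesh
    \<open>1 / Suc n\<close>. It is thus an exact union of grid cells, finitely many, and
    \<open>s n\<close> becomes a finite sum of translates.\<close>
  define w :: "nat \<Rightarrow> real \<Rightarrow> complex" where "w n y = indicator {- real (Suc n)..<real (Suc n)} y" for n y
  have [measurable]: "w n \<in> borel_measurable borel" for n unfolding w_def[abs_def] by measurable
  define s where "s n t = (\<integral>y. u y * (w n y * g (t - q n y)) \<partial>lborel)" for n t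
  have s_meas [measurable]: "s n \<in> borel_measurable borel" for n unfolding s_def[abs_def] by measurable
  have q_close: "\<bar>q n y - y\<bar> \<le> 1 / real (Suc n)" for n y
  proof -
    have "\<bar>real_of_int \<lfloor>real (Suc n) * y\<rfloor> - real (Suc n) * y\<bar> \<le> 1" by linarith
    then have "\<bar>real_of_int \<lfloor>real (Suc n) * y\<rfloor> - real (Suc n) * y\<bar> / real (Suc n) \<le> 1 / real (Suc n)"
      by (intro divide_right_mono) auto
    moreover have "q n y - y = (real_of_int \<lfloor>real (Suc n) * y\<rfloor> - real (Suc n) * y) / real (Suc n)"
      unfolding q_def by (simp add: diff_divide_distrib del: of_nat_Suc)
    ultimately show ?thesis by (simp add: abs_divide del: of_nat_Suc)
  qed
  have s_approx: "approx_translates p g (s n)" for n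
  proof -
    let ?m = "real (Suc n)"
    define S where "S = {- (int (Suc n) * int (Suc n))..<int (Suc n) * int (Suc n)}"
    define c where "c k = (\<integral>y. u y * indicator {y. \<lfloor>?m * y\<rfloor> = k} y \<partial>lborel)" for k
    have S_w: "w n y = indicator S \<lfloor>?m * y\<rfloor>" for y
    proof -
      have "(- ?m \<le> y) = (- (int (Suc n) * int (Suc n)) \<le> \<lfloor>?m * y\<rfloor>)"
      proof -
        have "(- ?m \<le> y) = (?m * (- ?m) \<le> ?m * y)" by (subst mult_le_cancel_left_pos) auto
        also have "?m * (- ?m) = real_of_int (- (int (Suc n) * int (Suc n)))" by (simp add: algebra_simps)
        finally show ?thesis by (simp only: le_floor_iff)
      qed
      moreover have "(y < ?m) = (\<lfloor>?m * y\<rfloor> < int (Suc n) * int (Suc n))"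
      proof -
        have "(y < ?m) = (?m * y < ?m * ?m)" by (subst mult_less_cancel_left_pos) auto
        also have "?m * ?m = real_of_int (int (Suc n) * int (Suc n))" by simp
        finally show ?thesis by (simp only: floor_less_iff)
      qed
      ultimately show ?thesis by (auto simp: w_def S_def indicator_def)
    qed
    have "s n t = (\<Sum>k\<in>S. c k * g (t + (- real_of_int k / ?m)))" for t
    proof -
      have "u y * (w n y * g (t - q n y)) = (\<Sum>k\<in>S. u y * indicator {y. \<lfloor>?m * y\<rfloor> = k} y * g (t + (- real_of_int k / ?m)))" for y
      proof -
        have "(\<Sum>k\<in>S. u y * indicator {y. \<lfloor>?m * y\<rfloor> = k} y * g (t + (- real_of_int k / ?m)))
          = (\<Sum>k\<in>S. if k = \<lfloor>?m * y\<rfloor> then u y * g (t + (- real_of_int k / ?m)) else 0)"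
          by (intro sum.cong) (auto simp: indicator_def)
        also have "\<dots> = (if \<lfloor>?m * y\<rfloor> \<in> S then u y * g (t + (- real_of_int \<lfloor>?m * y\<rfloor> / ?m)) else 0)"
          by (subst sum.delta) (auto simp: S_def)
        finally show ?thesis unfolding S_w q_def by (simp add: indicator_def)
      qed
      then have "s n t = (\<integral>y. (\<Sum>k\<in>S. u y * indicator {y. \<lfloor>?m * y\<rfloor> = k} y * g (t + (- real_of_int k / ?m))) \<partial>lborel)"
        by (simp add: s_def)
      also have "\<dots> = (\<Sum>k\<in>S. \<integral>y. u y * indicator {y. \<lfloor>?m * y\<rfloor> = k} y * g (t + (- real_of_int k / ?m)) \<partial>lborel)"
        by (rule Bochner_Integration.integral_sum)
           (intro integrable_mult_left Bochner_Integration.integrable_bound[OF u], auto simp: indicator_def)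
      also have "\<dots> = (\<Sum>k\<in>S. c k * g (t + (- real_of_int k / ?m)))"
        by (simp add: c_def)
      finally show ?thesis .
    qed
    then have "s n = (\<lambda>t. \<Sum>k\<in>S. c k * g (t + (- real_of_int k / ?m)))" by blast
    then show ?thesis
      by (simp only:) (intro approx_translates_sum approx_translates_self, auto simp: S_def)
  qed
  define \<Phi> where "\<Phi> n y = (\<integral>\<^sup>+t. ennreal (norm (g (t - y) - w n y * g (t - q n y)) ^ p) \<partial>lborel)" for n y
  have [measurable]: "\<Phi> n \<in> borel_measurable borel" for n unfolding \<Phi>_def[abs_def] by measurable
  let ?G = "\<integral>\<^sup>+t. ennreal (norm (g t) ^ p) \<partial>lborel" and ?U = "\<integral>\<^sup>+y. ennreal (norm (u y)) \<partial>lborel"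
  \<comment> \<open>Two translates of \<open>g\<close> contribute \<open>?G\<close> each, and the
    power form of the triangle inequality doubles their sum. The bound is uniform in
    \<open>n\<close> and \<open>y\<close>, as dominated convergence requires.\<close>
  have \<Phi>_le: "\<Phi> n y \<le> 4 * ?G" for n y
  proof -
    have "\<Phi> n y = (\<integral>\<^sup>+t. ennreal (norm (g (t - y) + - (w n y * g (t - q n y))) ^ p) \<partial>lborel)"
      unfolding \<Phi>_def by simp
    also have "\<dots> \<le> 2 * ((\<integral>\<^sup>+t. ennreal (norm (g (t - y)) ^ p) \<partial>lborel) + (\<integral>\<^sup>+t. ennreal (norm (- (w n y * g (t - q n y))) ^ p) \<partial>lborel))"
      by (rule nn_integral_norm_add_le[OF p]) auto
    also have "(\<integral>\<^sup>+t. ennreal (norm (- (w n y * g (t - q n y))) ^ p) \<partial>lborel) \<le> (\<integral>\<^sup>+t. ennreal (norm (g (t - q n y)) ^ p) \<partial>lborel)"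
      by (intro nn_integral_mono ennreal_leI power_mono) (auto simp: w_def norm_mult indicator_def)
    finally show ?thesis by (simp add: nn_integral_power_translate mult_2[symmetric] mult.assoc[symmetric] add_left_mono mult_left_mono)
  qed
  have \<Phi>_lim: "(\<lambda>n. \<Phi> n y) \<longlonglongrightarrow> 0" for y
  proof (rule Lim_transform_eventually)
    have "(\<lambda>n. 1 / real (Suc n)) \<longlonglongrightarrow> 0" by (rule LIMSEQ_Suc[OF lim_1_over_n])
    then have "(\<lambda>n. q n y - y) \<longlonglongrightarrow> 0"
      by (rule Lim_null_comparison[rotated]) (use q_close in \<open>auto intro!: always_eventually\<close>)
    then show "(\<lambda>n. \<integral>\<^sup>+t. ennreal (norm (g (t + (q n y - y)) - g t) ^ p) \<partial>lborel) \<longlonglongrightarrow> 0"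
      by (rule cont)
    obtain N :: nat where N: "\<bar>y\<bar> < real N" using reals_Archimedean2 by blast
    \<comment> \<open>As soon as \<open>y\<close> lies in the window the cut-off equals 1;
      translating by \<open>q n y\<close> then leaves the difference of \<open>g\<close> and its
      shift by \<open>q n y - y\<close>, which tends to 0.\<close>
    show "eventually (\<lambda>n. (\<integral>\<^sup>+t. ennreal (norm (g (t + (q n y - y)) - g t) ^ p) \<partial>lborel) = \<Phi> n y) sequentially"
      using eventually_ge_at_top[of N]
    proof eventually_elim
      case (elim n)
      then have "w n y = 1" using N by (auto simp: w_def indicator_def)
      then show ?case
        unfolding \<Phi>_def
        using nn_integral_translate[of "\<lambda>t. ennreal (norm (g (t + (q n y - y)) - g t) ^ p)" "- q n y"]
        by simp
    qed
  qed
  have lim: "(\<lambda>n. \<integral>\<^sup>+y. ennreal (norm (u y)) * \<Phi> n y \<partial>lborel) \<longlonglongrightarrow> (\<integral>\<^sup>+(y::real). 0 \<partial>lborel)"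
  proof (rule nn_integral_dominated_convergence)
    show "(\<integral>\<^sup>+y. ennreal (norm (u y)) * (4 * ?G) \<partial>lborel) < \<infinity>"
      using u gp by (simp add: nn_integral_multc integrable_iff_bounded ennreal_mult_less_top)
    show "AE y in lborel. ennreal (norm (u y)) * \<Phi> n y \<le> ennreal (norm (u y)) * (4 * ?G)" for n
      by (intro AE_I2 mult_left_mono \<Phi>_le) auto
    show "AE y in lborel. (\<lambda>n. ennreal (norm (u y)) * \<Phi> n y) \<longlonglongrightarrow> 0"
    proof (rule AE_I2)
      fix y :: real
      show "(\<lambda>n. ennreal (norm (u y)) * \<Phi> n y) \<longlonglongrightarrow> 0"
        using ennreal_tendsto_cmult[OF _ \<Phi>_lim[of y], of "ennreal (norm (u y))"] by simp
    qed
  qed auto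
  have Ufin: "?U ^ (p - 1) < top" using u by (auto simp: integrable_iff_bounded power_less_top_ennreal)
  have lim': "(\<lambda>n. ?U ^ (p - 1) * (\<integral>\<^sup>+y. ennreal (norm (u y)) * \<Phi> n y \<partial>lborel)) \<longlonglongrightarrow> 0"
    using ennreal_tendsto_cmult[OF Ufin lim] by simp
  have diff: "(\<integral>\<^sup>+t. ennreal (norm (conv u g t - s n t) ^ p) \<partial>lborel)
     \<le> ?U ^ (p - 1) * (\<integral>\<^sup>+y. ennreal (norm (u y)) * \<Phi> n y \<partial>lborel)" for n
  proof -
    have uw: "integrable lborel (\<lambda>y. u y * w n y)"
      by (rule Bochner_Integration.integrable_bound[OF u]) (auto simp: w_def indicator_def)
    \<comment> \<open>Both integrals converge only for almost every \<open>t\<close>, by Fubini;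
      elsewhere the difference could not be taken under the integral sign.\<close>
    have "AE t in lborel. conv u g t - s n t = (\<integral>y. u y * (g (t - y) - w n y * g (t - q n y)) \<partial>lborel)"
      using AE_integrable_shift[OF u g, of "\<lambda>y. y"] AE_integrable_shift[OF uw g, of "q n"]
    proof (simp, elim AE_mp, intro AE_I2 impI)
      fix t assume a: "integrable lborel (\<lambda>y. u y * g (t - y))" "integrable lborel (\<lambda>y. u y * w n y * g (t - q n y))"
      show "conv u g t - s n t = (\<integral>y. u y * (g (t - y) - w n y * g (t - q n y)) \<partial>lborel)"
        unfolding conv_def s_def using a
        by (subst Bochner_Integration.integral_diff[symmetric]) (auto simp: algebra_simps)
    qed
    then have "(\<integral>\<^sup>+t. ennreal (norm (conv u g t - s n t) ^ p) \<partial>lborel)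
      = (\<integral>\<^sup>+t. ennreal (norm (\<integral>y. u y * (g (t - y) - w n y * g (t - q n y)) \<partial>lborel) ^ p) \<partial>lborel)"
      by (intro nn_integral_cong_AE) (auto elim!: eventually_mono)
    also have "\<dots> \<le> ?U ^ (p - 1) * (\<integral>\<^sup>+y. ennreal (norm (u y)) * \<Phi> n y \<partial>lborel)"
      unfolding \<Phi>_def by (rule nn_integral_mixture_le[OF p]) auto
    finally show ?thesis .
  qed
  show ?thesis
  proof (rule approx_translates_closed)
    show "conv u g \<in> borel_measurable borel" by measurable
    fix \<epsilon> :: real assume "\<epsilon> > 0"
    then have "eventually (\<lambda>n. ?U ^ (p - 1) * (\<integral>\<^sup>+y. ennreal (norm (u y)) * \<Phi> n y \<partial>lborel) < ennreal \<epsilon>) sequentially"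
      by (intro order_tendstoD[OF lim']) auto
    then obtain n where "?U ^ (p - 1) * (\<integral>\<^sup>+y. ennreal (norm (u y)) * \<Phi> n y \<partial>lborel) < ennreal \<epsilon>"
      by (auto simp: eventually_sequentially)
    then have "(\<integral>\<^sup>+x. ennreal (norm (conv u g x - s n x) ^ p) \<partial>lborel) < ennreal \<epsilon>"
      by (rule order.strict_trans1[OF diff])
    then show "\<exists>h'. h' \<in> borel_measurable borel \<and> approx_translates p g h' \<and>
      (\<integral>\<^sup>+x. ennreal (norm (conv u g x - h' x) ^ p) \<partial>lborel) < ennreal \<epsilon>"
      using s_approx s_meas by blast
  qed
qed

end

section \<open>Fourier transform and convolution\<close>

definition ft :: "(real \<Rightarrow> complex) \<Rightarrow> real \<Rightarrow> complex" where
  "ft h x = (\<integral>t. cis (- (x * t)) * h t \<partial>lborel)"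

text \<open>The normalisation is the one for which \<open>ft (ift K) = K\<close>.\<close>

definition ift :: "(real \<Rightarrow> complex) \<Rightarrow> real \<Rightarrow> complex" where
  "ift K t = ft K (- t) / complex_of_real (2 * pi)"

lemma fourier_eq_ft: "fourier f = ft (\<lambda>t. complex_of_real (f t))"
  by (simp add: fun_eq_iff fourier_def ft_def cis_conv_exp)

lemma integrable_cis_mult:
  assumes h: "integrable M h" and [measurable]: "\<phi> \<in> borel_measurable M"
  shows "integrable M (\<lambda>t. cis (\<phi> t) * h t)"
proof -
  have [measurable]: "h \<in> borel_measurable M" using h by auto
  show ?thesis by (rule Bochner_Integration.integrable_bound[OF h]) (auto simp: norm_mult)
qed

lemma ft_measurable [measurable]:
  assumes [measurable]: "h \<in> borel_measurable borel"
  shows "ft h \<in> borel_measurable borel"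
  unfolding ft_def[abs_def] by measurable

lemma ift_measurable [measurable]:
  assumes [measurable]: "h \<in> borel_measurable borel"
  shows "ift h \<in> borel_measurable borel"
  unfolding ift_def[abs_def] by measurable

lemma norm_ft_le: "norm (ft h x) \<le> (\<integral>t. norm (h t) \<partial>lborel)"
  unfolding ft_def by (rule order_trans[OF integral_norm_bound]) (simp add: norm_mult)

lemma norm_ift_le: "norm (ift h x) \<le> (\<integral>t. norm (h t) \<partial>lborel) / (2 * pi)"
  unfolding ift_def using norm_ft_le[of h "-x"] by (simp add: norm_divide divide_right_mono norm_mult)

lemma isCont_ft:
  assumes h: "integrable lborel h"
  shows "isCont (ft h) x"
  unfolding continuous_at_sequentially
proof (intro allI impI)
  fix X :: "nat \<Rightarrow> real" assume X: "X \<longlonglongrightarrow> x"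
  have [measurable]: "h \<in> borel_measurable borel" using h by auto
  show "(ft h \<circ> X) \<longlonglongrightarrow> ft h x"
    unfolding ft_def comp_def
  proof (rule integral_dominated_convergence)
    show "integrable lborel (\<lambda>t. norm (h t))" using h by simp
    show "AE t in lborel. (\<lambda>n. cis (- (X n * t)) * h t) \<longlonglongrightarrow> cis (- (x * t)) * h t"
      by (intro AE_I2 tendsto_intros X)
  qed (auto simp: norm_mult)
qed

lemma ft_diff: "integrable lborel u \<Longrightarrow> integrable lborel v \<Longrightarrow> ft (\<lambda>t. u t - v t) x = ft u x - ft v x"
  unfolding ft_def
  by (subst Bochner_Integration.integral_diff[symmetric]) (auto simp: right_diff_distrib intro!: integrable_cis_mult)

lemma ft_cmult: "ft (\<lambda>t. c * u t) x = c * ft u x"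
  unfolding ft_def by (subst integral_mult_right_zero[symmetric]) (simp add: algebra_simps)

lemma ft_sum:
  assumes "\<And>i. i \<in> S \<Longrightarrow> integrable lborel (u i)"
  shows "ft (\<lambda>t. \<Sum>i\<in>S. u i t) x = (\<Sum>i\<in>S. ft (u i) x)"
  unfolding ft_def sum_distrib_left
  by (rule Bochner_Integration.integral_sum) (intro integrable_cis_mult assms, auto)

lemma ift_diff: "integrable lborel u \<Longrightarrow> integrable lborel v \<Longrightarrow> ift (\<lambda>t. u t - v t) x = ift u x - ift v x"
  by (simp add: ift_def ft_diff diff_divide_distrib)

lemma ift_cmult: "ift (\<lambda>t. c * u t) x = c * ift u x"
  by (simp add: ift_def ft_cmult)

lemma ift_sum:
  "(\<And>i. i \<in> S \<Longrightarrow> integrable lborel (u i)) \<Longrightarrow> ift (\<lambda>t. \<Sum>i\<in>S. u i t) x = (\<Sum>i\<in>S. ift (u i) x)"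
  by (simp add: ift_def ft_sum sum_divide_distrib)

lemma ft_scale:
  assumes "s > 0"
  shows "ft (\<lambda>t. of_real s * h (s * t)) x = ft h (x / s)"
  unfolding ft_def using assms
  by (subst lborel_integral_real_affine[of s "\<lambda>t. cis (- (x / s * t)) * h t" 0])
     (auto simp: scaleR_conv_of_real algebra_simps intro!: integral_mult_right_zero[symmetric])

lemma ft_modulate: "ft (\<lambda>t. cis (a * t) * h t) x = ft h (x - a)"
proof -
  have "cis (- (x * t)) * (cis (a * t) * h t) = cis (- ((x - a) * t)) * h t" for t
    by (simp add: mult.assoc[symmetric] cis_mult left_diff_distrib)
  then show ?thesis by (simp only: ft_def)
qed

lemma ft_cnj: "ft (\<lambda>t. cnj (h t)) x = cnj (ft h (- x))"
  unfolding ft_def Bochner_Integration.integral_cnj[symmetric]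
  by (rule Bochner_Integration.integral_cong) (auto simp: cis_cnj)

lemma integral_conv:
  assumes u: "integrable lborel u" and h: "integrable lborel h"
  shows "(\<integral>t. conv u h t \<partial>lborel) = (\<integral>t. u t \<partial>lborel) * (\<integral>t. h t \<partial>lborel)"
proof -
  have "(\<integral>t. conv u h t \<partial>lborel) = (\<integral>y. (\<integral>t. u y * h (t - y) \<partial>lborel) \<partial>lborel)"
    unfolding conv_def
    by (rule lborel_pair.Fubini_integral) (rule integrable_shift_pair[OF u h], simp)
  also have "(\<integral>t. h (t - y) \<partial>lborel) = (\<integral>t. h t \<partial>lborel)" for y
    using lborel_integral_real_affine[of 1 h "-y"] by (simp add: add.commute)
  then have "(\<integral>y. (\<integral>t. u y * h (t - y) \<partial>lborel) \<partial>lborel) = (\<integral>y. u y * (\<integral>t. h t \<partial>lborel) \<partial>lborel)"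
    by simp
  finally show ?thesis by simp
qed

text \<open>A character is multiplicative, so multiplying a convolution by it means convolving the
  two multiplied factors. The claim becomes the formula for the total integral of a
  convolution.\<close>

theorem ft_conv:
  assumes u: "integrable lborel u" and h: "integrable lborel h"
  shows "ft (conv u h) x = ft u x * ft h x"
proof -
  have eq: "cis (- (x * t)) * conv u h t = conv (\<lambda>t. cis (- (x * t)) * u t) (\<lambda>t. cis (- (x * t)) * h t) t" for t
    unfolding conv_def
  proof (subst integral_mult_right_zero[symmetric], rule Bochner_Integration.integral_cong[OF refl])
    fix y
    have "cis (- (x * t)) = cis (- (x * y)) * cis (- (x * (t - y)))"
      by (simp add: cis_mult algebra_simps)
    then show "cis (- (x * t)) * (u y * h (t - y)) = cis (- (x * y)) * u y * (cis (- (x * (t - y))) * h (t - y))"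
      by simp
  qed
  show ?thesis unfolding ft_def[of "conv u h"] eq
    by (subst integral_conv) (auto intro!: integrable_cis_mult u h simp: ft_def)
qed

section \<open>Frequency multipliers and dilated kernels\<close>

lemma integrable_product_pair:
  fixes u K :: "real \<Rightarrow> complex"
  assumes u: "integrable lborel u" and K: "integrable lborel K"
  shows "integrable (lborel \<Otimes>\<^sub>M lborel) (\<lambda>(y, t). u y * K t)"
  using integrable_shift_pair[OF u K, of "\<lambda>_. 0"] by simp

lemma integrable_cis_pair:
  fixes u K :: "real \<Rightarrow> complex"
  assumes u: "integrable lborel u" and K: "integrable lborel K"
    and [measurable]: "(\<lambda>(y, t). \<phi> y t) \<in> borel_measurable (borel \<Otimes>\<^sub>M borel)"
  shows "integrable (lborel \<Otimes>\<^sub>M lborel) (\<lambda>(y, t). cis (\<phi> y t) * (u y * K t))"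
proof -
  have "integrable (lborel \<Otimes>\<^sub>M lborel) (\<lambda>z. cis (case z of (y, t) \<Rightarrow> \<phi> y t) * (case z of (y, t) \<Rightarrow> u y * K t))"
    by (intro integrable_cis_mult integrable_product_pair u K) measurable
  then show ?thesis by (simp add: case_prod_beta')
qed

lemma Fubini_cis:
  fixes u K :: "real \<Rightarrow> complex"
  assumes u: "integrable lborel u" and K: "integrable lborel K"
    and m: "(\<lambda>(y, t). \<phi> y t) \<in> borel_measurable (borel \<Otimes>\<^sub>M borel)"
  shows "(\<integral>y. (\<integral>t. cis (\<phi> y t) * (u y * K t) \<partial>lborel) \<partial>lborel) = (\<integral>t. (\<integral>y. cis (\<phi> y t) * (u y * K t) \<partial>lborel) \<partial>lborel)"
  by (rule lborel_pair.Fubini_integral[symmetric]) (rule integrable_cis_pair[OF assms])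

text \<open>Convolution acts on an inverse transform as multiplication of the spectrum by
  \<open>ft u\<close>. Fubini is applied to the integrable product \<open>u y * K \<xi>\<close>, so
  the identity is available even when \<open>ift K\<close> is not integrable; the L^2 converse
  relies on this.\<close>

theorem conv_ift:
  assumes u: "integrable lborel u" and K: "integrable lborel K"
  shows "conv u (ift K) t = ift (\<lambda>\<xi>. ft u \<xi> * K \<xi>) t"
proof -
  have "(\<integral>y. u y * ft K (- (t - y)) \<partial>lborel) = (\<integral>y. (\<integral>\<xi>. cis (\<xi> * (t - y)) * (u y * K \<xi>) \<partial>lborel) \<partial>lborel)"
    unfolding ft_def by (subst integral_mult_right_zero[symmetric]) (simp add: algebra_simps)
  also have "\<dots> = (\<integral>\<xi>. (\<integral>y. cis (\<xi> * (t - y)) * (u y * K \<xi>) \<partial>lborel) \<partial>lborel)"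
    by (rule Fubini_cis[OF u K]) measurable
  also have "\<dots> = ft (\<lambda>\<xi>. ft u \<xi> * K \<xi>) (- t)"
    unfolding ft_def
  proof (intro Bochner_Integration.integral_cong refl)
    fix \<xi>
    have "cis (\<xi> * (t - y)) * (u y * K \<xi>) = (cis (\<xi> * t) * K \<xi>) * (cis (- (\<xi> * y)) * u y)" for y
    proof -
      have "cis (\<xi> * (t - y)) = cis (\<xi> * t) * cis (- (\<xi> * y))"
        by (simp add: cis_mult algebra_simps)
      then show ?thesis by simp
    qed
    then show "(\<integral>y. cis (\<xi> * (t - y)) * (u y * K \<xi>) \<partial>lborel) =
       cis (- (- t * \<xi>)) * ((\<integral>y. cis (- (\<xi> * y)) * u y \<partial>lborel) * K \<xi>)"
      by (simp only: integral_mult_right_zero) (simp add: mult_ac)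
  qed
  finally show ?thesis by (simp add: conv_def ift_def)
qed

lemma integrable_ft_mult:
  assumes u: "integrable lborel u" and K: "integrable lborel K"
  shows "integrable lborel (\<lambda>\<xi>. ft u \<xi> * K \<xi>)"
proof -
  have [measurable]: "u \<in> borel_measurable borel" "K \<in> borel_measurable borel" using u K by auto
  show ?thesis
  proof (rule Bochner_Integration.integrable_bound)
    show "integrable lborel (\<lambda>\<xi>. (\<integral>t. norm (u t) \<partial>lborel) * norm (K \<xi>))" using K by simp
    show "AE x in lborel. norm (ft u x * K x) \<le> norm ((\<integral>t. norm (u t) \<partial>lborel) * norm (K x))"
      using norm_ft_le by (auto simp: norm_mult intro!: mult_right_mono)
  qed measurable
qed

text \<open>The kernel enters only through \<open>norm (k y)\<close>, so the quantity does not
  change when \<open>k\<close> is multiplied by a character. This is the source of uniformity in the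
  frequency when the localisers are built.\<close>

lemma dilation_continuous:
  fixes k h :: "real \<Rightarrow> complex"
  assumes k: "integrable lborel k" and h: "integrable lborel h" and s: "s \<longlonglongrightarrow> (0::real)"
  shows "(\<lambda>n. \<integral>\<^sup>+y. ennreal (norm (k y)) * (\<integral>\<^sup>+t. ennreal (norm (h (t - s n * y) - h t)) \<partial>lborel) \<partial>lborel) \<longlonglongrightarrow> 0"
proof -
  have [measurable]: "k \<in> borel_measurable borel" "h \<in> borel_measurable borel" using k h by auto
  let ?\<Phi> = "\<lambda>n y. \<integral>\<^sup>+t. ennreal (norm (h (t - s n * y) - h t)) \<partial>lborel"
  let ?H = "\<integral>\<^sup>+t. ennreal (norm (h t)) \<partial>lborel"
  have "(\<lambda>n. \<integral>\<^sup>+y. ennreal (norm (k y)) * ?\<Phi> n y \<partial>lborel) \<longlonglongrightarrow> (\<integral>\<^sup>+(y::real). 0 \<partial>lborel)"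
  proof (rule nn_integral_dominated_convergence)
    show "(\<integral>\<^sup>+y. ennreal (norm (k y)) * (2 * (?H + ?H)) \<partial>lborel) < \<infinity>"
      using k h by (simp add: nn_integral_multc integrable_iff_bounded ennreal_mult_less_top)
    show "AE y in lborel. ennreal (norm (k y)) * ?\<Phi> n y \<le> ennreal (norm (k y)) * (2 * (?H + ?H))" for n
    proof (intro AE_I2 mult_left_mono)
      fix y
      show "?\<Phi> n y \<le> 2 * (?H + ?H)"
        using nn_integral_norm_add_le[of 1 "\<lambda>t. h (t - s n * y)" "\<lambda>t. - h t"] nn_integral_power_translate[of h "s n * y" 1]
        by simp
    qed auto
    show "AE y in lborel. (\<lambda>n. ennreal (norm (k y)) * ?\<Phi> n y) \<longlonglongrightarrow> 0"
    proof (rule AE_I2)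
      fix y :: real
      have "(\<lambda>n. - (s n * y)) \<longlonglongrightarrow> - (0 * y)" by (intro tendsto_intros s)
      then have "(\<lambda>n. ?\<Phi> n y) \<longlonglongrightarrow> 0"
        using translation_continuous_L1[OF h, of "\<lambda>n. - (s n * y)"] by simp
      then show "(\<lambda>n. ennreal (norm (k y)) * ?\<Phi> n y) \<longlonglongrightarrow> 0"
        using ennreal_tendsto_cmult[of "ennreal (norm (k y))"] by fastforce
    qed
  qed auto
  then show ?thesis by simp
qed

text \<open>The mass of \<open>k\<close> is left arbitrary: the approximate identity uses mass 1,
  the localiser uses a modulated \<open>g\<close> whose mass is \<open>ft g x0\<close>.\<close>

lemma dilated_conv_diff_le:
  fixes k h :: "real \<Rightarrow> complex"
  assumes k: "integrable lborel k" and h: "integrable lborel h"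
  shows "(\<integral>\<^sup>+t. ennreal (norm ((\<integral>y. k y * h (t - s * y) \<partial>lborel) - (\<integral>y. k y \<partial>lborel) * h t)) \<partial>lborel)
     \<le> (\<integral>\<^sup>+y. ennreal (norm (k y)) * (\<integral>\<^sup>+t. ennreal (norm (h (t - s * y) - h t)) \<partial>lborel) \<partial>lborel)"
proof -
  have [measurable]: "k \<in> borel_measurable borel" "h \<in> borel_measurable borel" using k h by auto
  have "AE t in lborel. (\<integral>y. k y * h (t - s * y) \<partial>lborel) - (\<integral>y. k y \<partial>lborel) * h t
       = (\<integral>y. k y * (h (t - s * y) - h t) \<partial>lborel)"
    using AE_integrable_shift[OF k h, of "\<lambda>y. s * y"]
  proof (simp, elim AE_mp, intro AE_I2 impI)
    fix t assume a: "integrable lborel (\<lambda>y. k y * h (t - s * y))"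
    show "(\<integral>y. k y * h (t - s * y) \<partial>lborel) - (\<integral>y. k y \<partial>lborel) * h t
       = (\<integral>y. k y * (h (t - s * y) - h t) \<partial>lborel)"
      using a k
      by (subst integral_mult_left_zero[symmetric], subst Bochner_Integration.integral_diff[symmetric])
         (auto simp: algebra_simps)
  qed
  then have "(\<integral>\<^sup>+t. ennreal (norm ((\<integral>y. k y * h (t - s * y) \<partial>lborel) - (\<integral>y. k y \<partial>lborel) * h t)) \<partial>lborel)
    = (\<integral>\<^sup>+t. ennreal (norm (\<integral>y. k y * (h (t - s * y) - h t) \<partial>lborel) ^ 1) \<partial>lborel)"
    by (intro nn_integral_cong_AE) (auto elim!: eventually_mono)
  also have "\<dots> \<le> (\<integral>\<^sup>+y. ennreal (norm (k y)) \<partial>lborel) ^ (1 - 1) *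
     (\<integral>\<^sup>+y. ennreal (norm (k y)) * (\<integral>\<^sup>+t. ennreal (norm (h (t - s * y) - h t) ^ 1) \<partial>lborel) \<partial>lborel)"
    by (rule nn_integral_mixture_le) auto
  finally show ?thesis by simp
qed

theorem approximate_identity:
  fixes k h :: "real \<Rightarrow> complex"
  assumes k: "integrable lborel k" and h: "integrable lborel h" and s: "s \<longlonglongrightarrow> (0::real)"
    and k1: "(\<integral>y. k y \<partial>lborel) = 1"
  shows "(\<lambda>n. \<integral>\<^sup>+t. ennreal (norm ((\<integral>y. k y * h (t - s n * y) \<partial>lborel) - h t)) \<partial>lborel) \<longlonglongrightarrow> 0"
proof (rule tendsto_sandwich[OF _ _ tendsto_const dilation_continuous[OF k h s]])
  show "eventually (\<lambda>n. (\<integral>\<^sup>+t. ennreal (norm ((\<integral>y. k y * h (t - s n * y) \<partial>lborel) - h t)) \<partial>lborel)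
    \<le> (\<integral>\<^sup>+y. ennreal (norm (k y)) * (\<integral>\<^sup>+t. ennreal (norm (h (t - s n * y) - h t)) \<partial>lborel) \<partial>lborel)) sequentially"
    using dilated_conv_diff_le[OF k h] by (simp add: k1)
qed simp

lemma dilated_conv:
  assumes "s > 0"
  shows "(\<integral>y. k y * h (t - s * y) \<partial>lborel) = conv h (\<lambda>y. k (y / s) / of_real s) t"
proof -
  have "conv h (\<lambda>y. k (y / s) / of_real s) t = (\<integral>y. h (t + - 1 * y) * (k (y / s) / of_real s) \<partial>lborel)"
    unfolding conv_def using lborel_integral_real_affine[of "-1" "\<lambda>y. h y * (k ((t - y) / s) / of_real s)" t]
    by simp
  also have "\<dots> = \<bar>s\<bar> *\<^sub>R (\<integral>y. h (t + - 1 * (0 + s * y)) * (k ((0 + s * y) / s) / of_real s) \<partial>lborel)"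
    using assms by (subst lborel_integral_real_affine[of s _ 0]) auto
  also have "\<dots> = (\<integral>y. k y * h (t - s * y) \<partial>lborel)"
    using assms
    by (subst integral_scaleR_right[symmetric])
       (intro Bochner_Integration.integral_cong, auto simp: scaleR_conv_of_real)
  finally show ?thesis by simp
qed

section \<open>Gaussian damping and inversion\<close>

lemma integrable_exp_square:
  assumes "s > 0" shows "integrable lborel (\<lambda>t::real. exp (- (s * t)\<^sup>2 / 2))"
proof -
  have "integrable lborel (\<lambda>t. sqrt (2 * pi) * std_normal_density (0 + s * t))"
    using assms by (intro integrable_mult_right lborel_integrable_real_affine) auto
  then show ?thesis by (simp add: std_normal_density_def)
qed

text \<open>The characteristic function of the standard normal distribution, rescaled. Writing the
  result with \<open>normal_density\<close> turns Gaussian damping in space into averaging against a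
  probability density in frequency.\<close>

lemma ft_exp_square:
  assumes s: "s > 0"
  shows "ft (\<lambda>t. of_real (exp (- (s * t)\<^sup>2 / 2))) x = of_real (2 * pi * normal_density 0 s x)"
proof -
  let ?n = "\<lambda>t. complex_of_real (std_normal_density t)"
  have 1: "ft ?n y = of_real (exp (- y\<^sup>2 / 2))" for y
  proof -
    have "char std_normal_distribution (- y) = (CLINT t|lborel. std_normal_density t *\<^sub>R iexp (- y * t))"
      unfolding char_def by (subst integral_density) auto
    also have "\<dots> = ft ?n y"
      by (simp add: ft_def cis_conv_exp scaleR_conv_of_real mult.commute)
    finally show ?thesis by (simp add: char_std_normal_distribution)
  qed
  have "ft (\<lambda>t. of_real (exp (- (s * t)\<^sup>2 / 2))) x
      = ft (\<lambda>t. of_real (sqrt (2 * pi) / s) * (of_real s * ?n (s * t))) x"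
    using s by (simp add: std_normal_density_def)
  also have "\<dots> = of_real (sqrt (2 * pi) / s) * of_real (exp (- (x / s)\<^sup>2 / 2))"
    by (subst ft_cmult, subst ft_scale[OF s], subst 1) simp
  also have "\<dots> = of_real (2 * pi * normal_density 0 s x)"
  proof -
    have "sqrt (2 * pi) / s = 2 * pi / sqrt (2 * pi * s\<^sup>2)"
    proof -
      have "sqrt (2 * pi * s\<^sup>2) = sqrt (2 * pi) * s" using s by (simp add: real_sqrt_mult)
      moreover have "2 * pi / sqrt (2 * pi) = sqrt (2 * pi)" by (intro real_div_sqrt) simp
      ultimately show ?thesis by (simp add: divide_divide_eq_left[symmetric] del: divide_divide_eq_left)
    qed
    then have "sqrt (2 * pi) / s * exp (- (x / s)\<^sup>2 / 2) = 2 * pi * normal_density 0 s x"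
      by (simp add: normal_density_def power_divide)
    then show ?thesis by (metis of_real_mult)
  qed
  finally show ?thesis .
qed

lemma integrable_exp_square_complex:
  "s > 0 \<Longrightarrow> integrable lborel (\<lambda>t. complex_of_real (exp (- (s * t)\<^sup>2 / 2)))"
  using integrable_exp_square by (simp only: complex_of_real_integrable_eq)

lemma measurable_cnj [measurable]: "cnj \<in> borel_measurable borel"
  by (intro borel_measurable_continuous_onI continuous_intros)

lemma integrable_bounded_mult:
  fixes F G :: "real \<Rightarrow> complex"
  assumes G: "integrable lborel G" and [measurable]: "F \<in> borel_measurable borel"
    and B: "\<And>t. norm (F t) \<le> B"
  shows "integrable lborel (\<lambda>t. F t * G t)"
proof (rule Bochner_Integration.integrable_bound)
  show "integrable lborel (\<lambda>t. B * norm (G t))" using G by simp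
  show "(\<lambda>t. F t * G t) \<in> borel_measurable lborel" using G by measurable
  show "AE t in lborel. norm (F t * G t) \<le> norm (B * norm (G t))"
  proof (rule AE_I2)
    fix t
    have "norm (F t * G t) \<le> B * norm (G t)" using B[of t] by (auto simp: norm_mult intro!: mult_right_mono)
    then show "norm (F t * G t) \<le> norm (B * norm (G t))" by simp
  qed
qed

lemma integrable_normal_density_complex: "s > 0 \<Longrightarrow> integrable lborel (\<lambda>t. complex_of_real (normal_density m s t))"
  by (intro integrable_of_real integrable_normal_density)

lemma normal_density_shift: "normal_density x s y = normal_density 0 s (y - x)"
  by (simp add: normal_density_def)

lemma normal_density_swap: "normal_density x s y = normal_density y s x"
  by (simp add: normal_density_def power2_commute)

lemma normal_density_measurable_pair [measurable]:
  "(\<lambda>(x, y). normal_density x s y) \<in> borel_measurable (borel \<Otimes>\<^sub>M borel)"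
  unfolding normal_density_def by measurable

lemma integrable_damped:
  assumes s: "s > 0" and K: "integrable lborel K"
  shows "integrable lborel (\<lambda>t. of_real (exp (- (s * t)\<^sup>2 / 2)) * ift K t)"
proof -
  have [measurable]: "K \<in> borel_measurable borel" using K by auto
  have "integrable lborel (\<lambda>t. ift K t * of_real (exp (- (s * t)\<^sup>2 / 2)))"
    using norm_ift_le by (intro integrable_bounded_mult integrable_exp_square_complex s) auto
  then show ?thesis by (simp add: mult.commute)
qed

text \<open>The Gaussian factor makes the double integral absolutely convergent, so the transform
  and the inverse transform may be interchanged; undamped, Fubini would not apply.\<close>

theorem ft_damped_ift:
  assumes s: "s > 0" and K: "integrable lborel K"
  shows "ft (\<lambda>t. of_real (exp (- (s * t)\<^sup>2 / 2)) * ift K t) x = (\<integral>\<xi>. of_real (normal_density x s \<xi>) * K \<xi> \<partial>lborel)"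
proof -
  let ?\<gamma> = "\<lambda>t. complex_of_real (exp (- (s * t)\<^sup>2 / 2))"
  have \<gamma>: "integrable lborel ?\<gamma>" by (rule integrable_exp_square_complex[OF s])
  have "ft (\<lambda>t. ?\<gamma> t * ift K t) x = (\<integral>t. (\<integral>\<xi>. cis ((\<xi> - x) * t) * (?\<gamma> t * K \<xi>) \<partial>lborel) \<partial>lborel) / of_real (2 * pi)"
  proof -
    have "cis (- (x * t)) * (?\<gamma> t * ift K t) = (\<integral>\<xi>. cis ((\<xi> - x) * t) * (?\<gamma> t * K \<xi>) \<partial>lborel) / of_real (2 * pi)" for t
    proof -
      have "cis ((\<xi> - x) * t) * (?\<gamma> t * K \<xi>) = (cis (- (x * t)) * ?\<gamma> t) * (cis (- (- t * \<xi>)) * K \<xi>)" for \<xi>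
      proof -
        have "cis ((\<xi> - x) * t) = cis (- (x * t)) * cis (- (- t * \<xi>))" by (simp add: cis_mult algebra_simps)
        then show ?thesis by simp
      qed
      then have "(\<integral>\<xi>. cis ((\<xi> - x) * t) * (?\<gamma> t * K \<xi>) \<partial>lborel) = (cis (- (x * t)) * ?\<gamma> t) * ft K (- t)"
        unfolding ft_def by (simp only: integral_mult_right_zero)
      then show ?thesis by (simp add: ift_def)
    qed
    then show ?thesis unfolding ft_def[of "\<lambda>t. ?\<gamma> t * ift K t"] by (simp only: integral_divide_zero)
  qed
  also have "(\<integral>t. (\<integral>\<xi>. cis ((\<xi> - x) * t) * (?\<gamma> t * K \<xi>) \<partial>lborel) \<partial>lborel)
     = (\<integral>\<xi>. (\<integral>t. cis ((\<xi> - x) * t) * (?\<gamma> t * K \<xi>) \<partial>lborel) \<partial>lborel)"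
    by (rule Fubini_cis[OF \<gamma> K]) measurable
  also have "\<dots> = (\<integral>\<xi>. of_real (2 * pi) * (of_real (normal_density x s \<xi>) * K \<xi>) \<partial>lborel)"
  proof (intro Bochner_Integration.integral_cong refl)
    fix \<xi>
    have "(\<integral>t. cis ((\<xi> - x) * t) * (?\<gamma> t * K \<xi>) \<partial>lborel) = ft ?\<gamma> (x - \<xi>) * K \<xi>"
      unfolding ft_def by (subst integral_mult_left_zero[symmetric]) (simp add: algebra_simps)
    then show "(\<integral>t. cis ((\<xi> - x) * t) * (?\<gamma> t * K \<xi>) \<partial>lborel) = of_real (2 * pi) * (of_real (normal_density x s \<xi>) * K \<xi>)"
      unfolding ft_exp_square[OF s] normal_density_swap[of x s \<xi>] normal_density_shift[of \<xi> s x] by simp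
  qed
  finally show ?thesis by simp
qed

text \<open>Two limits of one sequence are compared. As the damping disappears, the left side
  converges because \<open>ift K\<close> is integrable, while the Gaussian averages of the bounded
  function \<open>K\<close> concentrate at the continuity point \<open>x\<close>.\<close>

theorem ft_ift:
  assumes K: "integrable lborel K" and B: "\<And>x. norm (K x) \<le> B" and cont: "isCont K x"
    and e: "integrable lborel (ift K)"
  shows "ft (ift K) x = K x"
proof -
  have [measurable]: "K \<in> borel_measurable borel" using K by auto
  let ?s = "\<lambda>n. 1 / real (Suc n)"
  have s0: "?s \<longlonglongrightarrow> 0" by (rule LIMSEQ_Suc[OF lim_1_over_n])
  have "(\<lambda>n. ft (\<lambda>t. of_real (exp (- (?s n * t)\<^sup>2 / 2)) * ift K t) x) \<longlonglongrightarrow> ft (ift K) x"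
    unfolding ft_def[of _ x]
  proof (rule integral_dominated_convergence)
    show "integrable lborel (\<lambda>t. norm (ift K t))" using e by simp
    show "AE t in lborel. (\<lambda>n. cis (- (x * t)) * (complex_of_real (exp (- (?s n * t)\<^sup>2 / 2)) * ift K t)) \<longlonglongrightarrow> cis (- (x * t)) * ift K t"
    proof (rule AE_I2)
      fix t
      have "(\<lambda>n. cis (- (x * t)) * (complex_of_real (exp (- (?s n * t)\<^sup>2 / 2)) * ift K t))
         \<longlonglongrightarrow> cis (- (x * t)) * (complex_of_real (exp (- (0 * t)\<^sup>2 / 2)) * ift K t)"
        by (intro tendsto_intros s0) auto
      then show "(\<lambda>n. cis (- (x * t)) * (complex_of_real (exp (- (?s n * t)\<^sup>2 / 2)) * ift K t)) \<longlonglongrightarrow> cis (- (x * t)) * ift K t"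
        by simp
    qed
    show "AE t in lborel. norm (cis (- (x * t)) * (complex_of_real (exp (- (?s n * t)\<^sup>2 / 2)) * ift K t)) \<le> norm (ift K t)" for n
      by (auto simp: norm_mult intro!: mult_left_le_one_le)
  qed auto
  moreover have "ft (\<lambda>t. of_real (exp (- (?s n * t)\<^sup>2 / 2)) * ift K t) x = (\<integral>z. of_real (std_normal_density z) * K (x + ?s n * z) \<partial>lborel)" for n
  proof -
    have s: "?s n > 0" by simp
    have "ft (\<lambda>t. of_real (exp (- (?s n * t)\<^sup>2 / 2)) * ift K t) x = (\<integral>\<xi>. of_real (normal_density x (?s n) \<xi>) * K \<xi> \<partial>lborel)"
      by (rule ft_damped_ift[OF s K])
    also have "\<dots> = \<bar>?s n\<bar> *\<^sub>R (\<integral>z. of_real (normal_density x (?s n) (x + ?s n * z)) * K (x + ?s n * z) \<partial>lborel)"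
      by (rule lborel_integral_real_affine) simp
    also have "\<dots> = (\<integral>z. of_real (std_normal_density z) * K (x + ?s n * z) \<partial>lborel)"
    proof (subst integral_scaleR_right[symmetric], intro Bochner_Integration.integral_cong refl)
      fix z
      have "\<bar>r\<bar> *\<^sub>R (of_real (normal_density x r (x + r * z)) * K (x + r * z)) = of_real (std_normal_density z) * K (x + r * z)"
        if r: "r > 0" for r
      proof -
        have "r * normal_density x r (x + r * z) = std_normal_density z"
          using r by (simp add: normal_density_def real_sqrt_mult power_mult_distrib)
        then have "complex_of_real r * of_real (normal_density x r (x + r * z)) = of_real (std_normal_density z)"
          by (metis of_real_mult)
        then show ?thesis using r by (simp add: scaleR_conv_of_real mult.assoc[symmetric])
      qed
      from this[OF s] show "\<bar>?s n\<bar> *\<^sub>R (of_real (normal_density x (?s n) (x + ?s n * z)) * K (x + ?s n * z))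
         = of_real (std_normal_density z) * K (x + ?s n * z)" .
    qed
    finally show ?thesis .
  qed
  moreover have "(\<lambda>n. (\<integral>z. of_real (std_normal_density z) * K (x + ?s n * z) \<partial>lborel)) \<longlonglongrightarrow> (\<integral>z. of_real (std_normal_density z) * K x \<partial>lborel)"
  proof (rule integral_dominated_convergence)
    show "integrable lborel (\<lambda>z. std_normal_density z * B)" by (intro integrable_mult_left) simp
    show "AE z in lborel. (\<lambda>n. of_real (std_normal_density z) * K (x + ?s n * z)) \<longlonglongrightarrow> of_real (std_normal_density z) * K x"
    proof (intro AE_I2 tendsto_intros)
      fix z
      have "(\<lambda>n. x + ?s n * z) \<longlonglongrightarrow> x + 0 * z" by (intro tendsto_intros s0)
      then show "(\<lambda>n. K (x + ?s n * z)) \<longlonglongrightarrow> K x" using isCont_tendsto_compose[OF cont] by simp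
    qed
    show "AE z in lborel. norm (of_real (std_normal_density z) * K (x + ?s n * z)) \<le> std_normal_density z * B" for n
      using B by (auto simp: norm_mult intro!: mult_left_mono)
  qed auto
  moreover have "(\<integral>z. of_real (std_normal_density z) * K x \<partial>lborel) = K x" by simp
  ultimately show ?thesis using LIMSEQ_unique by (metis (no_types, lifting) LIMSEQ_unique ext)
qed

text \<open>With damping, the integral on the left is \<open>1 / (2 * pi)\<close> times the pairing
  of \<open>K\<close> with its own Gaussian average. The symmetry of the density in its two
  arguments bounds that pairing, and Fatou's lemma removes the damping. The right-hand side may be
  infinite. The sharp constant would be \<open>1 / (2 * pi)\<close>.\<close>

theorem nn_integral_ift_square_le:
  assumes K: "integrable lborel K"
  shows "(\<integral>\<^sup>+t. ennreal (norm (ift K t) ^ 2) \<partial>lborel) \<le> (\<integral>\<^sup>+\<xi>. ennreal (norm (K \<xi>) ^ 2) \<partial>lborel)"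
proof -
  have [measurable]: "K \<in> borel_measurable borel" using K by auto
  let ?R = "\<integral>\<^sup>+\<xi>. ennreal (norm (K \<xi>) ^ 2) \<partial>lborel"
  have damped: "(\<integral>\<^sup>+t. ennreal (exp (- (s * t)\<^sup>2 / 2) * norm (ift K t) ^ 2) \<partial>lborel) \<le> ?R" if s: "s > 0" for s
  proof -
    let ?e = "\<lambda>t. of_real (exp (- (s * t)\<^sup>2 / 2)) * ift K t"
    have e: "integrable lborel ?e" by (rule integrable_damped[OF s K])
    have e2: "integrable lborel (\<lambda>t. cnj (ift K t) * ?e t)"
      by (rule integrable_bounded_mult[OF e, where B="(\<integral>t. norm (K t) \<partial>lborel) / (2 * pi)"]) (auto simp: norm_ift_le)
    have pt: "cnj (ift K t) * ?e t = of_real (exp (- (s * t)\<^sup>2 / 2) * norm (ift K t) ^ 2)" for t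
      by (simp add: complex_norm_square[symmetric] mult_ac)
    have "(\<integral>t. exp (- (s * t)\<^sup>2 / 2) * norm (ift K t) ^ 2 \<partial>lborel) = norm (\<integral>t. cnj (ift K t) * ?e t \<partial>lborel)"
      unfolding pt integral_complex_of_real norm_of_real by simp
    also have "(\<integral>t. cnj (ift K t) * ?e t \<partial>lborel)
       = (\<integral>t. (\<integral>\<xi>. cis (- (\<xi> * t)) * (?e t * cnj (K \<xi>)) \<partial>lborel) \<partial>lborel) / of_real (2 * pi)"
    proof -
      have "cnj (ift K t) * ?e t = (\<integral>\<xi>. cis (- (\<xi> * t)) * (?e t * cnj (K \<xi>)) \<partial>lborel) / of_real (2 * pi)" for t
      proof -
        have "cnj (ift K t) = ft (\<lambda>\<xi>. cnj (K \<xi>)) t / of_real (2 * pi)"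
          by (simp add: ift_def ft_cnj)
        moreover have "cis (- (\<xi> * t)) * (?e t * cnj (K \<xi>)) = ?e t * (cis (- (t * \<xi>)) * cnj (K \<xi>))" for \<xi>
          by (simp add: mult_ac)
        then have "(\<integral>\<xi>. cis (- (\<xi> * t)) * (?e t * cnj (K \<xi>)) \<partial>lborel) = ?e t * ft (\<lambda>\<xi>. cnj (K \<xi>)) t"
          unfolding ft_def by (simp only: integral_mult_right_zero)
        ultimately show ?thesis by simp
      qed
      then show ?thesis by (simp only: integral_divide_zero)
    qed
    also have "(\<integral>t. (\<integral>\<xi>. cis (- (\<xi> * t)) * (?e t * cnj (K \<xi>)) \<partial>lborel) \<partial>lborel)
       = (\<integral>\<xi>. (\<integral>t. cis (- (\<xi> * t)) * (?e t * cnj (K \<xi>)) \<partial>lborel) \<partial>lborel)"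
      using K by (intro Fubini_cis e) auto
    also have "\<dots> = (\<integral>\<xi>. cnj (K \<xi>) * (\<integral>\<eta>. of_real (normal_density \<xi> s \<eta>) * K \<eta> \<partial>lborel) \<partial>lborel)"
    proof (intro Bochner_Integration.integral_cong refl)
      fix \<xi>
      have "(\<integral>t. cis (- (\<xi> * t)) * (?e t * cnj (K \<xi>)) \<partial>lborel) = cnj (K \<xi>) * ft ?e \<xi>"
      proof -
        have "cis (- (\<xi> * t)) * (?e t * cnj (K \<xi>)) = cnj (K \<xi>) * (cis (- (\<xi> * t)) * ?e t)" for t
          by (simp add: mult_ac)
        then show ?thesis unfolding ft_def[of ?e] by (simp only: integral_mult_right_zero)
      qed
      then show "(\<integral>t. cis (- (\<xi> * t)) * (?e t * cnj (K \<xi>)) \<partial>lborel) = cnj (K \<xi>) * (\<integral>\<eta>. of_real (normal_density \<xi> s \<eta>) * K \<eta> \<partial>lborel)"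
        by (simp only: ft_damped_ift[OF s K])
    qed
    finally have J: "(\<integral>t. exp (- (s * t)\<^sup>2 / 2) * norm (ift K t) ^ 2 \<partial>lborel)
        = norm (\<integral>\<xi>. cnj (K \<xi>) * (\<integral>\<eta>. of_real (normal_density \<xi> s \<eta>) * K \<eta> \<partial>lborel) \<partial>lborel) / (2 * pi)"
      by (simp add: norm_divide norm_mult)
    let ?x = "norm (\<integral>\<xi>. cnj (K \<xi>) * (\<integral>\<eta>. of_real (normal_density \<xi> s \<eta>) * K \<eta> \<partial>lborel) \<partial>lborel)"
    have le: "ennreal (norm (\<integral>x. F x \<partial>lborel)) \<le> (\<integral>\<^sup>+x. ennreal (norm (F x)) \<partial>lborel)" for F :: "real \<Rightarrow> complex"
      by (cases "integrable lborel F") (simp_all add: integral_norm_bound_ennreal not_integrable_integral_eq)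
    have nd: "(\<integral>\<^sup>+\<eta>. ennreal (normal_density \<xi> s \<eta>) \<partial>lborel) = 1" for \<xi>
      using s by (simp add: nn_integral_eq_integral)
    have "ennreal (norm (\<integral>\<xi>. cnj (K \<xi>) * (\<integral>\<eta>. of_real (normal_density \<xi> s \<eta>) * K \<eta> \<partial>lborel) \<partial>lborel))
      \<le> (\<integral>\<^sup>+\<xi>. ennreal (norm (K \<xi>)) * (\<integral>\<^sup>+\<eta>. ennreal (norm (of_real (normal_density \<xi> s \<eta>) * K \<eta>)) \<partial>lborel) \<partial>lborel)"
      by (rule order_trans[OF le]) (auto simp: norm_mult ennreal_mult intro!: nn_integral_mono mult_left_mono order_trans[OF le])
    also have "\<dots> = (\<integral>\<^sup>+\<xi>. (\<integral>\<^sup>+\<eta>. ennreal (norm (K \<xi>) * (normal_density \<xi> s \<eta> * norm (K \<eta>))) \<partial>lborel) \<partial>lborel)"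
      by (intro nn_integral_cong, subst nn_integral_cmult[symmetric]) (auto simp: norm_mult ennreal_mult)
    also have "\<dots> \<le> (\<integral>\<^sup>+\<xi>. (\<integral>\<^sup>+\<eta>. ennreal (norm (K \<xi>) ^ 2) * ennreal (normal_density \<xi> s \<eta>)
        + ennreal (norm (K \<eta>) ^ 2) * ennreal (normal_density \<xi> s \<eta>) \<partial>lborel) \<partial>lborel)"
    proof (intro nn_integral_mono)
      fix \<xi> \<eta>
      have le: "a * (d * b) \<le> a ^ 2 * d + b ^ 2 * d" if "0 \<le> a" "0 \<le> b" "0 \<le> d" for a b d :: real
      proof -
        have "2 * a * b \<le> a ^ 2 + b ^ 2" by (rule sum_squares_bound)
        moreover have "0 \<le> a * b" using that by simp
        ultimately have "a * b \<le> a ^ 2 + b ^ 2" by linarith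
        then have "(a * b) * d \<le> (a ^ 2 + b ^ 2) * d" using that by (intro mult_right_mono)
        then show ?thesis by (simp add: algebra_simps)
      qed
      have "ennreal (norm (K \<xi>) * (normal_density \<xi> s \<eta> * norm (K \<eta>)))
        \<le> ennreal (norm (K \<xi>) ^ 2 * normal_density \<xi> s \<eta> + norm (K \<eta>) ^ 2 * normal_density \<xi> s \<eta>)"
        by (intro ennreal_leI le) auto
      also have "\<dots> = ennreal (norm (K \<xi>) ^ 2) * ennreal (normal_density \<xi> s \<eta>)
        + ennreal (norm (K \<eta>) ^ 2) * ennreal (normal_density \<xi> s \<eta>)"
        by (subst ennreal_plus) (auto simp: ennreal_mult)
      finally show "ennreal (norm (K \<xi>) * (normal_density \<xi> s \<eta> * norm (K \<eta>))) \<le> ennreal (norm (K \<xi>) ^ 2) * ennreal (normal_density \<xi> s \<eta>)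
        + ennreal (norm (K \<eta>) ^ 2) * ennreal (normal_density \<xi> s \<eta>)" .
    qed
    also have "\<dots> = (\<integral>\<^sup>+\<xi>. (\<integral>\<^sup>+\<eta>. ennreal (norm (K \<xi>) ^ 2) * ennreal (normal_density \<xi> s \<eta>) \<partial>lborel) \<partial>lborel)
       + (\<integral>\<^sup>+\<xi>. (\<integral>\<^sup>+\<eta>. ennreal (norm (K \<eta>) ^ 2) * ennreal (normal_density \<xi> s \<eta>) \<partial>lborel) \<partial>lborel)"
      by (subst nn_integral_add[symmetric]) (auto intro!: nn_integral_cong nn_integral_add)
    also have "(\<integral>\<^sup>+\<xi>. (\<integral>\<^sup>+\<eta>. ennreal (norm (K \<eta>) ^ 2) * ennreal (normal_density \<xi> s \<eta>) \<partial>lborel) \<partial>lborel)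
       = (\<integral>\<^sup>+\<eta>. (\<integral>\<^sup>+\<xi>. ennreal (norm (K \<eta>) ^ 2) * ennreal (normal_density \<eta> s \<xi>) \<partial>lborel) \<partial>lborel)"
      by (subst lborel_pair.Fubini') (auto simp: normal_density_swap)
    also have "(\<integral>\<^sup>+\<xi>. (\<integral>\<^sup>+\<eta>. ennreal (norm (K \<xi>) ^ 2) * ennreal (normal_density \<xi> s \<eta>) \<partial>lborel) \<partial>lborel) = ?R"
      by (simp add: nn_integral_cmult nd)
    finally have "ennreal ?x \<le> 2 * ?R"
      by (simp add: mult_2)
    then have "ennreal (?x / (2 * pi)) \<le> ?R"
    proof -
      assume a: "ennreal ?x \<le> 2 * ?R"
      \<comment> \<open>The crude inequality \<open>a * b \<le> a^2 + b^2\<close> cost a factor 2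
        above; the normalisation \<open>1 / (2 * pi)\<close> absorbs it.\<close>
      have "?x / (2 * pi) \<le> ?x / 2" using pi_gt3 by (intro divide_left_mono) auto
      then have "ennreal (?x / (2 * pi)) \<le> ennreal (?x / 2)" by (rule ennreal_leI)
      also have "\<dots> \<le> ?R"
      proof (cases "?R = top")
        case False
        then obtain r where r: "?R = ennreal r" "r \<ge> 0" by (cases ?R) auto
        have "2 * ennreal r = ennreal (2 * r)" using r by (subst ennreal_mult) auto
        with a r have "?x \<le> 2 * r" by (simp add: r(1))
        then show ?thesis using r by (simp add: r(1) ennreal_leI)
      qed simp
      finally show "ennreal (?x / (2 * pi)) \<le> ?R" .
    qed
    moreover have "(\<integral>\<^sup>+t. ennreal (exp (- (s * t)\<^sup>2 / 2) * norm (ift K t) ^ 2) \<partial>lborel)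
       = ennreal (\<integral>t. exp (- (s * t)\<^sup>2 / 2) * norm (ift K t) ^ 2 \<partial>lborel)"
    proof (rule nn_integral_eq_integral)
      show "integrable lborel (\<lambda>t. exp (- (s * t)\<^sup>2 / 2) * norm (ift K t) ^ 2)"
        using e2 unfolding pt by (simp only: complex_of_real_integrable_eq)
    qed simp
    ultimately show ?thesis unfolding J by simp
  qed
  let ?s = "\<lambda>n. 1 / real (Suc n)"
  have s0: "?s \<longlonglongrightarrow> 0" by (rule LIMSEQ_Suc[OF lim_1_over_n])
  have lim: "(\<lambda>n. ennreal (exp (- (?s n * t)\<^sup>2 / 2) * norm (ift K t) ^ 2)) \<longlonglongrightarrow> ennreal (norm (ift K t) ^ 2)" for t
  proof -
    have "(\<lambda>n. exp (- (?s n * t)\<^sup>2 / 2) * norm (ift K t) ^ 2) \<longlonglongrightarrow> exp (- (0 * t)\<^sup>2 / 2) * norm (ift K t) ^ 2"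
      by (intro tendsto_intros s0) auto
    then show ?thesis by (intro tendsto_ennrealI) simp
  qed
  have "(\<integral>\<^sup>+t. ennreal (norm (ift K t) ^ 2) \<partial>lborel)
     = (\<integral>\<^sup>+t. liminf (\<lambda>n. ennreal (exp (- (?s n * t)\<^sup>2 / 2) * norm (ift K t) ^ 2)) \<partial>lborel)"
    by (intro nn_integral_cong lim_imp_Liminf[symmetric] lim) simp
  also have "\<dots> \<le> liminf (\<lambda>n. \<integral>\<^sup>+t. ennreal (exp (- (?s n * t)\<^sup>2 / 2) * norm (ift K t) ^ 2) \<partial>lborel)"
    by (rule nn_integral_liminf) measurable
  also have "\<dots> \<le> liminf (\<lambda>n::nat. ?R)"
    by (intro Liminf_mono always_eventually allI damped) simp
  also have "\<dots> = ?R" by (simp add: Liminf_const)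
  finally show ?thesis .
qed

section \<open>Wiener's theorem for integrable functions\<close>

definition unit_box :: "real \<Rightarrow> complex" where
  "unit_box t = indicator {-1/2..1/2} t"

definition tri :: "real \<Rightarrow> complex" where
  "tri x = of_real (max 0 (1 - \<bar>x\<bar>))"

text \<open>Defined by its spectrum, so that its transform and total mass follow from inversion and
  no closed form has to be integrated.\<close>

definition fejer :: "real \<Rightarrow> complex" where
  "fejer = ift tri"

lemma integrable_unit_box: "integrable lborel unit_box"
proof -
  have eq: "unit_box = (\<lambda>t. complex_of_real (indicator {-1/2..1/2} t))"
    by (auto simp: unit_box_def indicator_def)
  show ?thesis unfolding eq
    by (intro integrable_of_real integrable_real_indicator) auto
qed

lemma conv_unit_box: "conv unit_box unit_box t = tri t"
proof -
  have "conv unit_box unit_box t = (\<integral>y. complex_of_real (indicator {max (-1/2) (t - 1/2)..min (1/2) (t + 1/2)} y) \<partial>lborel)"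
    unfolding conv_def
    by (intro Bochner_Integration.integral_cong) (auto simp: unit_box_def indicator_def)
  also have "\<dots> = of_real (measure lborel {max (-1/2) (t - 1/2)..min (1/2) (t + 1/2)})"
    by (subst integral_complex_of_real) simp
  also have "\<dots> = tri t"
  proof (cases "max (-1/2) (t - 1/2) \<le> min (1/2) (t + 1/2)")
    case True
    then show ?thesis by (auto simp: tri_def max_def min_def)
  next
    case False
    then have "1 - \<bar>t\<bar> \<le> 0" by linarith
    then show ?thesis using False by (simp add: tri_def)
  qed
  finally show ?thesis .
qed

lemma tri_eq_conv: "tri = conv unit_box unit_box"
  using conv_unit_box by (simp add: fun_eq_iff)

lemma integrable_tri: "integrable lborel tri"
  unfolding tri_eq_conv by (intro integrable_conv integrable_unit_box)

lemma norm_tri_le: "norm (tri x) \<le> 1"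
  by (simp add: tri_def)

lemma tri_eq_0: "\<bar>x\<bar> \<ge> 1 \<Longrightarrow> tri x = 0"
  by (simp add: tri_def)

lemma isCont_tri: "isCont tri x"
  unfolding tri_def by (intro continuous_intros)

lemma tri_measurable [measurable]: "tri \<in> borel_measurable borel"
  using integrable_tri by auto

text \<open>The triangle is a convolution square, so the Fejer kernel is the square of the
  square-integrable function \<open>ift unit_box\<close>.\<close>

lemma integrable_fejer: "integrable lborel fejer"
proof -
  have [measurable]: "unit_box \<in> borel_measurable borel" using integrable_unit_box by auto
  have eq: "fejer t = of_real (2 * pi) * (ift unit_box t * ift unit_box t)" for t
    unfolding fejer_def ift_def tri_eq_conv ft_conv[OF integrable_unit_box integrable_unit_box] by simp
  have "(\<integral>\<^sup>+t. ennreal (norm (ift unit_box t * ift unit_box t)) \<partial>lborel) \<le> (\<integral>\<^sup>+\<xi>. ennreal (norm (unit_box \<xi>) ^ 2) \<partial>lborel)"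
    using nn_integral_ift_square_le[OF integrable_unit_box] by (simp add: norm_mult power2_eq_square)
  also have "\<dots> = (\<integral>\<^sup>+\<xi>. indicator {-1/2..1/2 :: real} \<xi> \<partial>lborel)"
    by (intro nn_integral_cong) (auto simp: unit_box_def indicator_def)
  also have "\<dots> < \<infinity>" by simp
  finally have "integrable lborel (\<lambda>t. ift unit_box t * ift unit_box t)"
    by (intro integrableI_bounded) auto
  then show ?thesis unfolding eq[abs_def] by (intro integrable_mult_right)
qed

lemma fejer_measurable [measurable]: "fejer \<in> borel_measurable borel"
  using integrable_fejer by auto

lemma ft_fejer: "ft fejer x = tri x"
  unfolding fejer_def
  using ft_ift[OF integrable_tri norm_tri_le isCont_tri] integrable_fejer by (simp add: fejer_def)

lemma integral_fejer: "(\<integral>t. fejer t \<partial>lborel) = 1"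
  using ft_fejer[of 0] by (simp add: ft_def tri_def)

text \<open>Triangles at the integers are hat functions, so the sum is the piecewise linear
  interpolant of its weights. The weights are the values of a triangle of half-width
  \<open>m\<close> whose kinks are integers, and interpolation reproduces it exactly.\<close>

lemma sum_tri:
  "(\<Sum>j\<in>{- int m..int m}. of_real (real m - \<bar>real_of_int j\<bar>) * tri (x - of_int j)) = of_real (max 0 (real m - \<bar>x\<bar>))"
proof -
  \<comment> \<open>Truncating the weights at 0 allows the two nodes next to \<open>x\<close> to be
    included even if they lie outside the range of summation.\<close>
  define w where "w j = max 0 (real m - \<bar>real_of_int j\<bar>)" for j :: int
  define k where "k = \<lfloor>x\<rfloor>"
  have k: "of_int k \<le> x" "x < of_int k + 1" unfolding k_def by linarith+
  have tri0: "tri (x - of_int j) = 0" if "j \<noteq> k" "j \<noteq> k + 1" for j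
  proof -
    have "j \<le> k - 1 \<or> j \<ge> k + 2" using that by linarith
    then have "real_of_int j \<le> of_int k - 1 \<or> real_of_int j \<ge> of_int k + 2" by linarith
    then show ?thesis using k by (intro tri_eq_0) linarith
  qed
  have "(\<Sum>j\<in>{- int m..int m}. of_real (real m - \<bar>real_of_int j\<bar>) * tri (x - of_int j))
     = (\<Sum>j\<in>{- int m..int m}. of_real (w j) * tri (x - of_int j))"
    by (intro sum.cong) (auto simp: w_def)
  also have "\<dots> = (\<Sum>j\<in>{- int m..int m} \<union> {k, k + 1}. of_real (w j) * tri (x - of_int j))"
    by (intro sum.mono_neutral_left) (auto simp: w_def)
  also have "\<dots> = (\<Sum>j\<in>{k, k + 1}. of_real (w j) * tri (x - of_int j))"
    using tri0 by (intro sum.mono_neutral_right) auto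
  also have "\<dots> = of_real (w k * (1 - (x - of_int k)) + w (k + 1) * (x - of_int k))"
    using k by (simp add: tri_def max_def)
  also have "w k * (1 - (x - of_int k)) + w (k + 1) * (x - of_int k) = max 0 (real m - \<bar>x\<bar>)"
  proof -
    \<comment> \<open>The kinks of the large triangle are at \<open>- m\<close>, 0 and
      \<open>m\<close>, so in each case the cell between \<open>k\<close> and \<open>k + 1\<close>
      lies in a single linear piece.\<close>
    consider "int m \<le> k" | "0 \<le> k" "k < int m" | "k < 0" "- int m \<le> k" | "k < - int m" by linarith
    then show ?thesis
    proof cases
      case 1
      then have "real m \<le> of_int k" by linarith
      then show ?thesis using k by (auto simp: w_def)
    next
      case 2
      then have "0 \<le> real_of_int k" "real_of_int k + 1 \<le> real m" by linarith+
      then have ws: "w k = real m - k" "w (k + 1) = real m - k - 1" "max 0 (real m - \<bar>x\<bar>) = real m - x"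
        using k by (auto simp: w_def)
      show ?thesis unfolding ws by (simp add: algebra_simps)
    next
      case 3
      then have "real_of_int k + 1 \<le> 0" "- real m \<le> real_of_int k" by linarith+
      then have ws: "w k = real m + k" "w (k + 1) = real m + k + 1" "max 0 (real m - \<bar>x\<bar>) = real m + x"
        using k by (auto simp: w_def)
      show ?thesis unfolding ws by (simp add: algebra_simps)
    next
      case 4
      then have "real_of_int k + 1 \<le> - real m" by linarith
      then have ws: "w k = 0" "w (k + 1) = 0" "max 0 (real m - \<bar>x\<bar>) = 0"
        using k by (auto simp: w_def)
      then show ?thesis by simp
    qed
  qed
  finally show ?thesis .
qed

text \<open>The transform \<open>2 * tri (x / 2) - tri x\<close> is a trapezoid, equal to 1 on
  [-1, 1] and to 0 outside [-2, 2]. The plateau makes it act as the identity on a whole band of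
  frequencies.\<close>

definition vallee_poussin :: "real \<Rightarrow> complex" where
  "vallee_poussin t = 2 * (of_real 2 * fejer (2 * t)) - fejer t"

lemma integrable_vallee_poussin: "integrable lborel vallee_poussin"
  unfolding vallee_poussin_def
  using lborel_integrable_real_affine[OF integrable_fejer, of 2 0] integrable_fejer by auto

lemma ft_vallee_poussin:
  assumes "\<bar>x\<bar> \<le> 1" shows "ft vallee_poussin x = 1"
proof -
  have i: "integrable lborel (\<lambda>t. of_real 2 * fejer (2 * t))"
    using lborel_integrable_real_affine[OF integrable_fejer, of 2 0] by auto
  have "ft vallee_poussin x = 2 * ft (\<lambda>t. of_real 2 * fejer (2 * t)) x - ft fejer x"
    unfolding vallee_poussin_def ft_diff[OF integrable_mult_right[OF i] integrable_fejer] ft_cmult ..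
  also have "\<dots> = 2 * tri (x / 2) - tri x"
    by (subst ft_scale) (auto simp: ft_fejer)
  also have "\<dots> = complex_of_real (2 * (1 - \<bar>x\<bar> / 2) - (1 - \<bar>x\<bar>))"
    using assms by (simp add: tri_def max_def)
  finally show ?thesis by simp
qed

section \<open>Localisation in frequency\<close>

lemma conv_commute: "conv u h t = conv h u t"
  unfolding conv_def
  using lborel_integral_real_affine[of "-1" "\<lambda>y. u y * h (t - y)" t] by (simp add: mult.commute)

text \<open>A contraction argument replaces the usual inversion \<open>1 / ft g\<close>: on the support of \<open>K\<close>
  the multiplier \<open>ft u = 1 - ft g / z\<close> has small \<open>L\<^sup>1\<close> norm, and its powers tend to zero.\<close>

lemma approx_translates_local:
  fixes g u K :: "real \<Rightarrow> complex"
  assumes g: "integrable lborel g" and u: "integrable lborel u" and K: "integrable lborel K"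
    and K1: "integrable lborel (ift K)" and z: "z \<noteq> 0"
    and small: "(\<integral>\<^sup>+t. ennreal (norm (u t)) \<partial>lborel) \<le> ennreal (1/2)"
    and loc: "\<And>\<xi>. K \<xi> \<noteq> 0 \<Longrightarrow> ft u \<xi> = 1 - ft g \<xi> / z"
  shows "approx_translates 1 g (ift K)"
proof -
  have [measurable]: "g \<in> borel_measurable borel" "u \<in> borel_measurable borel" "K \<in> borel_measurable borel"
    using g u K by auto
  define k where "k r \<xi> = ft u \<xi> ^ r * K \<xi>" for r :: nat and \<xi>
  have k0: "k 0 = K" by (simp add: k_def fun_eq_iff)
  have kSuc: "k (Suc r) \<xi> = ft u \<xi> * k r \<xi>" for r \<xi> by (simp add: k_def)
  have k_int: "integrable lborel (k r)" for r
  proof (induction r)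
    case (Suc r)
    then have "integrable lborel (\<lambda>\<xi>. ft u \<xi> * k r \<xi>)" by (rule integrable_ft_mult[OF u])
    moreover have "k (Suc r) = (\<lambda>\<xi>. ft u \<xi> * k r \<xi>)" using kSuc by (rule ext)
    ultimately show ?case by simp
  qed (simp add: k0 K)
  have F_Suc: "ift (k (Suc r)) = conv u (ift (k r))" for r
  proof -
    have "k (Suc r) = (\<lambda>\<xi>. ft u \<xi> * k r \<xi>)" using kSuc by (rule ext)
    then show ?thesis by (simp only:) (rule ext, rule conv_ift[OF u k_int, symmetric])
  qed
  have F_int: "integrable lborel (ift (k r))" for r
    by (induction r) (simp_all add: k0 K1 F_Suc integrable_conv u)
  have [measurable]: "ift (k r) \<in> borel_measurable borel" for r using F_int[of r] by auto
  let ?N = "\<integral>\<^sup>+t. ennreal (norm (ift K t)) \<partial>lborel"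
  have F_norm: "(\<integral>\<^sup>+t. ennreal (norm (ift (k r) t)) \<partial>lborel) \<le> ennreal ((1/2) ^ r) * ?N" for r
  proof (induction r)
    case (Suc r)
    have "(\<integral>\<^sup>+t. ennreal (norm (ift (k (Suc r)) t)) \<partial>lborel)
      \<le> (\<integral>\<^sup>+t. ennreal (norm (u t)) \<partial>lborel) * (\<integral>\<^sup>+t. ennreal (norm (ift (k r) t)) \<partial>lborel)"
      unfolding F_Suc by (rule nn_integral_conv_le[OF u F_int])
    also have "\<dots> \<le> ennreal (1/2) * (ennreal ((1/2) ^ r) * ?N)"
      by (intro mult_mono small Suc) auto
    also have "\<dots> = ennreal ((1/2) ^ Suc r) * ?N"
    proof -
      have "ennreal ((1/2) ^ Suc r) = ennreal (1/2) * ennreal ((1/2) ^ r)"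
        by (subst ennreal_mult[symmetric]) auto
      then show ?thesis by (simp only: mult.assoc)
    qed
    finally show ?case .
  qed (simp add: k0)
  \<comment> \<open>On the support of \<open>K\<close> the multipliers \<open>ft u\<close> and
    \<open>ft g / z\<close> add up to 1, so each iterate is the next one plus a convolution with
    \<open>g\<close>; off the support both sides of the spectral identity vanish.\<close>
  have step: "ift (k r) t = ift (k (Suc r)) t + (1 / z) * conv g (ift (k r)) t" for r t
  proof -
    have gi: "integrable lborel (\<lambda>\<xi>. (1 / z) * (ft g \<xi> * k r \<xi>))"
      by (intro integrable_mult_right integrable_ft_mult g k_int)
    have "k (Suc r) = (\<lambda>\<xi>. k r \<xi> - (1 / z) * (ft g \<xi> * k r \<xi>))"
    proof
      fix \<xi>
      show "k (Suc r) \<xi> = k r \<xi> - (1 / z) * (ft g \<xi> * k r \<xi>)"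
        by (cases "K \<xi> = 0") (auto simp: kSuc loc, auto simp: k_def algebra_simps)
    qed
    then have "ift (k (Suc r)) t = ift (k r) t - ift (\<lambda>\<xi>. (1 / z) * (ft g \<xi> * k r \<xi>)) t"
      by (simp only: ift_diff[OF k_int gi])
    then show ?thesis by (simp only: ift_cmult conv_ift[OF g k_int]) simp
  qed
  have conv_approx: "approx_translates 1 g (\<lambda>t. (1 / z) * conv g (ift (k r)) t)" for r
  proof -
    have "approx_translates 1 g (conv (ift (k r)) g)"
      using g F_int translation_continuous_L1[OF g]
      by (intro approx_translates_conv) (auto simp: integrable_iff_bounded)
    moreover have "conv (ift (k r)) g = conv g (ift (k r))" by (rule ext) (rule conv_commute)
    ultimately have "approx_translates 1 g (conv g (ift (k r)))" by simp
    then show ?thesis by (intro approx_translates_cmult) auto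
  qed
  \<comment> \<open>Telescoping: the difference of \<open>ift K\<close> and the iterate
    \<open>r\<close> is a finite sum of convolutions with \<open>g\<close>, so only the iterate
    itself remains to be made small.\<close>
  have diff_approx: "approx_translates 1 g (\<lambda>t. ift K t - ift (k r) t)" for r
  proof (induction r)
    case 0
    then show ?case using approx_translates_zero[of 1 g] by (simp add: k0)
  next
    case (Suc r)
    have "approx_translates 1 g (\<lambda>t. (ift K t - ift (k r) t) + (1 / z) * conv g (ift (k r)) t)"
      by (intro approx_translates_add Suc conv_approx) auto
    moreover have "(ift K t - ift (k r) t) + (1 / z) * conv g (ift (k r)) t = ift K t - ift (k (Suc r)) t" for t
      using step[of r t] by simp
    ultimately show ?case by (simp only:)
  qed
  show ?thesis
  proof (rule approx_translates_closed)
    fix \<epsilon> :: real assume \<epsilon>: "\<epsilon> > 0"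
    obtain B where B: "?N = ennreal B" "B \<ge> 0"
      using K1 by (cases ?N) (auto simp: integrable_iff_bounded)
    have "(\<lambda>r. (1/2) ^ r * B) \<longlonglongrightarrow> 0 * B" by (intro tendsto_intros LIMSEQ_power_zero) simp
    then have "eventually (\<lambda>r. (1/2) ^ r * B < \<epsilon>) sequentially"
      using \<epsilon> by (intro order_tendstoD) auto
    then obtain r where r: "(1/2) ^ r * B < \<epsilon>" by (auto simp: eventually_sequentially)
    have "(\<integral>\<^sup>+t. ennreal (norm (ift (k r) t)) \<partial>lborel) \<le> ennreal ((1/2) ^ r * B)"
      using F_norm[of r] B by (simp add: ennreal_mult)
    also have "\<dots> < ennreal \<epsilon>" using r \<epsilon> by (intro ennreal_lessI) auto
    finally show "\<exists>h'. h' \<in> borel_measurable borel \<and> approx_translates 1 g h' \<and>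
      (\<integral>\<^sup>+x. ennreal (norm (ift K x - h' x) ^ 1) \<partial>lborel) < ennreal \<epsilon>"
      using diff_approx[of r] by (intro exI[of _ "\<lambda>t. ift K t - ift (k r) t"]) auto
  qed auto
qed

text \<open>Take \<open>u\<close> to be the modulated plateau kernel minus its convolution with
  \<open>g / ft g x0\<close>. After modulation and dilation are undone, its norm measures how far
  the dilated convolution of \<open>vallee_poussin\<close> with the modulated \<open>g\<close> is
  from a multiple of \<open>vallee_poussin\<close>. The smallness hypothesis depends on
  \<open>x0\<close> only through \<open>norm (ft g x0)\<close>, so a lower bound for that norm
  permits one \<open>lam\<close> for many frequencies.\<close>

lemma localizer_exists:
  fixes g :: "real \<Rightarrow> complex"
  assumes g: "integrable lborel g" and lam: "lam > 0" and x0: "ft g x0 \<noteq> 0"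
    and small: "(\<integral>\<^sup>+y. ennreal (norm (g y)) * (\<integral>\<^sup>+t. ennreal (norm (vallee_poussin (t - lam * y) - vallee_poussin t)) \<partial>lborel) \<partial>lborel)
      \<le> ennreal (norm (ft g x0) / 2)"
  shows "\<exists>u. integrable lborel u \<and> (\<integral>\<^sup>+t. ennreal (norm (u t)) \<partial>lborel) \<le> ennreal (1/2) \<and>
     (\<forall>\<xi>. \<bar>\<xi> - x0\<bar> \<le> lam \<longrightarrow> ft u \<xi> = 1 - ft g \<xi> / ft g x0)"
proof -
  let ?v = vallee_poussin
  have [measurable]: "g \<in> borel_measurable borel" "?v \<in> borel_measurable borel"
    using g integrable_vallee_poussin by auto
  \<comment> \<open>Dilation by \<open>lam\<close> moves the plateau to [-lam, lam] and modulation
    moves its centre to \<open>x0\<close>.\<close>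
  define e where "e t = cis (x0 * t) * (of_real lam * ?v (lam * t))" for t
  define k where "k y = cis (- (x0 * y)) * g y" for y
  \<comment> \<open>In the variable \<open>lam * t\<close>, the function \<open>u\<close> equals
    \<open>- lam * D / ft g x0\<close> up to a factor of modulus 1; the change of variables cancels
    the factor \<open>lam\<close> in the norm.\<close>
  define D where "D \<tau> = (\<integral>y. k y * ?v (\<tau> - lam * y) \<partial>lborel) - (\<integral>y. k y \<partial>lborel) * ?v \<tau>" for \<tau>
  have k: "integrable lborel k" unfolding k_def[abs_def] by (rule integrable_cis_mult[OF g]) auto
  have [measurable]: "k \<in> borel_measurable borel" using k by auto
  have [measurable]: "D \<in> borel_measurable borel" unfolding D_def[abs_def] by measurable
  have e: "integrable lborel e"
    unfolding e_def[abs_def] using lborel_integrable_real_affine[OF integrable_vallee_poussin, of lam 0] lam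
    by (intro integrable_cis_mult integrable_mult_right) auto
  have fte: "ft e \<xi> = 1" if "\<bar>\<xi> - x0\<bar> \<le> lam" for \<xi>
    unfolding e_def[abs_def] ft_modulate ft_scale[OF lam] using that lam
    by (intro ft_vallee_poussin) (simp add: abs_divide)
  define u where "u t = e t - (1 / ft g x0) * conv g e t" for t
  have u: "integrable lborel u"
    unfolding u_def[abs_def] by (intro Bochner_Integration.integrable_diff integrable_mult_right integrable_conv e g)
  have ftu: "ft u \<xi> = 1 - ft g \<xi> / ft g x0" if "\<bar>\<xi> - x0\<bar> \<le> lam" for \<xi>
  proof -
    have "ft u \<xi> = ft e \<xi> - (1 / ft g x0) * (ft g \<xi> * ft e \<xi>)"
      unfolding u_def[abs_def] ft_diff[OF e integrable_mult_right[OF integrable_conv[OF g e]]]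
        ft_cmult ft_conv[OF g e] ..
    then show ?thesis using fte[OF that] by simp
  qed
  have norm_u: "norm (u t) = lam * norm (D (lam * t)) / norm (ft g x0)" for t
  proof -
    have c: "conv g e t = cis (x0 * t) * of_real lam * (\<integral>y. k y * ?v (lam * t - lam * y) \<partial>lborel)"
      unfolding conv_def
    proof (subst integral_mult_right_zero[symmetric], intro Bochner_Integration.integral_cong refl)
      fix y
      have "cis (x0 * (t - y)) = cis (x0 * t) * cis (- (x0 * y))" by (simp add: cis_mult algebra_simps)
      then show "g y * e (t - y) = cis (x0 * t) * of_real lam * (k y * ?v (lam * t - lam * y))"
        by (simp add: e_def k_def right_diff_distrib)
    qed
    have "ft g x0 = (\<integral>y. k y \<partial>lborel)" by (simp add: ft_def k_def)
    then have "u t = - (cis (x0 * t) * of_real lam * D (lam * t) / ft g x0)"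
      using x0 unfolding u_def c e_def D_def by (simp add: field_simps)
    then show ?thesis using lam by (simp add: norm_mult norm_divide)
  qed
  have "(\<integral>\<^sup>+t. ennreal (norm (u t)) \<partial>lborel)
     = ennreal (1 / norm (ft g x0)) * (ennreal lam * (\<integral>\<^sup>+t. ennreal (norm (D (lam * t))) \<partial>lborel))"
    unfolding norm_u using lam
    by (subst nn_integral_cmult[symmetric], simp)+
       (auto intro!: nn_integral_cong simp: ennreal_mult[symmetric])
  also have "ennreal lam * (\<integral>\<^sup>+t. ennreal (norm (D (lam * t))) \<partial>lborel) = (\<integral>\<^sup>+t. ennreal (norm (D t)) \<partial>lborel)"
    using nn_integral_real_affine[of "\<lambda>t. ennreal (norm (D t))" lam 0] lam by simp
  also have "\<dots> \<le> (\<integral>\<^sup>+y. ennreal (norm (k y)) * (\<integral>\<^sup>+t. ennreal (norm (?v (t - lam * y) - ?v t)) \<partial>lborel) \<partial>lborel)"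
    unfolding D_def by (rule dilated_conv_diff_le[OF k integrable_vallee_poussin])
  also have "\<dots> = (\<integral>\<^sup>+y. ennreal (norm (g y)) * (\<integral>\<^sup>+t. ennreal (norm (?v (t - lam * y) - ?v t)) \<partial>lborel) \<partial>lborel)"
    by (simp add: k_def norm_mult)
  also note small
  also have "ennreal (1 / norm (ft g x0)) * ennreal (norm (ft g x0) / 2) = ennreal (1 / 2)"
    using x0 by (subst ennreal_mult[symmetric]) auto
  finally have "(\<integral>\<^sup>+t. ennreal (norm (u t)) \<partial>lborel) \<le> ennreal (1 / 2)"
    by (simp add: mult_left_mono)
  then show ?thesis using u ftu by blast
qed

lemma ift_tri_dilate:
  assumes "s > 0" shows "ift (\<lambda>\<xi>. tri (s * \<xi>)) y = fejer (y / s) / of_real s"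
proof -
  have "of_real s * ift (\<lambda>\<xi>. tri (s * \<xi>)) y = ift tri (y / s)"
    using ft_scale[OF assms, of tri "- y"] by (simp add: ift_cmult[symmetric]) (simp add: ift_def)
  then show ?thesis using assms by (simp add: fejer_def field_simps)
qed

lemma integrable_tri_affine: "s \<noteq> 0 \<Longrightarrow> integrable lborel (\<lambda>\<xi>. tri (s * \<xi> - a))"
  using lborel_integrable_real_affine[OF integrable_tri, of s "- a"] by (simp add: algebra_simps)

text \<open>Exhibits each frequency piece as a modulated, dilated Fejer kernel, hence as an
  integrable function.\<close>

lemma ift_tri_affine:
  assumes s: "s > 0" shows "ift (\<lambda>\<xi>. tri (s * \<xi> - a)) t = cis (a / s * t) * (fejer (t / s) / of_real s)"
proof -
  have "ift (\<lambda>\<xi>. tri (s * \<xi> - a)) t = ift (\<lambda>\<xi>. tri (s * (\<xi> - a / s))) t"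
    using s by (simp add: right_diff_distrib)
  also have "\<dots> = cis (a / s * t) * ift (\<lambda>\<xi>. tri (s * \<xi>)) t"
  proof -
    have "ft (\<lambda>\<xi>. h (\<xi> - b)) (- t) = cis (b * t) * ft h (- t)" for h and b :: real
    proof -
      have "ft (\<lambda>\<xi>. h (\<xi> - b)) (- t) = (\<integral>\<xi>. cis (t * (b + \<xi>)) * h \<xi> \<partial>lborel)"
        unfolding ft_def using lborel_integral_real_affine[of 1 "\<lambda>\<xi>. cis (- (- t * \<xi>)) * h (\<xi> - b)" b] by simp
      also have "\<dots> = (\<integral>\<xi>. cis (b * t) * (cis (- (- t * \<xi>)) * h \<xi>) \<partial>lborel)"
        by (simp add: mult.assoc[symmetric] cis_mult distrib_left mult.commute[of t b])
      finally show ?thesis unfolding ft_def by (simp only: integral_mult_right_zero)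
    qed
    from this[of "\<lambda>\<xi>. tri (s * \<xi>)" "a / s"] show ?thesis by (simp add: ift_def)
  qed
  finally show ?thesis by (simp add: ift_tri_dilate[OF s])
qed

lemma integrable_ift_tri_affine:
  assumes s: "s > 0" shows "integrable lborel (ift (\<lambda>\<xi>. tri (s * \<xi> - a)))"
  unfolding ift_tri_affine[OF s, abs_def]
  using lborel_integrable_real_affine[OF integrable_fejer, of "1 / s" 0] s
  by (intro integrable_cis_mult) auto

text \<open>Fejer means of \<open>h\<close> have spectrum in a compact interval, where
  \<open>norm (ft g x)\<close> attains a positive minimum; there the localisers have a common
  width.\<close>

theorem wiener_L1_complex:
  fixes g h :: "real \<Rightarrow> complex"
  assumes g: "integrable lborel g" and h: "integrable lborel h" and nz: "\<And>x. ft g x \<noteq> 0"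
  shows "approx_translates 1 g h"
proof -
  have [measurable]: "g \<in> borel_measurable borel" "h \<in> borel_measurable borel" using g h by auto
  have main: "approx_translates 1 g (ift (\<lambda>\<xi>. ft h \<xi> * tri (s * \<xi>)))" if s: "s > 0" for s
  proof -
    \<comment> \<open>All centres \<open>j * lam\<close> used below lie in this interval, so the
      minimum of \<open>norm (ft g x)\<close> on it serves every piece.\<close>
    have "\<exists>x\<in>{-1/s..1/s}. \<forall>y\<in>{-1/s..1/s}. norm (ft g x) \<le> norm (ft g y)"
      using s by (intro continuous_attains_inf) (auto intro!: continuous_intros continuous_at_imp_continuous_on isCont_ft g)
    then obtain x\<^sub>m where xm: "\<And>y. \<bar>y\<bar> \<le> 1/s \<Longrightarrow> norm (ft g x\<^sub>m) \<le> norm (ft g y)"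
      by (metis abs_le_iff atLeastAtMost_iff minus_le_iff divide_minus_left)
    define T where "T lam = (\<integral>\<^sup>+y. ennreal (norm (g y)) * (\<integral>\<^sup>+t. ennreal (norm (vallee_poussin (t - lam * y) - vallee_poussin t)) \<partial>lborel) \<partial>lborel)" for lam
    \<comment> \<open>Only widths \<open>1 / (s * m)\<close> with integer \<open>m\<close> are
      tried: then the centres subdivide [-1/s, 1/s] exactly, and \<open>sum_tri\<close> applies
      after scaling.\<close>
    have "(\<lambda>n. 1 / s * (1 / real (Suc n))) \<longlonglongrightarrow> 1 / s * 0"
      by (intro tendsto_intros LIMSEQ_Suc[OF lim_1_over_n])
    then have "(\<lambda>n. T (1 / s * (1 / real (Suc n)))) \<longlonglongrightarrow> 0"
      unfolding T_def by (intro dilation_continuous g integrable_vallee_poussin) simp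
    then have "eventually (\<lambda>n. T (1 / s * (1 / real (Suc n))) < ennreal (norm (ft g x\<^sub>m) / 2)) sequentially"
      using nz[of x\<^sub>m] by (intro order_tendstoD) auto
    then obtain n where n: "T (1 / s * (1 / real (Suc n))) < ennreal (norm (ft g x\<^sub>m) / 2)"
      by (auto simp: eventually_sequentially)
    define m where "m = Suc n"
    define lam where "lam = 1 / (s * real m)"
    have m: "m > 0" by (simp add: m_def)
    have lam: "lam > 0" using s m by (simp add: lam_def)
    have T: "T lam \<le> ennreal (norm (ft g x\<^sub>m) / 2)" using n by (simp add: lam_def m_def)
    have sm: "s * real m > 0" using s m by simp
    define S where "S = {- int m..int m}"
    have piece: "approx_translates 1 g (ift (\<lambda>\<xi>. ft h \<xi> * tri (s * real m * \<xi> - of_int j)))"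
      if j: "j \<in> S" for j
    proof -
      define x0 where "x0 = of_int j * lam"
      have jm: "\<bar>real_of_int j\<bar> \<le> real m" using j unfolding S_def by simp linarith
      have "\<bar>x0\<bar> \<le> real m * lam" unfolding x0_def using jm lam by (simp add: abs_mult mult_right_mono)
      also have "\<dots> = 1 / s" using m by (simp add: lam_def)
      finally have x0: "norm (ft g x\<^sub>m) \<le> norm (ft g x0)" by (rule xm)
      have "T lam \<le> ennreal (norm (ft g x0) / 2)" using x0 by (intro order_trans[OF T] ennreal_leI) simp
      then obtain u where u: "integrable lborel u" "(\<integral>\<^sup>+t. ennreal (norm (u t)) \<partial>lborel) \<le> ennreal (1/2)"
         "\<And>\<xi>. \<bar>\<xi> - x0\<bar> \<le> lam \<Longrightarrow> ft u \<xi> = 1 - ft g \<xi> / ft g x0"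
        using localizer_exists[OF g lam nz[of x0]] unfolding T_def by blast
      have ti: "integrable lborel (\<lambda>\<xi>. tri (s * real m * \<xi> - of_int j))"
        using s m by (intro integrable_tri_affine) simp
      show ?thesis
      proof (rule approx_translates_local[OF g u(1) integrable_ft_mult[OF h ti] _ nz[of x0] u(2)])
        have "integrable lborel (conv h (ift (\<lambda>\<xi>. tri (s * real m * \<xi> - of_int j))))"
          by (intro integrable_conv h integrable_ift_tri_affine sm)
        then show "integrable lborel (ift (\<lambda>\<xi>. ft h \<xi> * tri (s * real m * \<xi> - of_int j)))"
          by (simp add: conv_ift[OF h ti, abs_def])
        fix \<xi> assume "ft h \<xi> * tri (s * real m * \<xi> - of_int j) \<noteq> 0"
        then have "\<bar>s * real m * \<xi> - of_int j\<bar> \<le> 1" using tri_eq_0[of "s * real m * \<xi> - of_int j"] by fastforce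
        then have "lam * \<bar>s * real m * \<xi> - of_int j\<bar> \<le> lam * 1" using lam by (intro mult_left_mono) auto
        also have "lam * \<bar>s * real m * \<xi> - of_int j\<bar> = \<bar>lam * (s * real m * \<xi> - of_int j)\<bar>"
          using lam by (simp add: abs_mult)
        also have "lam * (s * real m * \<xi> - of_int j) = \<xi> - x0"
          using s m by (simp add: lam_def x0_def field_simps)
        finally show "ft u \<xi> = 1 - ft g \<xi> / ft g x0" by (intro u(3)) simp
      qed
    qed
    have ti: "integrable lborel (\<lambda>\<xi>. ft h \<xi> * tri (s * real m * \<xi> - of_int j))" for j
      using s m by (intro integrable_ft_mult h integrable_tri_affine) simp
    \<comment> \<open>The values of \<open>tri (s * \<xi>)\<close> at the grid frequencies
      \<open>j * lam\<close>.\<close>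
    define c where "c j = complex_of_real ((real m - \<bar>real_of_int j\<bar>) / real m)" for j
    have tri_eq: "ft h \<xi> * tri (s * \<xi>) = (\<Sum>j\<in>S. c j * (ft h \<xi> * tri (s * real m * \<xi> - of_int j)))" for \<xi>
    proof -
      have "(\<Sum>j\<in>S. c j * (ft h \<xi> * tri (s * real m * \<xi> - of_int j)))
        = ft h \<xi> / of_real (real m) * (\<Sum>j\<in>S. of_real (real m - \<bar>real_of_int j\<bar>) * tri (s * real m * \<xi> - of_int j))"
        by (simp add: sum_distrib_left c_def mult_ac)
      also have "\<dots> = ft h \<xi> * of_real (max 0 (real m - \<bar>s * real m * \<xi>\<bar>) / real m)"
        unfolding S_def sum_tri by simp
      also have "max 0 (real m - \<bar>s * real m * \<xi>\<bar>) / real m = max 0 (1 - \<bar>s * \<xi>\<bar>)"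
        using m by (simp add: abs_mult max_def field_simps)
      finally show ?thesis by (simp add: tri_def)
    qed
    have "ift (\<lambda>\<xi>. ft h \<xi> * tri (s * \<xi>)) = (\<lambda>t. \<Sum>j\<in>S. c j * ift (\<lambda>\<xi>. ft h \<xi> * tri (s * real m * \<xi> - of_int j)) t)"
      unfolding tri_eq by (rule ext) (simp add: ift_sum ift_cmult ti)
    then show ?thesis
      by (simp only:) (intro approx_translates_sum approx_translates_cmult piece, auto simp: S_def)
  qed
  show ?thesis
  proof (rule approx_translates_closed)
    fix \<epsilon> :: real assume \<epsilon>: "\<epsilon> > 0"
    have "(\<lambda>n. \<integral>\<^sup>+t. ennreal (norm ((\<integral>y. fejer y * h (t - 1 / real (Suc n) * y) \<partial>lborel) - h t)) \<partial>lborel) \<longlonglongrightarrow> 0"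
      by (intro approximate_identity integrable_fejer h integral_fejer LIMSEQ_Suc[OF lim_1_over_n])
    then have "eventually (\<lambda>n. (\<integral>\<^sup>+t. ennreal (norm ((\<integral>y. fejer y * h (t - 1 / real (Suc n) * y) \<partial>lborel) - h t)) \<partial>lborel) < ennreal \<epsilon>) sequentially"
      using \<epsilon> by (intro order_tendstoD) auto
    then obtain n where n: "(\<integral>\<^sup>+t. ennreal (norm ((\<integral>y. fejer y * h (t - 1 / real (Suc n) * y) \<partial>lborel) - h t)) \<partial>lborel) < ennreal \<epsilon>"
      by (auto simp: eventually_sequentially)
    define s where "s = 1 / real (Suc n)"
    have s: "s > 0" by (simp add: s_def)
    have "(\<integral>y. fejer y * h (t - s * y) \<partial>lborel) = ift (\<lambda>\<xi>. ft h \<xi> * tri (s * \<xi>)) t" for t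
    proof -
      have ti: "integrable lborel (\<lambda>\<xi>. tri (s * \<xi>))" using integrable_tri_affine[of s 0] s by simp
      have "(\<integral>y. fejer y * h (t - s * y) \<partial>lborel) = conv h (\<lambda>y. fejer (y / s) / of_real s) t"
        by (rule dilated_conv[OF s])
      also have "(\<lambda>y. fejer (y / s) / of_real s) = ift (\<lambda>\<xi>. tri (s * \<xi>))"
        by (simp add: ift_tri_dilate[OF s] fun_eq_iff)
      finally show ?thesis by (simp add: conv_ift[OF h ti])
    qed
    then have "(\<integral>\<^sup>+t. ennreal (norm (h t - ift (\<lambda>\<xi>. ft h \<xi> * tri (s * \<xi>)) t) ^ 1) \<partial>lborel) < ennreal \<epsilon>"
      using n by (simp only: s_def[symmetric] norm_minus_commute[of "h _"] power_one_right)
    moreover have "ift (\<lambda>\<xi>. ft h \<xi> * tri (s * \<xi>)) \<in> borel_measurable borel" by measurable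
    ultimately show "\<exists>h'. h' \<in> borel_measurable borel \<and> approx_translates 1 g h' \<and>
      (\<integral>\<^sup>+x. ennreal (norm (h x - h' x) ^ 1) \<partial>lborel) < ennreal \<epsilon>"
      using main[OF s] by blast
  qed auto
qed

text \<open>Since \<open>g\<close> and \<open>h\<close> are real, replacing the coefficients by
  their real parts replaces the error by its real part, which is no larger.\<close>

lemma approx_translates_real:
  assumes "approx_translates p (\<lambda>x. complex_of_real (g x)) (\<lambda>x. of_real (h x))" and "\<epsilon> > 0"
  shows "\<exists>(m::nat) c a. (\<integral>\<^sup>+x. ennreal (\<bar>h x - (\<Sum>k<m. c k * g (x + a k))\<bar> ^ p) \<partial>lborel) < ennreal \<epsilon>"
proof -
  obtain m c a where
    b: "(\<integral>\<^sup>+x. ennreal (norm (complex_of_real (h x) - (\<Sum>k<(m::nat). c k * of_real (g (x + a k)))) ^ p) \<partial>lborel) < ennreal \<epsilon>"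
    using assms unfolding approx_translates_def by blast
  have "(\<integral>\<^sup>+x. ennreal (\<bar>h x - (\<Sum>k<m. Re (c k) * g (x + a k))\<bar> ^ p) \<partial>lborel)
    \<le> (\<integral>\<^sup>+x. ennreal (norm (complex_of_real (h x) - (\<Sum>k<(m::nat). c k * of_real (g (x + a k)))) ^ p) \<partial>lborel)"
  proof (intro nn_integral_mono ennreal_leI power_mono)
    fix x
    have "h x - (\<Sum>k<m. Re (c k) * g (x + a k)) = Re (complex_of_real (h x) - (\<Sum>k<m. c k * of_real (g (x + a k))))"
      by simp
    then show "\<bar>h x - (\<Sum>k<m. Re (c k) * g (x + a k))\<bar> \<le> norm (complex_of_real (h x) - (\<Sum>k<m. c k * of_real (g (x + a k))))"
      using abs_Re_le_cmod by metis
  qed simp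
  also note b
  finally show ?thesis by (intro exI[of _ m] exI[of _ "\<lambda>k. Re (c k)"] exI[of _ a])
qed

lemma ft_translate: "ft (\<lambda>t. h (t + a)) x = cis (a * x) * ft h x"
proof -
  have "ft (\<lambda>t. h (t + a)) x = (\<integral>t. cis (- (x * (t - a))) * h t \<partial>lborel)"
    unfolding ft_def using lborel_integral_real_affine[of 1 "\<lambda>t. cis (- (x * t)) * h (t + a)" "- a"] by simp
  also have "\<dots> = (\<integral>t. cis (a * x) * (cis (- (x * t)) * h t) \<partial>lborel)"
  proof (intro Bochner_Integration.integral_cong refl)
    fix t
    have "cis (- (x * (t - a))) = cis (a * x) * cis (- (x * t))" by (simp add: cis_mult algebra_simps)
    then show "cis (- (x * (t - a))) * h t = cis (a * x) * (cis (- (x * t)) * h t)" by simp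
  qed
  finally show ?thesis unfolding ft_def by (simp only: integral_mult_right_zero)
qed

theorem wiener_L1:
  fixes g :: "real \<Rightarrow> real"
  assumes g: "integrable lborel g"
  shows "(\<forall>x. fourier g x \<noteq> 0) \<longleftrightarrow> translates_dense_L1 g"
proof
  assume nz: "\<forall>x. fourier g x \<noteq> 0"
  show "translates_dense_L1 g"
    unfolding translates_dense_L1_def
  proof (intro allI impI)
    fix h :: "real \<Rightarrow> real" and \<epsilon> :: real
    assume h: "integrable lborel h" and \<epsilon>: "\<epsilon> > 0"
    have "approx_translates 1 (\<lambda>x. complex_of_real (g x)) (\<lambda>x. of_real (h x))"
      using g h nz by (intro wiener_L1_complex) (auto simp: fourier_eq_ft)
    from approx_translates_real[OF this \<epsilon>]
    show "\<exists>(m::nat) c a. (\<integral>\<^sup>+x. ennreal \<bar>h x - (\<Sum>k<m. c k * g (x + a k))\<bar> \<partial>lborel) < ennreal \<epsilon>" by simp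
  qed
next
  assume dense: "translates_dense_L1 g"
  show "\<forall>x. fourier g x \<noteq> 0"
  proof (intro allI notI)
    fix x assume 0: "fourier g x = 0"
    \<comment> \<open>The test function is a Gaussian because its transform vanishes nowhere,
      whatever the zero \<open>x\<close> of \<open>fourier g\<close> is.\<close>
    define h :: "real \<Rightarrow> real" where "h t = exp (- (1 * t)\<^sup>2 / 2)" for t
    have h: "integrable lborel h" unfolding h_def[abs_def] by (rule integrable_exp_square) simp
    let ?h = "\<lambda>t. complex_of_real (h t)"
    define \<epsilon> where "\<epsilon> = norm (ft ?h x)"
    have "ft ?h x = of_real (2 * pi * normal_density 0 1 x)"
      unfolding h_def by (rule ft_exp_square) simp
    then have \<epsilon>: "\<epsilon> > 0" using normal_density_pos[of 1 0 x] by (simp add: \<epsilon>_def norm_mult)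
    then obtain m c a where
      b: "(\<integral>\<^sup>+x. ennreal \<bar>h x - (\<Sum>k<(m::nat). c k * g (x + a k))\<bar> \<partial>lborel) < ennreal \<epsilon>"
      using dense h unfolding translates_dense_L1_def by blast
    let ?g = "\<lambda>t. complex_of_real (g t)"
    have gt: "integrable lborel (\<lambda>t. of_real (c k) * ?g (t + a k))" for k
      using lborel_integrable_real_affine[of ?g 1 "a k"] g by (intro integrable_mult_right) (simp add: add.commute)
    define d where "d t = ?h t - (\<Sum>k<m. of_real (c k) * ?g (t + a k))" for t
    have d: "integrable lborel d" unfolding d_def[abs_def] using h gt by (intro Bochner_Integration.integrable_diff Bochner_Integration.integrable_sum) auto
    \<comment> \<open>Every translate of \<open>g\<close> has transform 0 at \<open>x\<close>, so
      the transform of the error is that of \<open>h\<close>, which bounds the L^1 norm of the error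
      from below by \<epsilon>.\<close>
    have "ft d x = ft ?h x - (\<Sum>k<m. ft (\<lambda>t. of_real (c k) * ?g (t + a k)) x)"
      unfolding d_def[abs_def] using h gt by (subst ft_diff) (auto simp: ft_sum)
    also have "\<dots> = ft ?h x" using 0 by (simp add: ft_cmult ft_translate[of ?g] fourier_eq_ft)
    finally have "ennreal \<epsilon> \<le> ennreal (\<integral>t. norm (d t) \<partial>lborel)"
      using norm_ft_le[of d x] by (simp add: \<epsilon>_def ennreal_leI)
    also have "\<dots> = (\<integral>\<^sup>+t. ennreal (norm (d t)) \<partial>lborel)"
      using d by (intro nn_integral_eq_integral[symmetric]) auto
    also have "\<dots> = (\<integral>\<^sup>+t. ennreal \<bar>h t - (\<Sum>k<m. c k * g (t + a k))\<bar> \<partial>lborel)"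
    proof (intro nn_integral_cong)
      fix t
      have "d t = of_real (h t - (\<Sum>k<m. c k * g (t + a k)))" by (simp add: d_def)
      then show "ennreal (norm (d t)) = ennreal \<bar>h t - (\<Sum>k<m. c k * g (t + a k))\<bar>" by (simp only: norm_of_real)
    qed
    finally show False using b by simp
  qed
qed

section \<open>Wiener's theorem for square-integrable functions\<close>

text \<open>The signed square \<open>g * |g|\<close> is integrable, and \<open>|a - b|^2\<close> is
  at most twice the difference of the signed squares of \<open>a\<close> and \<open>b\<close>, so
  the L^1 statement suffices. Keeping the sign matters: a plain square would not distinguish
  \<open>a\<close> from \<open>- a\<close>.\<close>

lemma translation_continuous_L2:
  fixes g :: "real \<Rightarrow> real"
  assumes [measurable]: "g \<in> borel_measurable borel" and g: "integrable lborel (\<lambda>x. (g x)\<^sup>2)"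
    and y: "y \<longlonglongrightarrow> 0"
  shows "(\<lambda>n. \<integral>\<^sup>+t. ennreal (norm (complex_of_real (g (t + y n)) - of_real (g t)) ^ 2) \<partial>lborel) \<longlonglongrightarrow> 0"
proof -
  define q where "q t = g t * \<bar>g t\<bar>" for t
  have [measurable]: "q \<in> borel_measurable borel" unfolding q_def[abs_def] by measurable
  have q: "integrable lborel q"
    by (rule Bochner_Integration.integrable_bound[OF g]) (auto simp: q_def abs_mult power2_eq_square)
  have le2: "x \<le> 2 * x" if "x \<ge> 0" for x :: real using that by simp
  have le: "\<bar>a - b\<bar>\<^sup>2 \<le> 2 * \<bar>a * \<bar>a\<bar> - b * \<bar>b\<bar>\<bar>" for a b :: real
  proof -
    consider "a \<ge> 0 \<and> b \<ge> 0 \<or> a \<le> 0 \<and> b \<le> 0" | "a \<ge> 0 \<and> b \<le> 0 \<or> a \<le> 0 \<and> b \<ge> 0" by linarith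
    then show ?thesis
    proof cases
      case 1
      then have "\<bar>a - b\<bar> \<le> \<bar>a + b\<bar>" by linarith
      then have "\<bar>a - b\<bar> * \<bar>a - b\<bar> \<le> \<bar>a - b\<bar> * \<bar>a + b\<bar>" by (intro mult_left_mono) auto
      also have "\<dots> = \<bar>(a - b) * (a + b)\<bar>" by (simp add: abs_mult)
      also have "(a - b) * (a + b) = a * a - b * b" by (simp add: algebra_simps)
      also have "\<bar>a * a - b * b\<bar> = \<bar>a * \<bar>a\<bar> - b * \<bar>b\<bar>\<bar>" using 1 by auto
      finally have "\<bar>a - b\<bar>\<^sup>2 \<le> \<bar>a * \<bar>a\<bar> - b * \<bar>b\<bar>\<bar>" unfolding power2_eq_square .
      also have "\<dots> \<le> 2 * \<bar>a * \<bar>a\<bar> - b * \<bar>b\<bar>\<bar>" by (rule le2) simp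
      finally show ?thesis .
    next
      case 2
      then have "\<bar>a * \<bar>a\<bar> - b * \<bar>b\<bar>\<bar> = a * a + b * b" by auto
      moreover have "\<bar>a - b\<bar>\<^sup>2 \<le> 2 * (a * a + b * b)"
        using zero_le_power2[of "a + b"] by (simp add: power2_eq_square algebra_simps)
      ultimately show ?thesis by simp
    qed
  qed
  have lim: "(\<lambda>n. 2 * (\<integral>\<^sup>+t. ennreal (norm (q (t + y n) - q t)) \<partial>lborel)) \<longlonglongrightarrow> 0"
    using ennreal_tendsto_cmult[OF _ translation_continuous_L1[OF q y], of 2] by simp
  show ?thesis
  proof (rule tendsto_sandwich[OF _ _ tendsto_const lim])
    have "(\<integral>\<^sup>+t. ennreal (norm (complex_of_real (g (t + y n)) - of_real (g t)) ^ 2) \<partial>lborel)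
      \<le> 2 * (\<integral>\<^sup>+t. ennreal (norm (q (t + y n) - q t)) \<partial>lborel)" for n
    proof -
      have "(\<integral>\<^sup>+t. ennreal (norm (complex_of_real (g (t + y n)) - of_real (g t)) ^ 2) \<partial>lborel)
       \<le> (\<integral>\<^sup>+t. 2 * ennreal (norm (q (t + y n) - q t)) \<partial>lborel)"
      proof (rule nn_integral_mono)
        fix t
        have "ennreal (norm (complex_of_real (g (t + y n)) - of_real (g t)) ^ 2) \<le> ennreal (2 * norm (q (t + y n) - q t))"
          using le[of "g (t + y n)" "g t"]
          by (intro ennreal_leI) (simp add: q_def of_real_diff[symmetric] del: of_real_diff)
        then show "ennreal (norm (complex_of_real (g (t + y n)) - of_real (g t)) ^ 2) \<le> 2 * ennreal (norm (q (t + y n) - q t))"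
          by (simp add: ennreal_mult)
      qed
      then show ?thesis by (simp add: nn_integral_cmult)
    qed
    then show "eventually (\<lambda>n. (\<integral>\<^sup>+t. ennreal (norm (complex_of_real (g (t + y n)) - of_real (g t)) ^ 2) \<partial>lborel)
      \<le> 2 * (\<integral>\<^sup>+t. ennreal (norm (q (t + y n) - q t)) \<partial>lborel)) sequentially" by simp
  qed simp
qed

section \<open>Gaussian smoothing on the frequency side\<close>

definition gauss :: "real \<Rightarrow> real \<Rightarrow> complex" where
  "gauss s t = of_real (normal_density 0 s t)"

lemma integrable_gauss: "s > 0 \<Longrightarrow> integrable lborel (gauss s)"
  unfolding gauss_def[abs_def] by (rule integrable_normal_density_complex)

lemma gauss_measurable [measurable]: "gauss s \<in> borel_measurable borel"
  unfolding gauss_def[abs_def] by measurable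

lemma gauss_eq_ift: "s > 0 \<Longrightarrow> gauss s = ift (\<lambda>t. of_real (exp (- (s * t)\<^sup>2 / 2)))"
  unfolding gauss_def ift_def by (simp add: fun_eq_iff ft_exp_square[simplified] normal_density_def)

lemma gauss_dilate: "s > 0 \<Longrightarrow> gauss s y = gauss 1 (y / s) / of_real s"
  by (simp add: gauss_def normal_density_def real_sqrt_mult power_divide)

lemma ft_gauss:
  assumes s: "s > 0"
  shows "ft (gauss s) x = of_real (sqrt (2 * pi) / s) * gauss (1 / s) x"
proof -
  have "gauss s = (\<lambda>t. of_real (1 / (sqrt (2 * pi) * s)) * of_real (exp (- (1 / s * t)\<^sup>2 / 2)))"
    using s by (simp add: gauss_def normal_density_def fun_eq_iff real_sqrt_mult power_divide)
  then have "ft (gauss s) x = of_real (1 / (sqrt (2 * pi) * s)) * of_real (2 * pi * normal_density 0 (1 / s) x)"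
    using s by (simp only: ft_cmult ft_exp_square zero_less_divide_1_iff)
  also have "\<dots> = of_real (sqrt (2 * pi) / s) * gauss (1 / s) x"
  proof -
    have "1 / (sqrt (2 * pi) * s) * (2 * pi) = sqrt (2 * pi) / s"
      using real_div_sqrt[of "2 * pi"] by (simp add: divide_simps)
    then show ?thesis unfolding gauss_def of_real_mult[symmetric] by (simp only: mult.assoc[symmetric])
  qed
  finally show ?thesis .
qed

lemma norm_conv_gauss_le:
  assumes s: "s > 0" and J: "integrable lborel J" and B: "\<And>x. norm (J x) \<le> B"
  shows "norm (conv J (gauss s) t) \<le> B"
proof -
  have "norm (conv J (gauss s) t) = norm (\<integral>y. gauss s y * J (t - y) \<partial>lborel)"
    by (subst conv_commute) (simp add: conv_def)
  also have "\<dots> \<le> (\<integral>y. norm (gauss s y * J (t - y)) \<partial>lborel)"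
    by (rule integral_norm_bound)
  also have "\<dots> \<le> (\<integral>y. normal_density 0 s y * B \<partial>lborel)"
  proof (rule integral_mono)
    have "integrable lborel (\<lambda>y. J (t - y) * gauss s y)"
    proof (rule integrable_bounded_mult[OF integrable_gauss[OF s]])
      have [measurable]: "J \<in> borel_measurable borel" using J by auto
      show "(\<lambda>y. J (t - y)) \<in> borel_measurable borel" by measurable
    qed (rule B)
    then show "integrable lborel (\<lambda>y. norm (gauss s y * J (t - y)))"
      by (intro integrable_norm) (simp add: mult.commute)
    show "integrable lborel (\<lambda>y. normal_density 0 s y * B)"
      using s by (intro integrable_mult_left integrable_normal_density)
  qed (auto simp: norm_mult gauss_def intro!: mult_left_mono B)
  also have "\<dots> = B" using s by simp
  finally show ?thesis .
qed

text \<open>\<open>J\<close> and its Gaussian averages are both bounded by \<open>B\<close>, so the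
  squared error is at most \<open>2 * B\<close> times the error itself, and L^1 convergence
  suffices. The \<open>+ 1\<close> in the threshold covers \<open>B = 0\<close>.\<close>

lemma gauss_smoothing_L2:
  assumes J: "integrable lborel J" and B: "\<And>x. norm (J x) \<le> B" and \<epsilon>: "\<epsilon> > (0::real)"
  shows "\<exists>s>0. (\<integral>\<^sup>+t. ennreal (norm (J t - conv J (gauss s) t) ^ 2) \<partial>lborel) < ennreal \<epsilon>"
proof -
  have [measurable]: "J \<in> borel_measurable borel" using J by auto
  have B0: "B \<ge> 0" using norm_ge_zero order_trans B by blast
  have g1: "(\<integral>y. gauss 1 y \<partial>lborel) = 1"
    unfolding gauss_def by (subst integral_complex_of_real) simp
  have "(\<lambda>n. \<integral>\<^sup>+t. ennreal (norm ((\<integral>y. gauss 1 y * J (t - 1 / real (Suc n) * y) \<partial>lborel) - J t)) \<partial>lborel) \<longlonglongrightarrow> 0"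
    by (intro approximate_identity integrable_gauss J g1 LIMSEQ_Suc[OF lim_1_over_n]) simp
  then have "eventually (\<lambda>n. (\<integral>\<^sup>+t. ennreal (norm ((\<integral>y. gauss 1 y * J (t - 1 / real (Suc n) * y) \<partial>lborel) - J t)) \<partial>lborel) < ennreal (\<epsilon> / (2 * B + 1))) sequentially"
    using \<epsilon> B0 by (intro order_tendstoD) auto
  then obtain n where n: "(\<integral>\<^sup>+t. ennreal (norm ((\<integral>y. gauss 1 y * J (t - 1 / real (Suc n) * y) \<partial>lborel) - J t)) \<partial>lborel) < ennreal (\<epsilon> / (2 * B + 1))"
    by (auto simp: eventually_sequentially)
  define s where "s = 1 / real (Suc n)"
  have s: "s > 0" by (simp add: s_def)
  have c: "(\<integral>y. gauss 1 y * J (t - s * y) \<partial>lborel) = conv J (gauss s) t" for t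
    unfolding dilated_conv[OF s] using gauss_dilate[OF s] by (simp add: conv_def)
  have "(\<integral>\<^sup>+t. ennreal (norm (J t - conv J (gauss s) t) ^ 2) \<partial>lborel)
     \<le> (\<integral>\<^sup>+t. ennreal (2 * B) * ennreal (norm (J t - conv J (gauss s) t)) \<partial>lborel)"
  proof (rule nn_integral_mono)
    fix t
    have "norm (J t - conv J (gauss s) t) \<le> 2 * B"
      using norm_triangle_ineq4[of "J t" "conv J (gauss s) t"] B[of t] norm_conv_gauss_le[OF s J B, of t] by linarith
    then have "norm (J t - conv J (gauss s) t) ^ 2 \<le> 2 * B * norm (J t - conv J (gauss s) t)"
      unfolding power2_eq_square by (intro mult_right_mono) auto
    then show "ennreal (norm (J t - conv J (gauss s) t) ^ 2) \<le> ennreal (2 * B) * ennreal (norm (J t - conv J (gauss s) t))"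
      using B0 by (subst ennreal_mult[symmetric]) (auto intro: ennreal_leI)
  qed
  also have "\<dots> = ennreal (2 * B) * (\<integral>\<^sup>+t. ennreal (norm (J t - conv J (gauss s) t)) \<partial>lborel)"
    by (rule nn_integral_cmult) measurable
  also have "\<dots> \<le> ennreal (2 * B) * ennreal (\<epsilon> / (2 * B + 1))"
    using n unfolding s_def[symmetric] c by (intro mult_left_mono) (auto simp: norm_minus_commute)
  also have "\<dots> = ennreal (2 * B * (\<epsilon> / (2 * B + 1)))" using B0 \<epsilon> by (subst ennreal_mult) auto
  also have "\<dots> < ennreal \<epsilon>"
    using B0 \<epsilon> by (intro ennreal_lessI) (auto simp: field_simps)
  finally show ?thesis using s by blast
qed

text \<open>Smoothing a spectrum with a Gaussian multiplies its bounded inverse transform by a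
  Gaussian. This yields an integrable kernel, as \<open>approx_translates_conv\<close> demands, from
  a \<open>J\<close> that need not be continuous.\<close>

lemma integrable_ift_conv_gauss:
  assumes s: "s > 0" and J: "integrable lborel J"
  shows "integrable lborel (ift (conv J (gauss s)))"
proof -
  have [measurable]: "J \<in> borel_measurable borel" using J by auto
  have "integrable lborel (\<lambda>t. ft J (- t) * gauss (1 / s) (0 + - 1 * t))"
    using s norm_ft_le[of J]
    by (intro integrable_bounded_mult lborel_integrable_real_affine integrable_gauss) auto
  then have "integrable lborel (\<lambda>t. of_real (sqrt (2 * pi) / s) / of_real (2 * pi) * (ft J (- t) * gauss (1 / s) (- t)))"
    by (intro integrable_mult_right) simp
  then show ?thesis
    unfolding ift_def[abs_def] ft_conv[OF J integrable_gauss[OF s]] ft_gauss[OF s] by (simp add: mult_ac)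
qed

text \<open>Division by \<open>ft g\<close> is carried out only where \<open>|ft g| > 1/n\<close>; since \<open>ft g\<close> vanishes on a
  null set, the error tends to zero.\<close>

lemma L2_division:
  fixes g H :: "real \<Rightarrow> complex"
  assumes g: "integrable lborel g" and nz: "AE x in lborel. ft g x \<noteq> 0"
    and H: "integrable lborel H" and C: "\<And>x. norm (H x) \<le> C" and \<epsilon>: "\<epsilon> > (0::real)"
  shows "\<exists>J B. integrable lborel J \<and> (\<forall>x. norm (J x) \<le> B) \<and>
     (\<integral>\<^sup>+x. ennreal (norm (H x - ft g x * J x) ^ 2) \<partial>lborel) < ennreal \<epsilon>"
proof -
  have [measurable]: "g \<in> borel_measurable borel" "H \<in> borel_measurable borel" using g H by auto
  have C0: "C \<ge> 0" using norm_ge_zero order_trans C by blast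
  \<comment> \<open>The reciprocal of \<open>ft g\<close>, set to 0 where it would exceed
    \<open>Suc n\<close> in modulus; its boundedness keeps \<open>D n x * H x\<close> integrable and
    bounded.\<close>
  define D where "D n x = (if norm (ft g x) > 1 / real (Suc n) then 1 / ft g x else 0)" for n x
  have [measurable]: "D n \<in> borel_measurable borel" for n unfolding D_def[abs_def] by measurable
  have DB: "norm (D n x) \<le> real (Suc n)" for n x
  proof (cases "norm (ft g x) > 1 / real (Suc n)")
    case True
    then have "norm (ft g x) > 0" by (rule order.strict_trans[rotated]) simp
    moreover from True have "1 < norm (ft g x) * real (Suc n)" by (simp only: divide_less_eq)
    ultimately have "1 / norm (ft g x) \<le> real (Suc n)" by (simp add: divide_le_eq mult.commute del: of_nat_Suc)
    then show ?thesis using True by (simp add: D_def norm_divide del: of_nat_Suc)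
  qed (simp add: D_def)
  have eq: "H x - ft g x * (D n x * H x) = (if norm (ft g x) > 1 / real (Suc n) then 0 else H x)" for n x
  proof (cases "norm (ft g x) > 1 / real (Suc n)")
    case True
    then have "ft g x \<noteq> 0" by auto
    then show ?thesis using True by (simp add: D_def)
  qed (simp add: D_def)
  have "(\<lambda>n. \<integral>\<^sup>+x. ennreal (norm (H x - ft g x * (D n x * H x)) ^ 2) \<partial>lborel) \<longlonglongrightarrow> (\<integral>\<^sup>+(x::real). 0 \<partial>lborel)"
  proof (rule nn_integral_dominated_convergence)
    show "(\<integral>\<^sup>+x. ennreal C * ennreal (norm (H x)) \<partial>lborel) < \<infinity>"
      using H by (simp add: nn_integral_cmult integrable_iff_bounded ennreal_mult_less_top)
    show "AE x in lborel. ennreal (norm (H x - ft g x * (D n x * H x)) ^ 2) \<le> ennreal C * ennreal (norm (H x))" for n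
    proof (rule AE_I2)
      fix x
      have "norm (H x - ft g x * (D n x * H x)) ^ 2 \<le> C * norm (H x)"
        unfolding eq using C[of x] C0 by (auto simp: power2_eq_square intro!: mult_right_mono)
      then show "ennreal (norm (H x - ft g x * (D n x * H x)) ^ 2) \<le> ennreal C * ennreal (norm (H x))"
        using C0 by (subst ennreal_mult[symmetric]) (auto intro: ennreal_leI)
    qed
    show "AE x in lborel. (\<lambda>n. ennreal (norm (H x - ft g x * (D n x * H x)) ^ 2)) \<longlonglongrightarrow> 0"
      using nz
    proof eventually_elim
      case (elim x)
      then have "eventually (\<lambda>n. 1 / real (Suc n) < norm (ft g x)) sequentially"
        by (intro order_tendstoD(2)[OF LIMSEQ_Suc[OF lim_1_over_n]]) simp
      then show ?case by (intro tendsto_eventually) (erule eventually_mono, simp add: eq del: of_nat_Suc)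
    qed
  qed auto
  then have "eventually (\<lambda>n. (\<integral>\<^sup>+x. ennreal (norm (H x - ft g x * (D n x * H x)) ^ 2) \<partial>lborel) < ennreal \<epsilon>) sequentially"
    using \<epsilon> by (intro order_tendstoD) auto
  then obtain n where "(\<integral>\<^sup>+x. ennreal (norm (H x - ft g x * (D n x * H x)) ^ 2) \<partial>lborel) < ennreal \<epsilon>"
    by (auto simp: eventually_sequentially)
  moreover have "integrable lborel (\<lambda>x. D n x * H x)"
    using DB by (intro integrable_bounded_mult H) auto
  moreover have "norm (D n x * H x) \<le> real (Suc n) * C" for x
    unfolding norm_mult using DB[of n x] C[of x] by (intro mult_mono) auto
  ultimately show ?thesis by (intro exI[of _ "\<lambda>x. D n x * H x"] exI[of _ "real (Suc n) * C"]) auto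
qed

text \<open>Two smoothings with different purposes: that of \<open>h\<close> makes the spectrum
  \<open>H\<close> integrable, that of the quotient \<open>J\<close> makes \<open>ift K\<close>
  integrable, so that its convolution with \<open>g\<close> lies in the closed span.\<close>

lemma approx_translates_L2_bounded:
  fixes g :: "real \<Rightarrow> real" and h :: "real \<Rightarrow> complex"
  assumes g: "integrable lborel g" and g2: "integrable lborel (\<lambda>x. (g x)\<^sup>2)"
    and nz: "AE x in lborel. ft (\<lambda>t. of_real (g t)) x \<noteq> 0"
    and h: "integrable lborel h" and B: "\<And>x. norm (h x) \<le> B"
  shows "approx_translates 2 (\<lambda>t. of_real (g t)) h"
proof -
  let ?g = "\<lambda>t. complex_of_real (g t)"
  have gc: "integrable lborel ?g" using g by simp
  have [measurable]: "g \<in> borel_measurable borel" "h \<in> borel_measurable borel" using g h by auto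
  have g2': "(\<integral>\<^sup>+t. ennreal (norm (?g t) ^ 2) \<partial>lborel) < \<infinity>"
    using g2 by (simp add: integrable_iff_bounded)
  have convg: "approx_translates 2 ?g (conv ?g k)" if k: "integrable lborel k" for k
  proof -
    have "approx_translates 2 ?g (conv k ?g)"
      using translation_continuous_L2[OF _ g2] by (intro approx_translates_conv k gc g2') auto
    moreover have "conv k ?g = conv ?g k" by (rule ext) (rule conv_commute)
    ultimately show ?thesis by simp
  qed
  define M where "M = (\<integral>t. norm (?g t) \<partial>lborel)"
  have M: "M \<ge> 0" "norm (ft ?g x) \<le> M" for x unfolding M_def by (simp, rule norm_ft_le)
  have smooth: "approx_translates 2 ?g (conv h (gauss s))" if s: "s > 0" for s
  proof (rule approx_translates_closed)
    fix \<epsilon> :: real assume \<epsilon>: "\<epsilon> > 0"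
    let ?\<gamma> = "\<lambda>t. complex_of_real (exp (- (s * t)\<^sup>2 / 2))"
    define H where "H x = ft h x * ?\<gamma> x" for x
    have H: "integrable lborel H"
      unfolding H_def[abs_def] by (intro integrable_ft_mult h integrable_exp_square_complex s)
    have HC: "norm (H x) \<le> (\<integral>t. norm (h t) \<partial>lborel)" for x
    proof -
      have "norm (H x) \<le> (\<integral>t. norm (h t) \<partial>lborel) * 1"
        unfolding H_def norm_mult by (intro mult_mono norm_ft_le) auto
      then show ?thesis by simp
    qed
    have hH: "conv h (gauss s) = ift H"
      unfolding H_def[abs_def] gauss_eq_ift[OF s]
      by (rule ext) (rule conv_ift[OF h integrable_exp_square_complex[OF s]])
    obtain J C where J: "integrable lborel J" "\<And>x. norm (J x) \<le> C"
      and HJ: "(\<integral>\<^sup>+x. ennreal (norm (H x - ft ?g x * J x) ^ 2) \<partial>lborel) < ennreal (\<epsilon> / 4)"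
      using L2_division[OF gc nz H HC, of "\<epsilon> / 4"] \<epsilon> by auto
    let ?D = "\<integral>\<^sup>+x. ennreal (norm (H x - ft ?g x * J x) ^ 2) \<partial>lborel"
    have [measurable]: "J \<in> borel_measurable borel" "H \<in> borel_measurable borel" using J H by auto
    \<comment> \<open>Multiplication by \<open>ft ?g\<close> enlarges a squared error by at most
      \<open>M^2\<close>, so this makes the smoothing error at most \<epsilon> / 4; the 1 covers
      \<open>M = 0\<close>.\<close>
    define \<delta> where "\<delta> = \<epsilon> / (4 * (M\<^sup>2 + 1))"
    have \<delta>: "\<delta> > 0" using \<epsilon> by (simp add: \<delta>_def add_nonneg_pos)
    obtain r where r: "r > 0" and JK: "(\<integral>\<^sup>+t. ennreal (norm (J t - conv J (gauss r) t) ^ 2) \<partial>lborel) < ennreal \<delta>"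
      using gauss_smoothing_L2[OF J \<delta>] by auto
    define K where "K = conv J (gauss r)"
    have K: "integrable lborel K" unfolding K_def by (intro integrable_conv J integrable_gauss r)
    have [measurable]: "K \<in> borel_measurable borel" using K by auto
    have k: "integrable lborel (ift K)" unfolding K_def by (rule integrable_ift_conv_gauss[OF r J(1)])
    have "(\<integral>\<^sup>+t. ennreal (norm (ift H t - conv ?g (ift K) t) ^ 2) \<partial>lborel)
       = (\<integral>\<^sup>+t. ennreal (norm (ift (\<lambda>x. H x - ft ?g x * K x) t) ^ 2) \<partial>lborel)"
      by (simp add: conv_ift[OF gc K] ift_diff[OF H integrable_ft_mult[OF gc K]])
    also have "\<dots> \<le> (\<integral>\<^sup>+x. ennreal (norm (H x - ft ?g x * K x) ^ 2) \<partial>lborel)"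
      by (intro nn_integral_ift_square_le Bochner_Integration.integrable_diff H integrable_ft_mult gc K)
    also have "\<dots> = (\<integral>\<^sup>+x. ennreal (norm ((H x - ft ?g x * J x) + ft ?g x * (J x - K x)) ^ 2) \<partial>lborel)"
      by (simp add: algebra_simps)
    also have "\<dots> \<le> 2 * ((\<integral>\<^sup>+x. ennreal (norm (H x - ft ?g x * J x) ^ 2) \<partial>lborel) +
        (\<integral>\<^sup>+x. ennreal (norm (ft ?g x * (J x - K x)) ^ 2) \<partial>lborel))"
      by (rule nn_integral_norm_add_le) auto
    also have "(\<integral>\<^sup>+x. ennreal (norm (ft ?g x * (J x - K x)) ^ 2) \<partial>lborel)
       \<le> (\<integral>\<^sup>+x. ennreal (M\<^sup>2) * ennreal (norm (J x - K x) ^ 2) \<partial>lborel)"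
      using M by (intro nn_integral_mono, subst ennreal_mult[symmetric])
        (auto simp: norm_mult power_mult_distrib intro!: ennreal_leI mult_right_mono power_mono)
    also have "\<dots> = ennreal (M\<^sup>2) * (\<integral>\<^sup>+x. ennreal (norm (J x - K x) ^ 2) \<partial>lborel)"
      by (rule nn_integral_cmult) measurable
    also have "\<dots> \<le> ennreal (M\<^sup>2) * ennreal \<delta>"
      using JK unfolding K_def by (intro mult_left_mono) auto
    also have "\<dots> = ennreal (M\<^sup>2 * \<delta>)" using \<delta> by (subst ennreal_mult) auto
    also have "\<dots> \<le> ennreal (\<epsilon> / 4)"
    proof (rule ennreal_leI)
      have "M\<^sup>2 * \<delta> \<le> (M\<^sup>2 + 1) * \<delta>" using \<delta> by (intro mult_right_mono) auto
      also have "\<dots> = \<epsilon> / 4" by (simp add: \<delta>_def divide_simps add_nonneg_eq_0_iff)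
      finally show "M\<^sup>2 * \<delta> \<le> \<epsilon> / 4" .
    qed
    also have "2 * (?D + ennreal (\<epsilon> / 4)) < 2 * (ennreal (\<epsilon> / 4) + ennreal (\<epsilon> / 4))"
    proof (intro ennreal_mult_strict_left_mono)
      show "?D + ennreal (\<epsilon> / 4) < ennreal (\<epsilon> / 4) + ennreal (\<epsilon> / 4)"
        unfolding add.commute[of ?D] using HJ by (simp add: ennreal_add_left_cancel_less)
    qed auto
    also have "\<dots> = ennreal \<epsilon>" using \<epsilon> by (intro ennreal_quarters) simp
    finally have "(\<integral>\<^sup>+t. ennreal (norm (ift H t - conv ?g (ift K) t) ^ 2) \<partial>lborel) < ennreal \<epsilon>"
      by (simp add: add_left_mono mult_left_mono)
    then show "\<exists>h'. h' \<in> borel_measurable borel \<and> approx_translates 2 ?g h' \<and>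
       (\<integral>\<^sup>+x. ennreal (norm (conv h (gauss s) x - h' x) ^ 2) \<partial>lborel) < ennreal \<epsilon>"
      using convg[OF k] unfolding hH by (intro exI[of _ "conv ?g (ift K)"]) auto
  qed auto
  show ?thesis
  proof (rule approx_translates_closed)
    fix \<epsilon> :: real assume "\<epsilon> > 0"
    from gauss_smoothing_L2[OF h B this] obtain s where
      "s > 0" "(\<integral>\<^sup>+t. ennreal (norm (h t - conv h (gauss s) t) ^ 2) \<partial>lborel) < ennreal \<epsilon>" by auto
    then show "\<exists>h'. h' \<in> borel_measurable borel \<and> approx_translates 2 ?g h' \<and>
       (\<integral>\<^sup>+x. ennreal (norm (h x - h' x) ^ 2) \<partial>lborel) < ennreal \<epsilon>"
      using smooth by (intro exI[of _ "conv h (gauss s)"]) auto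
  qed auto
qed

lemma L2_truncation:
  fixes h :: "real \<Rightarrow> real"
  assumes [measurable]: "h \<in> borel_measurable borel" and h2: "integrable lborel (\<lambda>x. (h x)\<^sup>2)" and \<epsilon>: "\<epsilon> > (0::real)"
  shows "\<exists>h' B. integrable lborel h' \<and> (\<forall>x. \<bar>h' x\<bar> \<le> B) \<and> (\<integral>\<^sup>+x. ennreal (\<bar>h x - h' x\<bar> ^ 2) \<partial>lborel) < ennreal \<epsilon>"
proof -
  define t where "t n x = (if \<bar>h x\<bar> \<le> real n \<and> \<bar>x\<bar> \<le> real n then h x else 0)" for n x
  have [measurable]: "t n \<in> borel_measurable borel" for n unfolding t_def[abs_def] by measurable
  have "(\<lambda>n. \<integral>\<^sup>+x. ennreal (\<bar>h x - t n x\<bar> ^ 2) \<partial>lborel) \<longlonglongrightarrow> (\<integral>\<^sup>+(x::real). 0 \<partial>lborel)"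
  proof (rule nn_integral_dominated_convergence)
    show "(\<integral>\<^sup>+x. ennreal ((h x)\<^sup>2) \<partial>lborel) < \<infinity>"
      using h2 by (simp add: integrable_iff_bounded)
    show "AE x in lborel. ennreal (\<bar>h x - t n x\<bar> ^ 2) \<le> ennreal ((h x)\<^sup>2)" for n
      by (auto simp: t_def)
    show "AE x in lborel. (\<lambda>n. ennreal (\<bar>h x - t n x\<bar> ^ 2)) \<longlonglongrightarrow> 0"
    proof (rule AE_I2)
      fix x :: real
      obtain N :: nat where N: "max \<bar>h x\<bar> \<bar>x\<bar> \<le> real N" using real_arch_simple by blast
      have "eventually (\<lambda>n. ennreal (\<bar>h x - t n x\<bar> ^ 2) = 0) sequentially"
        using eventually_ge_at_top[of N]
      proof eventually_elim
        case (elim n)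
        then have "\<bar>h x\<bar> \<le> real n \<and> \<bar>x\<bar> \<le> real n" using N by auto
        then show ?case by (simp add: t_def)
      qed
      then show "(\<lambda>n. ennreal (\<bar>h x - t n x\<bar> ^ 2)) \<longlonglongrightarrow> 0" by (rule tendsto_eventually)
    qed
  qed auto
  then have "eventually (\<lambda>n. (\<integral>\<^sup>+x. ennreal (\<bar>h x - t n x\<bar> ^ 2) \<partial>lborel) < ennreal \<epsilon>) sequentially"
    using \<epsilon> by (intro order_tendstoD) auto
  then obtain n where n: "(\<integral>\<^sup>+x. ennreal (\<bar>h x - t n x\<bar> ^ 2) \<partial>lborel) < ennreal \<epsilon>"
    by (auto simp: eventually_sequentially)
  have "integrable lborel (t n)"
  proof (rule Bochner_Integration.integrable_bound)
    show "integrable lborel (\<lambda>x. real n * indicator {- real n..real n} x)" by simp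
  qed (auto simp: t_def indicator_def)
  then show ?thesis using n by (intro exI[of _ "t n"] exI[of _ "real n"]) (auto simp: t_def)
qed

theorem wiener_L2:
  fixes g :: "real \<Rightarrow> real"
  assumes g: "integrable lborel g" and g2: "integrable lborel (\<lambda>x. (g x)\<^sup>2)"
  shows "{x. fourier g x = 0} \<in> null_sets lborel \<longleftrightarrow> translates_dense_L2 g"
proof
  let ?g = "\<lambda>t. complex_of_real (g t)"
  have [measurable]: "g \<in> borel_measurable borel" using g by auto
  assume Z: "{x. fourier g x = 0} \<in> null_sets lborel"
  have nz: "AE x in lborel. ft ?g x \<noteq> 0"
    using AE_not_in[OF Z] by (simp add: fourier_eq_ft)
  show "translates_dense_L2 g"
    unfolding translates_dense_L2_def
  proof (intro allI impI)
    fix h :: "real \<Rightarrow> real" and \<epsilon> :: real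
    assume "h \<in> borel_measurable lborel" and h2: "integrable lborel (\<lambda>x. (h x)\<^sup>2)" and \<epsilon>: "\<epsilon> > 0"
    then have hm [measurable]: "h \<in> borel_measurable borel" by simp
    have "approx_translates 2 ?g (\<lambda>x. of_real (h x))"
    proof (rule approx_translates_closed)
      fix \<delta> :: real assume \<delta>: "\<delta> > 0"
      from L2_truncation[OF hm h2 \<delta>] obtain h' B where h': "integrable lborel h'" "\<And>x. \<bar>h' x\<bar> \<le> B"
        "(\<integral>\<^sup>+x. ennreal (\<bar>h x - h' x\<bar> ^ 2) \<partial>lborel) < ennreal \<delta>"
        by blast
      have "approx_translates 2 ?g (\<lambda>x. of_real (h' x))"
        using h' by (intro approx_translates_L2_bounded g g2 nz) auto
      moreover have "(\<integral>\<^sup>+x. ennreal (norm (complex_of_real (h x) - of_real (h' x)) ^ 2) \<partial>lborel) < ennreal \<delta>"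
        using h'(3) unfolding of_real_diff[symmetric] norm_of_real .
      ultimately show "\<exists>h'. h' \<in> borel_measurable borel \<and> approx_translates 2 ?g h' \<and>
          (\<integral>\<^sup>+x. ennreal (norm (complex_of_real (h x) - h' x) ^ 2) \<partial>lborel) < ennreal \<delta>"
        using h'(1) by (intro exI[of _ "\<lambda>x. of_real (h' x)"]) auto
    qed auto
    from approx_translates_real[OF this \<epsilon>]
    show "\<exists>(m::nat) c a. (\<integral>\<^sup>+x. ennreal ((h x - (\<Sum>k<m. c k * g (x + a k)))\<^sup>2) \<partial>lborel) < ennreal \<epsilon>"
      by simp
  qed
next
  let ?g = "\<lambda>t. complex_of_real (g t)"
  have gc: "integrable lborel ?g" using g by simp
  have [measurable]: "g \<in> borel_measurable borel" using g by auto
  assume dense: "translates_dense_L2 g"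
  \<comment> \<open>Cutting to bounded intervals gives sets of finite measure with integrable
    indicators; the zero set is their countable union.\<close>
  define Z where "Z n = {x. ft ?g x = 0} \<inter> {- real n..real n}" for n :: nat
  have Zm [measurable]: "Z n \<in> sets borel" for n unfolding Z_def by measurable
  have "emeasure lborel (Z n) = 0" for n
  proof (rule ccontr)
    assume pos: "emeasure lborel (Z n) \<noteq> 0"
    have fin: "emeasure lborel (Z n) < \<infinity>"
      by (rule le_less_trans[OF emeasure_mono[of _ "{- real n..real n}"]]) (auto simp: Z_def)
    define E where "E x = complex_of_real (indicator (Z n) x)" for x
    have E: "integrable lborel E" unfolding E_def[abs_def] using fin by (intro integrable_of_real integrable_real_indicator) auto
    have [measurable]: "E \<in> borel_measurable borel" using E by auto
    \<comment> \<open>The reflection turns the value at 0 of a convolution with \<open>ift E\<close>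
      into a pairing with \<open>k\<close>. The kernel \<open>k\<close> is square-integrable but
      need not be integrable.\<close>
    define k where "k y = ift E (- y)" for y
    have [measurable]: "k \<in> borel_measurable borel" unfolding k_def[abs_def] by measurable
    have pairing: "(\<integral>y. u y * k y \<partial>lborel) = ift (\<lambda>\<xi>. ft u \<xi> * E \<xi>) 0" if "integrable lborel u" for u
      using conv_ift[OF that E, of 0] by (simp add: conv_def k_def)
    let ?M = "emeasure lborel (Z n)"
    have k2: "(\<integral>\<^sup>+y. ennreal (norm (k y)) ^ 2 \<partial>lborel) \<le> ?M"
    proof -
      have "(\<integral>\<^sup>+y. ennreal (norm (k y)) ^ 2 \<partial>lborel) = (\<integral>\<^sup>+y. ennreal (norm (ift E y) ^ 2) \<partial>lborel)"
        using nn_integral_real_affine[of "\<lambda>y. ennreal (norm (ift E y) ^ 2)" "-1" 0] by (simp add: k_def ennreal_power)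
      also have "\<dots> \<le> (\<integral>\<^sup>+\<xi>. ennreal (norm (E \<xi>) ^ 2) \<partial>lborel)" by (rule nn_integral_ift_square_le[OF E])
      also have "\<dots> = (\<integral>\<^sup>+\<xi>. indicator (Z n) \<xi> \<partial>lborel)"
        by (intro nn_integral_cong) (auto simp: E_def indicator_def)
      finally show ?thesis by simp
    qed
    define h :: "real \<Rightarrow> real" where "h t = exp (- (1 * t)\<^sup>2 / 2)" for t
    let ?h = "\<lambda>t. complex_of_real (h t)"
    have h: "integrable lborel h" unfolding h_def[abs_def] by (rule integrable_exp_square) simp
    have h2: "integrable lborel (\<lambda>t. (h t)\<^sup>2)"
    proof (rule Bochner_Integration.integrable_bound[OF h])
      show "AE t in lborel. norm ((h t)\<^sup>2) \<le> norm (h t)"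
        by (auto simp: h_def power2_eq_square intro!: mult_left_le)
    qed (use h in measurable)
    \<comment> \<open>The value of the pairing of the Gaussian \<open>h\<close> with
      \<open>k\<close>. It is positive because the normal density vanishes nowhere and
      \<open>Z n\<close> has positive measure.\<close>
    define c where "c = (\<integral>\<xi>. normal_density 0 1 \<xi> * indicator (Z n) \<xi> \<partial>lborel)"
    have ci: "integrable lborel (\<lambda>\<xi>. normal_density 0 1 \<xi> * indicator (Z n) \<xi>)"
      by (intro integrable_real_mult_indicator) auto
    have "c \<noteq> 0"
    proof
      assume "c = 0"
      then have "AE \<xi> in lborel. normal_density 0 1 \<xi> * indicator (Z n) \<xi> = 0"
        using integral_nonneg_eq_0_iff_AE[OF ci] by (auto simp: c_def)
      then have "AE \<xi> in lborel. \<xi> \<notin> Z n"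
        using normal_density_pos[of 1 0] by (auto elim!: eventually_mono simp: less_le split: split_indicator_asm)
      then have "emeasure lborel (Z n) = 0" using Zm by (subst (asm) AE_iff_measurable[OF _ refl]) auto
      with pos show False by simp
    qed
    moreover have "c \<ge> 0" unfolding c_def by (intro integral_nonneg_AE) auto
    ultimately have c: "c > 0" by simp
    obtain M where M: "?M = ennreal M" "M \<ge> 0" using fin by (cases ?M) auto
    \<comment> \<open>Cauchy-Schwarz will give \<open>c^2 \<le> \<epsilon> * M\<close>, and this
      choice makes the right-hand side smaller than \<open>c^2\<close>.\<close>
    define \<epsilon> where "\<epsilon> = c\<^sup>2 / (M + 1)"
    have \<epsilon>: "\<epsilon> > 0" using c M by (simp add: \<epsilon>_def)
    have "h \<in> borel_measurable lborel" using h by auto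
    then obtain m b a where
      b: "(\<integral>\<^sup>+x. ennreal ((h x - (\<Sum>k<(m::nat). b k * g (x + a k)))\<^sup>2) \<partial>lborel) < ennreal \<epsilon>"
      using dense h2 \<epsilon> unfolding translates_dense_L2_def by blast
    have gt: "integrable lborel (\<lambda>t. of_real (b j) * ?g (t + a j))" for j
      using lborel_integrable_real_affine[of ?g 1 "a j"] gc by (intro integrable_mult_right) (simp add: add.commute)
    define d where "d t = ?h t - (\<Sum>j<m. of_real (b j) * ?g (t + a j))" for t
    have d: "integrable lborel d" unfolding d_def[abs_def] using h gt by (intro Bochner_Integration.integrable_diff Bochner_Integration.integrable_sum) auto
    have [measurable]: "d \<in> borel_measurable borel" using d by auto
    have ftd: "ft d x = ft ?h x - (\<Sum>j<m. of_real (b j) * (cis (a j * x) * ft ?g x))" for x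
    proof -
      have "ft d x = ft ?h x - (\<Sum>j<m. ft (\<lambda>t. of_real (b j) * ?g (t + a j)) x)"
        unfolding d_def[abs_def] using h gt by (subst ft_diff) (auto simp: ft_sum)
      then show ?thesis by (simp add: ft_cmult ft_translate[of ?g])
    qed
    \<comment> \<open>On \<open>Z n\<close> the transform of \<open>g\<close> vanishes, so the
      translates drop out and only the Gaussian remains.\<close>
    have "ft d \<xi> * E \<xi> = of_real (2 * pi * (normal_density 0 1 \<xi> * indicator (Z n) \<xi>))" for \<xi>
    proof (cases "\<xi> \<in> Z n")
      case True
      then have "ft ?g \<xi> = 0" by (simp add: Z_def)
      moreover have "ft ?h \<xi> = of_real (2 * pi * normal_density 0 1 \<xi>)"
        unfolding h_def by (rule ft_exp_square) simp
      ultimately show ?thesis using True by (simp add: ftd E_def)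
    qed (simp add: E_def)
    then have "(\<integral>y. d y * k y \<partial>lborel) = of_real c"
      unfolding pairing[OF d] ift_def ft_def c_def
      by (simp add: integral_complex_of_real[symmetric] del: integral_complex_of_real of_real_mult)
         (simp add: integral_complex_of_real)
    then have "ennreal c = ennreal (norm (\<integral>y. d y * k y \<partial>lborel))" using c by simp
    also have "\<dots> \<le> (\<integral>\<^sup>+y. ennreal (norm (d y)) * ennreal (norm (k y)) \<partial>lborel)"
      by (cases "integrable lborel (\<lambda>y. d y * k y)")
         (auto simp: not_integrable_integral_eq norm_mult ennreal_mult dest!: integral_norm_bound_ennreal)
    finally have "ennreal c ^ 2 \<le> (\<integral>\<^sup>+y. ennreal (norm (d y)) * ennreal (norm (k y)) \<partial>lborel) ^ 2"
      by (intro power_mono) auto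
    also have "\<dots> \<le> (\<integral>\<^sup>+y. ennreal (norm (d y)) ^ 2 \<partial>lborel) * (\<integral>\<^sup>+y. ennreal (norm (k y)) ^ 2 \<partial>lborel)"
      by (rule Cauchy_Schwarz_nn_integral) auto
    also have "\<dots> \<le> ennreal \<epsilon> * ennreal M"
    proof (intro mult_mono)
      have "d t = of_real (h t - (\<Sum>k<m. b k * g (t + a k)))" for t by (simp add: d_def)
      then have "norm (d t) ^ 2 = (h t - (\<Sum>k<m. b k * g (t + a k)))\<^sup>2" for t by (simp only: norm_of_real power2_abs)
      then show "(\<integral>\<^sup>+y. ennreal (norm (d y)) ^ 2 \<partial>lborel) \<le> ennreal \<epsilon>"
        using b by (simp add: ennreal_power)
    qed (use k2 M in auto)
    also have "\<dots> = ennreal (\<epsilon> * M)" using \<epsilon> M by (simp add: ennreal_mult)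
    finally have "c\<^sup>2 \<le> \<epsilon> * M" using c \<epsilon> M by (simp add: ennreal_power)
    then have "c\<^sup>2 * (M + 1) \<le> c\<^sup>2 * M" using M by (simp add: \<epsilon>_def field_simps)
    then show False using c by (simp add: algebra_simps)
  qed
  then have "(\<Union>n. Z n) \<in> null_sets lborel" by (intro null_sets_UN) (auto simp: null_sets_def)
  also have "(\<Union>n. Z n) = {x. fourier g x = 0}"
  proof -
    have "\<exists>n::nat. x \<in> {- real n..real n}" for x
      using real_arch_simple[of "\<bar>x\<bar>"] by (auto simp: abs_le_iff) (metis minus_le_iff)
    then show ?thesis by (auto simp: Z_def fourier_eq_ft)
  qed
  finally show "{x. fourier g x = 0} \<in> null_sets lborel" .
qed

section \<open>The correlation function and the Hankel determinant\<close>

text \<open>Dominated convergence for the remainder \<open>q\<close> of the difference quotient. The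
  first-order bound \<open>b1\<close> supplies the majorant, for which the first moment is enough;
  the second-order bound \<open>b2\<close> gives only the pointwise limit, where the factor
  \<open>t^2\<close> does no harm.\<close>

lemma has_vector_derivative_ft:
  assumes h: "integrable lborel h" and th: "integrable lborel (\<lambda>t. of_real t * h t)"
  shows "(ft h has_vector_derivative ft (\<lambda>t. - \<i> * (of_real t * h t)) x) (at x)"
proof -
  have [measurable]: "h \<in> borel_measurable borel" using h by auto
  let ?D = "ft (\<lambda>t. - \<i> * (of_real t * h t)) x"
  define q where "q y t = (cis (- (y * t)) - cis (- (x * t)) + of_real (y - x) * (\<i> * of_real t * cis (- (x * t)))) * h t / of_real (y - x)" for y t
  have cis_diff: "cis (- (y * t)) - cis (- (x * t)) = cis (- (x * t)) * (iexp (- ((y - x) * t)) - 1)" for y t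
  proof -
    have "cis (- (y * t)) = cis (- (x * t)) * cis (- ((y - x) * t))" by (simp add: cis_mult algebra_simps)
    then show ?thesis by (simp add: cis_conv_exp right_diff_distrib)
  qed
  have b1: "norm (iexp a - 1) \<le> \<bar>a\<bar>" for a
    using iexp_approx1[of a 0] by simp
  have b2: "norm (iexp a - 1 - \<i> * of_real a) \<le> \<bar>a\<bar>\<^sup>2" for a
  proof -
    have "norm (iexp a - 1 - \<i> * of_real a) \<le> \<bar>a\<bar>\<^sup>2 / 2"
      using iexp_approx1[of a 1] by (simp add: power2_eq_square diff_diff_eq)
    then show ?thesis using zero_le_power2[of "\<bar>a\<bar>"] by linarith
  qed
  have quot: "(ft h y - ft h x - (y - x) *\<^sub>R ?D) / of_real (y - x) = (\<integral>t. q y t \<partial>lborel)" if "y \<noteq> x" for y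
  proof -
    have i: "integrable lborel (\<lambda>t. cis (- (z * t)) * h t)" for z by (intro integrable_cis_mult h) auto
    have it: "integrable lborel (\<lambda>t. cis (- (x * t)) * (- \<i> * (of_real t * h t)))"
      by (intro integrable_cis_mult integrable_mult_right th) auto
    have "ft h y - ft h x - (y - x) *\<^sub>R ?D
       = (\<integral>t. cis (- (y * t)) * h t - cis (- (x * t)) * h t - of_real (y - x) * (cis (- (x * t)) * (- \<i> * (of_real t * h t))) \<partial>lborel)"
      unfolding ft_def scaleR_conv_of_real
        Bochner_Integration.integral_diff[OF Bochner_Integration.integrable_diff[OF i i] integrable_mult_right[OF it]]
        Bochner_Integration.integral_diff[OF i i] integral_mult_right_zero ..
    also have "\<dots> = (\<integral>t. of_real (y - x) * q y t \<partial>lborel)"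
      using that by (intro Bochner_Integration.integral_cong) (auto simp: q_def field_simps)
    finally show ?thesis using that by (simp only: integral_mult_right_zero) simp
  qed
  have "((\<lambda>y. (\<integral>t. q y t \<partial>lborel)) \<longlongrightarrow> 0) (at x)"
    unfolding tendsto_at_iff_sequentially comp_def
  proof (intro allI impI)
    fix X :: "nat \<Rightarrow> real" assume X: "\<forall>i. X i \<in> UNIV - {x}" "X \<longlonglongrightarrow> x"
    then have ne: "X i \<noteq> x" for i by auto
    have "(\<lambda>i. \<integral>t. q (X i) t \<partial>lborel) \<longlonglongrightarrow> (\<integral>(t::real). 0 \<partial>lborel)"
    proof (rule integral_dominated_convergence)
      show "integrable lborel (\<lambda>t. 2 * norm (of_real t * h t))" using th by simp
      show "AE t in lborel. norm (q (X i) t) \<le> 2 * norm (of_real t * h t)" for i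
      proof (rule AE_I2)
        fix t
        have "norm (cis (- (X i * t)) - cis (- (x * t)) + of_real (X i - x) * (\<i> * of_real t * cis (- (x * t))))
           \<le> \<bar>(X i - x) * t\<bar> + \<bar>(X i - x) * t\<bar>"
          unfolding cis_diff using b1[of "- ((X i - x) * t)"]
          by (intro norm_triangle_mono) (simp_all add: norm_mult abs_mult del: of_real_diff)
        then have "norm (cis (- (X i * t)) - cis (- (x * t)) + of_real (X i - x) * (\<i> * of_real t * cis (- (x * t)))) * norm (h t)
           \<le> (\<bar>(X i - x) * t\<bar> + \<bar>(X i - x) * t\<bar>) * norm (h t)" by (intro mult_right_mono) auto
        also have "\<dots> = \<bar>X i - x\<bar> * (2 * norm (of_real t * h t))" by (simp add: norm_mult abs_mult)
        finally show "norm (q (X i) t) \<le> 2 * norm (of_real t * h t)"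
          unfolding q_def norm_divide norm_mult norm_of_real
          using ne[of i] by (simp add: divide_le_eq mult.commute)
      qed
      show "AE t in lborel. (\<lambda>i. q (X i) t) \<longlonglongrightarrow> 0"
      proof (rule AE_I2)
        fix t
        have "(\<lambda>i. \<bar>X i - x\<bar> * (t\<^sup>2 * norm (h t))) \<longlonglongrightarrow> \<bar>x - x\<bar> * (t\<^sup>2 * norm (h t))"
          by (intro tendsto_intros X)
        then have lim: "(\<lambda>i. \<bar>X i - x\<bar> * (t\<^sup>2 * norm (h t))) \<longlonglongrightarrow> 0" by simp
        show "(\<lambda>i. q (X i) t) \<longlonglongrightarrow> 0"
        proof (rule Lim_null_comparison[OF always_eventually lim], rule allI)
          fix i
          let ?d = "X i - x"
          have "cis (- (X i * t)) - cis (- (x * t)) + of_real ?d * (\<i> * of_real t * cis (- (x * t)))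
             = cis (- (x * t)) * (iexp (- (?d * t)) - 1 - \<i> * of_real (- (?d * t)))"
            unfolding cis_diff by (simp add: algebra_simps)
          then have "norm (cis (- (X i * t)) - cis (- (x * t)) + of_real ?d * (\<i> * of_real t * cis (- (x * t)))) \<le> \<bar>?d * t\<bar>\<^sup>2"
            using b2[of "- (?d * t)"] by (simp add: norm_mult)
          then have "norm (cis (- (X i * t)) - cis (- (x * t)) + of_real ?d * (\<i> * of_real t * cis (- (x * t)))) * norm (h t)
            \<le> \<bar>?d * t\<bar>\<^sup>2 * norm (h t)" by (intro mult_right_mono) auto
          also have "\<dots> = \<bar>?d\<bar> * (\<bar>?d\<bar> * (t\<^sup>2 * norm (h t)))"
            by (simp add: abs_mult power2_eq_square)
          finally show "norm (q (X i) t) \<le> \<bar>?d\<bar> * (t\<^sup>2 * norm (h t))"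
            unfolding q_def norm_divide norm_mult norm_of_real
            using ne[of i] by (simp add: divide_le_eq mult.commute)
        qed
      qed
    qed (auto simp: q_def)
    then show "(\<lambda>i. \<integral>t. q (X i) t \<partial>lborel) \<longlonglongrightarrow> 0" by simp
  qed
  then have "((\<lambda>y. norm (\<integral>t. q y t \<partial>lborel)) \<longlongrightarrow> 0) (at x)" by (rule tendsto_norm_zero)
  then have "((\<lambda>y. norm (ft h y - ft h x - (y - x) *\<^sub>R ?D) / norm (y - x)) \<longlongrightarrow> 0) (at x)"
  proof (rule Lim_transform_eventually)
    show "eventually (\<lambda>y. norm (\<integral>t. q y t \<partial>lborel) = norm (ft h y - ft h x - (y - x) *\<^sub>R ?D) / norm (y - x)) (at x)"
      using eventually_neq_at_within[of x]
    proof eventually_elim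
      case (elim y)
      show ?case unfolding quot[OF elim, symmetric] norm_divide norm_of_real real_norm_def ..
    qed
  qed
  moreover have "norm (ft h y - ft h x - (y - x) *\<^sub>R ?D) / norm (y - x)
     = norm ((1 / norm (y - x)) *\<^sub>R (ft h y - (ft h x + (y - x) *\<^sub>R ?D)))" for y
    by (simp add: diff_diff_eq)
  ultimately have "((\<lambda>y. norm ((1 / norm (y - x)) *\<^sub>R (ft h y - (ft h x + (y - x) *\<^sub>R ?D)))) \<longlongrightarrow> 0) (at x)"
    by (simp only:)
  then show ?thesis
    unfolding has_vector_derivative_def has_derivative_at2
    by (intro conjI bounded_linear_scaleR_left) (rule tendsto_norm_zero_cancel)
qed

section \<open>Moments and higher derivatives of the transform\<close>

lemma integrable_moment_le:
  fixes f :: "real \<Rightarrow> real"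
  assumes f: "integrable lborel f" and mom: "integrable lborel (\<lambda>t. t ^ N * f t)" and k: "k \<le> N"
  shows "integrable lborel (\<lambda>t. t ^ k * f t)"
proof (rule Bochner_Integration.integrable_bound)
  have [measurable]: "f \<in> borel_measurable borel" using f by auto
  show "integrable lborel (\<lambda>t. norm (f t) + norm (t ^ N * f t))" using f mom by auto
  show "(\<lambda>t. t ^ k * f t) \<in> borel_measurable lborel" by measurable
  show "AE t in lborel. norm (t ^ k * f t) \<le> norm (norm (f t) + norm (t ^ N * f t))"
  proof (rule AE_I2)
    fix t :: real
    have "\<bar>t\<bar> ^ k \<le> 1 + \<bar>t\<bar> ^ N"
    proof (cases "\<bar>t\<bar> \<le> 1")
      case True
      then have "\<bar>t\<bar> ^ k \<le> 1" using power_mono[of "\<bar>t\<bar>" 1 k] by simp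
      then show ?thesis by (simp add: add_increasing2)
    next
      case False
      then have "\<bar>t\<bar> ^ k \<le> \<bar>t\<bar> ^ N" using k by (intro power_increasing) auto
      then show ?thesis by simp
    qed
    then have "\<bar>t\<bar> ^ k * \<bar>f t\<bar> \<le> (1 + \<bar>t\<bar> ^ N) * \<bar>f t\<bar>" by (intro mult_right_mono) auto
    then show "norm (t ^ k * f t) \<le> norm (norm (f t) + norm (t ^ N * f t))"
      by (simp add: abs_mult power_abs algebra_simps)
  qed
qed

text \<open>\<open>vector_derivative\<close> has a meaningful value only where a derivative exists,
  so the induction must establish differentiability at each order; the next moment is integrable as
  long as the order is at most \<open>N\<close>.\<close>

lemma higher_deriv_fourier:
  fixes f :: "real \<Rightarrow> real"
  assumes f: "integrable lborel f" and mom: "integrable lborel (\<lambda>t. t ^ N * f t)" and "k \<le> N"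
  shows "higher_deriv k (fourier f) x = (- \<i>) ^ k * ft (\<lambda>t. of_real (t ^ k * f t)) x"
  using \<open>k \<le> N\<close>
proof (induction k arbitrary: x)
  case 0
  then show ?case by (simp add: fourier_eq_ft)
next
  case (Suc k)
  have i1: "integrable lborel (\<lambda>t. complex_of_real (t ^ k * f t))"
    using Suc.prems by (intro integrable_of_real integrable_moment_le[OF f mom]) simp
  have i2: "integrable lborel (\<lambda>t. of_real t * complex_of_real (t ^ k * f t))"
  proof -
    have "integrable lborel (\<lambda>t. complex_of_real (t ^ Suc k * f t))"
      by (intro integrable_of_real integrable_moment_le[OF f mom Suc.prems])
    then show ?thesis by (simp add: mult.assoc)
  qed
  have "higher_deriv k (fourier f) = (\<lambda>x. (- \<i>) ^ k * ft (\<lambda>t. of_real (t ^ k * f t)) x)"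
    using Suc by (intro ext Suc.IH) simp
  moreover have "((\<lambda>x. (- \<i>) ^ k * ft (\<lambda>t. of_real (t ^ k * f t)) x) has_vector_derivative
     (- \<i>) ^ k * ft (\<lambda>t. - \<i> * (of_real t * of_real (t ^ k * f t))) x) (at x)"
    by (intro has_vector_derivative_mult_right has_vector_derivative_ft i1 i2)
  ultimately have "higher_deriv (Suc k) (fourier f) x = (- \<i>) ^ k * ft (\<lambda>t. - \<i> * (of_real t * of_real (t ^ k * f t))) x"
    by (simp add: vector_derivative_at)
  then show ?case unfolding ft_cmult by (simp add: mult.assoc)
qed

section \<open>Vandermonde determinants and Andreief's identity\<close>

definition vdm :: "nat \<Rightarrow> (nat \<Rightarrow> real) \<Rightarrow> real" where
  "vdm n s = (\<Sum>p | p permutes {..<n}. of_int (sign p) * (\<Prod>i<n. s i ^ p i))"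

text \<open>Composing with the transposition of \<open>a\<close> and \<open>b\<close> reverses every
  sign and preserves every product, so the value equals its own negative.\<close>

lemma vdm_eq_0:
  assumes "a < n" "b < n" "a \<noteq> b" "s a = s b"
  shows "vdm n s = 0"
proof -
  let ?\<tau> = "Transposition.transpose a b"
  have \<tau>: "?\<tau> permutes {..<n}" using assms by (intro permutes_swap_id) auto
  have "vdm n s = (\<Sum>p | p permutes {..<n}. of_int (sign (p \<circ> ?\<tau>)) * (\<Prod>i<n. s i ^ (p \<circ> ?\<tau>) i))"
    unfolding vdm_def by (rule sum_permutations_compose_right[OF \<tau>])
  also have "\<dots> = (\<Sum>p | p permutes {..<n}. - (of_int (sign p) * (\<Prod>i<n. s i ^ p i)))"
  proof (intro sum.cong refl)
    fix p assume "p \<in> {p. p permutes {..<n}}"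
    then have p: "permutation p" by (auto intro: permutation_permutes[THEN iffD2])
    have "sign (p \<circ> ?\<tau>) = - sign p"
      using assms p by (simp add: sign_compose permutation_swap_id sign_swap_id)
    moreover have "(\<Prod>i<n. s i ^ (p \<circ> ?\<tau>) i) = (\<Prod>i<n. s i ^ p i)"
    proof -
      have "(\<Prod>i<n. s i ^ p i) = (\<Prod>i<n. s (?\<tau> i) ^ p (?\<tau> i))"
        by (rule prod.permute[OF \<tau>, unfolded comp_def])
      moreover have "s (?\<tau> i) = s i" for i using assms by (auto simp: Transposition.transpose_def)
      ultimately show ?thesis by (simp add: comp_def)
    qed
    ultimately show "of_int (sign (p \<circ> ?\<tau>)) * (\<Prod>i<n. s i ^ (p \<circ> ?\<tau>) i) = - (of_int (sign p) * (\<Prod>i<n. s i ^ p i))"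
      by simp
  qed
  also have "\<dots> = - vdm n s" by (simp add: vdm_def sum_negf)
  finally show ?thesis by simp
qed

text \<open>As a polynomial in the last variable the determinant has degree at most \<open>n\<close>, vanishes at
  the other variables, and has the smaller determinant as leading coefficient.\<close>

theorem vdm_eq_prod: "vdm n s = (\<Prod>j<n. \<Prod>i<j. s j - s i)"
proof (induction n arbitrary: s)
  case 0
  have "{p. p permutes {..<0::nat}} = {id}" by auto
  then show ?case by (simp add: vdm_def)
next
  case (Suc n)
  define P where "P = (\<Sum>p | p permutes {..<Suc n}. monom (of_int (sign p) * (\<Prod>i<n. s i ^ p i)) (p n))"
  have fin: "finite {p. p permutes {..<Suc n}}" by (rule finite_permutations) simp
  have polyP: "poly P x = vdm (Suc n) (s(n := x))" for x
    by (simp add: P_def vdm_def poly_sum poly_monom mult.assoc)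
  have le: "p n \<le> n" if "p permutes {..<Suc n}" for p
    using permutes_in_image[OF that, of n] by auto
  have degP: "degree P \<le> n"
    unfolding P_def
    by (intro degree_sum_le fin) (auto intro: order_trans[OF degree_monom_le] le)
  have coeffP: "coeff P n = vdm n s"
  proof -
    \<comment> \<open>Only permutations with \<open>p n = n\<close> contribute in degree
      \<open>n\<close>, and these are exactly the permutations of the first \<open>n\<close>
      indices.\<close>
    have "coeff P n = (\<Sum>p | p permutes {..<Suc n}. if p n = n then of_int (sign p) * (\<Prod>i<n. s i ^ p i) else 0)"
      by (simp add: P_def coeff_sum eq_commute)
    also have "\<dots> = (\<Sum>p\<in>{p. p permutes {..<Suc n}} \<inter> {p. p n = n}. of_int (sign p) * (\<Prod>i<n. s i ^ p i))"
      using fin by (simp add: sum.If_cases)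
    also have "{p. p permutes {..<Suc n}} \<inter> {p. p n = n} = {p. p permutes {..<n}}"
    proof (intro equalityI subsetI)
      fix p assume p: "p \<in> {p. p permutes {..<Suc n}} \<inter> {p. p n = n}"
      have "p permutes {..<n}"
      proof (rule permutes_superset[of p "{..<Suc n}"])
        show "p permutes {..<Suc n}" using p by simp
        fix x assume "x \<in> {..<Suc n} - {..<n}"
        then have "x = n" by auto
        then show "p x = x" using p by simp
      qed
      then show "p \<in> {p. p permutes {..<n}}" by simp
    next
      fix p assume p: "p \<in> {p. p permutes {..<n}}"
      then have "p permutes {..<Suc n}" by (auto intro: permutes_subset)
      moreover have "p n = n" using p by (auto intro: permutes_not_in)
      ultimately show "p \<in> {p. p permutes {..<Suc n}} \<inter> {p. p n = n}" by simp
    qed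
    finally show ?thesis by (simp add: vdm_def)
  qed
  have root: "poly P (s k) = 0" if "k < n" for k
    unfolding polyP using that by (intro vdm_eq_0[of k _ n]) auto
  have "vdm (Suc n) s = vdm n s * (\<Prod>i<n. s n - s i)"
  \<comment> \<open>With a repetition among the first \<open>n\<close> variables there are too few
    distinct roots to identify the polynomial, but then both sides are 0.\<close>
  proof (cases "inj_on s {..<n}")
    case True
    define Q where "Q = smult (vdm n s) (\<Prod>i<n. [:- s i, 1:])"
    have degprod: "degree (\<Prod>i<n. [:- s i, 1:]) = n"
      by (subst degree_prod_eq_sum_degree) auto
    have "P = Q"
    proof (rule poly_eqI_degree_lead_coeff[where A = "s ` {..<n}" and n = n])
      have "coeff (\<Prod>i<n. [:- s i, 1:]) n = lead_coeff (\<Prod>i<n. [:- s i, 1:])" by (simp add: degprod)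
      also have "\<dots> = 1" by (simp add: lead_coeff_prod)
      finally show "coeff P n = coeff Q n" by (simp add: coeffP Q_def)
      show "degree Q \<le> n" unfolding Q_def using degree_smult_le degprod by metis
      show "card (s ` {..<n}) \<ge> n" using True by (simp add: card_image)
      fix z assume "z \<in> s ` {..<n}"
      then show "poly P z = poly Q z" using root by (auto simp: Q_def poly_prod)
    qed (rule degP)
    then have "vdm (Suc n) s = poly Q (s n)" using polyP[of "s n"] by simp
    then show ?thesis by (simp add: Q_def poly_prod)
  next
    case False
    then obtain a b where "a < n" "b < n" "a \<noteq> b" "s a = s b" by (auto simp: inj_on_def)
    then show ?thesis using vdm_eq_0[of a n b s] vdm_eq_0[of a "Suc n" b s] by simp
  qed
  then show ?case by (simp add: Suc.IH)
qed

lemma prod_square_eq_vdm: "(\<Prod>j<n. \<Prod>i<j. (s i - s j)\<^sup>2) = (vdm n s)\<^sup>2"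
  unfolding vdm_eq_prod prod_power_distrib
  by (intro prod.cong refl) (simp add: power2_commute)

text \<open>The Leibniz form of \<open>vdm\<close> is used because every term of the squared sum is
  a product over the coordinates, ready for Fubini; the product form of the Vandermonde determinant
  does not separate.\<close>

lemma square_vdm_prod:
  fixes F :: "real \<Rightarrow> complex"
  shows "of_real ((vdm n s)\<^sup>2) * (\<Prod>i<n. F (s i))
    = (\<Sum>p | p permutes {..<n}. \<Sum>q | q permutes {..<n}.
        of_int (sign p * sign q) * (\<Prod>i<n. of_real (s i ^ (p i + q i)) * F (s i)))"
proof -
  have "of_real ((vdm n s)\<^sup>2) * (\<Prod>i<n. F (s i))
    = (\<Sum>p | p permutes {..<n}. of_int (sign p) * (\<Prod>i<n. of_real (s i ^ p i))) *
      (\<Sum>q | q permutes {..<n}. of_int (sign q) * (\<Prod>i<n. of_real (s i ^ q i))) * (\<Prod>i<n. F (s i))"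
    unfolding power2_eq_square by (simp add: vdm_def)
  also have "\<dots> = (\<Sum>p | p permutes {..<n}. \<Sum>q | q permutes {..<n}.
        (of_int (sign p) * (\<Prod>i<n. of_real (s i ^ p i))) * (of_int (sign q) * (\<Prod>i<n. of_real (s i ^ q i))) * (\<Prod>i<n. F (s i)))"
    unfolding sum_product unfolding sum_distrib_right ..
  also have "\<dots> = (\<Sum>p | p permutes {..<n}. \<Sum>q | q permutes {..<n}.
        of_int (sign p * sign q) * (\<Prod>i<n. of_real (s i ^ (p i + q i)) * F (s i)))"
    by (intro sum.cong refl) (simp add: prod.distrib power_add mult_ac)
  finally show ?thesis .
qed

text \<open>Each pair of permutations integrates to a product of moments of order
  \<open>p i + q i\<close>. Writing \<open>q \<circ> p\<close> for \<open>q\<close> and reindexing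
  by \<open>p\<close> removes \<open>p\<close> from the inner sum, so each of the
  \<open>fact n\<close> permutations \<open>p\<close> contributes the same Hankel
  determinant.\<close>

theorem andreief_hankel:
  fixes F :: "real \<Rightarrow> complex"
  assumes F: "\<And>k. k \<le> 2 * n - 2 \<Longrightarrow> integrable lborel (\<lambda>t. of_real (t ^ k) * F t)" and n: "n \<ge> 1"
  shows "integrable (\<Pi>\<^sub>M i\<in>{..<n}. lborel) (\<lambda>s. of_real ((vdm n s)\<^sup>2) * (\<Prod>i<n. F (s i)))" (is ?int)
    and "(\<integral>s. of_real ((vdm n s)\<^sup>2) * (\<Prod>i<n. F (s i)) \<partial>(\<Pi>\<^sub>M i\<in>{..<n}. lborel))
      = fact n * det_n n (\<lambda>i j. \<integral>t. of_real (t ^ (i + j)) * F t \<partial>lborel)" (is ?eq)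
proof -
  interpret product_sigma_finite "\<lambda>i::nat. lborel :: real measure" ..
  let ?S = "{p. p permutes {..<n}}"
  define \<mu> where "\<mu> k = (\<integral>t. of_real (t ^ k) * F t \<partial>lborel)" for k
  \<comment> \<open>Row and column indices are at most \<open>n - 1\<close>; this is where the
    moment order \<open>2 * n - 2\<close> comes from.\<close>
  have bd: "p i + q i \<le> 2 * n - 2" if "p permutes {..<n}" "q permutes {..<n}" "i < n" for p q i
  proof -
    have "p i < n" "q i < n"
      using permutes_in_image[OF that(1), of i] permutes_in_image[OF that(2), of i] that(3) by auto
    then show ?thesis by simp
  qed
  have int: "integrable (\<Pi>\<^sub>M i\<in>{..<n}. lborel) (\<lambda>s. of_int (sign p * sign q) * (\<Prod>i<n. of_real (s i ^ (p i + q i)) * F (s i)))"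
    if "p permutes {..<n}" "q permutes {..<n}" for p q
    using bd[OF that] by (intro integrable_mult_right product_integrable_prod F) auto
  show ?int
    unfolding square_vdm_prod by (intro Bochner_Integration.integrable_sum int) auto
  have "(\<integral>s. of_real ((vdm n s)\<^sup>2) * (\<Prod>i<n. F (s i)) \<partial>(\<Pi>\<^sub>M i\<in>{..<n}. lborel))
     = (\<Sum>p\<in>?S. \<integral>s. (\<Sum>q\<in>?S. of_int (sign p * sign q) * (\<Prod>i<n. of_real (s i ^ (p i + q i)) * F (s i))) \<partial>(\<Pi>\<^sub>M i\<in>{..<n}. lborel))"
    unfolding square_vdm_prod
    by (intro Bochner_Integration.integral_sum Bochner_Integration.integrable_sum int) auto
  also have "\<dots> = (\<Sum>p\<in>?S. \<Sum>q\<in>?S. \<integral>s. of_int (sign p * sign q) * (\<Prod>i<n. of_real (s i ^ (p i + q i)) * F (s i)) \<partial>(\<Pi>\<^sub>M i\<in>{..<n}. lborel))"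
    by (intro sum.cong refl Bochner_Integration.integral_sum int) auto
  also have "\<dots> = (\<Sum>p\<in>?S. \<Sum>q\<in>?S. of_int (sign p * sign q) * (\<Prod>i<n. \<mu> (p i + q i)))"
  proof (intro sum.cong refl)
    fix p q assume "p \<in> ?S" "q \<in> ?S"
    then have "(\<integral>s. (\<Prod>i<n. of_real (s i ^ (p i + q i)) * F (s i)) \<partial>(\<Pi>\<^sub>M i\<in>{..<n}. lborel)) = (\<Prod>i<n. \<mu> (p i + q i))"
      unfolding \<mu>_def using bd[of p q] by (intro product_integral_prod F) auto
    then show "(\<integral>s. of_int (sign p * sign q) * (\<Prod>i<n. of_real (s i ^ (p i + q i)) * F (s i)) \<partial>(\<Pi>\<^sub>M i\<in>{..<n}. lborel))
      = of_int (sign p * sign q) * (\<Prod>i<n. \<mu> (p i + q i))" by simp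
  qed
  also have "\<dots> = (\<Sum>p\<in>?S. det_n n (\<lambda>i j. \<mu> (i + j)))"
  proof (intro sum.cong refl)
    fix p assume p: "p \<in> ?S"
    then have pp: "p permutes {..<n}" by simp
    have "(\<Sum>q\<in>?S. of_int (sign p * sign q) * (\<Prod>i<n. \<mu> (p i + q i)))
      = (\<Sum>q\<in>?S. of_int (sign p * sign (q \<circ> p)) * (\<Prod>i<n. \<mu> (p i + (q \<circ> p) i)))"
      by (rule sum_permutations_compose_right[OF pp])
    also have "\<dots> = (\<Sum>q\<in>?S. of_int (sign q) * (\<Prod>i<n. \<mu> (i + q i)))"
    proof (intro sum.cong refl)
      fix q assume "q \<in> ?S"
      then have "permutation p" "permutation q" using pp by (auto intro: permutation_permutes[THEN iffD2])
      then have "sign p * sign (q \<circ> p) = sign q"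
        by (simp add: sign_compose mult.left_commute)
      moreover have "(\<Prod>i<n. \<mu> (i + q i)) = (\<Prod>i<n. \<mu> (p i + (q \<circ> p) i))"
        using prod.permute[OF pp, of "\<lambda>i. \<mu> (i + q i)"] by (simp add: comp_def)
      ultimately show "of_int (sign p * sign (q \<circ> p)) * (\<Prod>i<n. \<mu> (p i + (q \<circ> p) i)) = of_int (sign q) * (\<Prod>i<n. \<mu> (i + q i))"
        by simp
    qed
    finally show "(\<Sum>q\<in>?S. of_int (sign p * sign q) * (\<Prod>i<n. \<mu> (p i + q i))) = det_n n (\<lambda>i j. \<mu> (i + j))"
      by (simp add: det_n_def)
  qed
  also have "\<dots> = fact n * det_n n (\<lambda>i j. \<mu> (i + j))"
    by (simp add: card_permutations[of "{..<n}" n])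
  finally show ?eq by (simp add: \<mu>_def)
qed

text \<open>In every Leibniz term the orders of differentiation add up to the same number, twice the
  sum of the indices, because a permutation preserves that sum. The powers of \<open>- \<i>\<close>
  therefore come out as one common factor.\<close>

lemma W_fourier:
  assumes f: "integrable lborel f" and mom: "integrable lborel (\<lambda>t. t ^ (2 * n - 2) * f t)"
  shows "W n (fourier f) x = (- \<i>) ^ (2 * (\<Sum>i<n. i)) *
    det_n n (\<lambda>i j. \<integral>t. of_real (t ^ (i + j)) * (cis (- (x * t)) * of_real (f t)) \<partial>lborel)"
proof -
  define \<mu> where "\<mu> k = (\<integral>t. of_real (t ^ k) * (cis (- (x * t)) * of_real (f t)) \<partial>lborel)" for k
  have hd: "higher_deriv k (fourier f) x = (- \<i>) ^ k * \<mu> k" if "k \<le> 2 * n - 2" for k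
    unfolding higher_deriv_fourier[OF f mom that] \<mu>_def ft_def by (simp add: mult_ac)
  have "W n (fourier f) x = (\<Sum>p | p permutes {..<n}. (- \<i>) ^ (2 * (\<Sum>i<n. i)) * (of_int (sign p) * (\<Prod>i<n. \<mu> (i + p i))))"
    unfolding W_def det_n_def
  proof (intro sum.cong refl)
    fix p assume "p \<in> {p. p permutes {..<n}}"
    then have p: "p permutes {..<n}" by simp
    have "(\<Prod>i<n. higher_deriv (i + p i) (fourier f) x) = (\<Prod>i<n. (- \<i>) ^ (i + p i) * \<mu> (i + p i))"
    proof (intro prod.cong refl hd)
      fix i assume "i \<in> {..<n}"
      then show "i + p i \<le> 2 * n - 2" using permutes_in_image[OF p, of i] by auto
    qed
    also have "\<dots> = (- \<i>) ^ (\<Sum>i<n. i + p i) * (\<Prod>i<n. \<mu> (i + p i))"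
      by (simp add: prod.distrib power_sum)
    also have "(\<Sum>i<n. i + p i) = 2 * (\<Sum>i<n. i)"
      using sum.permute[OF p, of "\<lambda>i. i"] by (simp add: sum.distrib comp_def)
    finally show "of_int (sign p) * (\<Prod>i<n. higher_deriv (i + p i) (fourier f) x)
      = (- \<i>) ^ (2 * (\<Sum>i<n. i)) * (of_int (sign p) * (\<Prod>i<n. \<mu> (i + p i)))" by simp
  qed
  then show ?thesis by (simp only: det_n_def sum_distrib_left[symmetric] \<mu>_def)
qed

section \<open>The correlation function as a marginal along coordinate sums\<close>

lemma sfull_measurable [measurable]:
  "(\<lambda>(t, s). sfull (Suc m) t s i) \<in> borel_measurable (lborel \<Otimes>\<^sub>M (\<Pi>\<^sub>M i\<in>{..<m}. lborel))"
proof (cases "i < m")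
  case True
  then show ?thesis by (simp add: sfull_def case_prod_beta')
next
  case False
  have "(\<lambda>z. \<Sum>j<m. (snd z) j) \<in> borel_measurable (lborel \<Otimes>\<^sub>M (\<Pi>\<^sub>M i\<in>{..<m}. lborel))"
    by (intro borel_measurable_sum) measurable
  then show ?thesis using False by (simp add: sfull_def case_prod_beta')
qed

lemma vdm_cong: "(\<And>i. i < n \<Longrightarrow> s i = s' i) \<Longrightarrow> vdm n s = vdm n s'"
  unfolding vdm_def by (intro sum.cong arg_cong2[of _ _ _ _ "(*)"] prod.cong refl) auto

text \<open>With the other coordinates fixed, passing from the last coordinate to the total
  \<open>t\<close> is a translation and preserves Lebesgue measure. So \<open>nu n f\<close> is the
  marginal in \<open>t\<close> of the integrand over all \<open>n\<close> coordinates, and its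
  transform is Andreief's integral for the modulated function \<open>F\<close>.\<close>

lemma
  fixes f :: "real \<Rightarrow> real"
  assumes f: "integrable lborel f" and mom: "integrable lborel (\<lambda>t. t ^ (2 * n - 2) * f t)" and n: "n \<ge> 1"
  shows integrable_nu: "integrable lborel (nu n f)"
    and fourier_nu: "fourier (nu n f) x = fact n *
      det_n n (\<lambda>i j. \<integral>t. of_real (t ^ (i + j)) * (cis (- (x * t)) * of_real (f t)) \<partial>lborel)"
proof -
  interpret product_sigma_finite "\<lambda>i::nat. lborel :: real measure" ..
  have [measurable]: "f \<in> borel_measurable borel" using f by auto
  obtain m where m: "n = Suc m" using n by (cases n) auto
  let ?P = "\<Pi>\<^sub>M i\<in>{..<m}. (lborel :: real measure)"
  interpret P: sigma_finite_measure ?P by (rule sigma_finite) simp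
  interpret pair_sigma_finite lborel ?P ..
  have ins: "{..<n} = insert m {..<m}" using m by auto
  define F where "F t = cis (- (x * t)) * complex_of_real (f t)" for t
  have F: "integrable lborel (\<lambda>t. of_real (t ^ k) * F t)" if "k \<le> 2 * n - 2" for k
  proof -
    have "integrable lborel (\<lambda>t. cis (- (x * t)) * complex_of_real (t ^ k * f t))"
      by (intro integrable_cis_mult integrable_of_real integrable_moment_le[OF f mom that]) auto
    then show ?thesis by (simp add: F_def mult_ac)
  qed
  define G where "G s = of_real ((vdm n s)\<^sup>2) * (\<Prod>i<n. F (s i))" for s
  have G: "integrable (\<Pi>\<^sub>M i\<in>{..<n}. lborel) G"
    and G_eq: "(\<integral>s. G s \<partial>(\<Pi>\<^sub>M i\<in>{..<n}. lborel)) = fact n * det_n n (\<lambda>i j. \<integral>t. of_real (t ^ (i + j)) * F t \<partial>lborel)"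
    unfolding G_def[abs_def] using andreief_hankel[OF F n] by auto
  define R where "R t s = (\<Prod>j<n. \<Prod>i<j. (sfull n t s i - sfull n t s j)\<^sup>2) * (\<Prod>i<n. f (sfull n t s i))" for t s
  have nu_R: "nu n f t = (\<integral>s. R t s \<partial>?P)" for t unfolding nu_def R_def using m by simp
  have GR: "G (s(m := t + - (\<Sum>j<m. s j))) = cis (- (x * t)) * of_real (R t s)" for s t
  \<comment> \<open>The updated coordinate makes the coordinates sum to \<open>t\<close>, so the
    product of the characters contained in \<open>F\<close> collapses to
    \<open>cis (- (x * t))\<close>.\<close>
  proof -
    let ?s = "s(m := t + - (\<Sum>j<m. s j))"
    have sf: "?s i = sfull n t s i" if "i < n" for i using that m by (auto simp: sfull_def less_Suc_eq)
    have sumt: "(\<Sum>i<n. ?s i) = t" using m by simp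
    have "(\<Prod>i<n. F (?s i)) = (\<Prod>i<n. cis (- (x * ?s i))) * of_real (\<Prod>i<n. f (?s i))"
      by (simp only: F_def prod.distrib of_real_prod)
    also have "(\<Prod>i<n. cis (- (x * ?s i))) = cis (\<Sum>i<n. - (x * ?s i))"
      by (simp only: cis_conv_exp exp_sum[symmetric] finite_lessThan sum_distrib_left of_real_sum)
    also have "(\<Sum>i<n. - (x * ?s i)) = - (x * t)"
      unfolding sum_negf sum_distrib_left[symmetric] sumt ..
    finally have "G ?s = cis (- (x * t)) * of_real ((vdm n ?s)\<^sup>2 * (\<Prod>i<n. f (?s i)))"
      by (simp add: G_def del: fun_upd_apply)
    also have "(vdm n ?s)\<^sup>2 * (\<Prod>i<n. f (?s i)) = R t s"
    proof -
      have vd: "vdm n ?s = vdm n (sfull n t s)" by (rule vdm_cong) (rule sf)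
      have pf: "(\<Prod>i<n. f (?s i)) = (\<Prod>i<n. f (sfull n t s i))"
        by (intro prod.cong refl arg_cong[of _ _ f] sf) simp
      show ?thesis unfolding R_def prod_square_eq_vdm vd pf ..
    qed
    finally show ?thesis .
  qed
  have [measurable]: "(\<lambda>(t, s). R t s) \<in> borel_measurable (lborel \<Otimes>\<^sub>M ?P)"
  proof -
    have [measurable]: "(\<lambda>z. sfull n (fst z) (snd z) i) \<in> borel_measurable (lborel \<Otimes>\<^sub>M ?P)" for i
      using sfull_measurable[of m i] by (simp add: m case_prod_beta')
    show ?thesis unfolding R_def case_prod_beta' by measurable
  qed
  have [measurable]: "G \<in> borel_measurable (\<Pi>\<^sub>M i\<in>{..<n}. lborel)" using G by auto
  \<comment> \<open>Joint integrability of \<open>R\<close> is inherited from \<open>G\<close>: the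
    two have equal modulus after the translation of the last coordinate. It gives the integrability
    of the marginal and permits Fubini below.\<close>
  have "(\<integral>\<^sup>+z. ennreal (norm (case z of (t, s) \<Rightarrow> R t s)) \<partial>(lborel \<Otimes>\<^sub>M ?P))
     = (\<integral>\<^sup>+s. (\<integral>\<^sup>+t. ennreal (norm (R t s)) \<partial>lborel) \<partial>?P)"
    by (subst nn_integral_snd[symmetric]) auto
  also have "\<dots> = (\<integral>\<^sup>+s. (\<integral>\<^sup>+y. ennreal (norm (G (s(m := y)))) \<partial>lborel) \<partial>?P)"
  proof (rule nn_integral_cong)
    fix s assume s: "s \<in> space ?P"
    have "(\<lambda>y. s(m := y)) \<in> measurable lborel (Pi\<^sub>M (insert m {..<m}) (\<lambda>i. lborel))"
      by (rule measurable_component_update[OF s]) simp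
    then have "(\<lambda>y. G (s(m := y))) \<in> borel_measurable lborel"
      using borel_measurable_integrable[OF G] unfolding ins by (rule measurable_compose)
    then have [measurable]: "(\<lambda>y. G (s(m := y))) \<in> borel_measurable borel" by simp
    have "(\<integral>\<^sup>+y. ennreal (norm (G (s(m := y)))) \<partial>lborel) = (\<integral>\<^sup>+t. ennreal (norm (G (s(m := t + - (\<Sum>j<m. s j))))) \<partial>lborel)"
      by (rule nn_integral_translate[symmetric]) measurable
    then show "(\<integral>\<^sup>+t. ennreal (norm (R t s)) \<partial>lborel) = (\<integral>\<^sup>+y. ennreal (norm (G (s(m := y)))) \<partial>lborel)"
      unfolding GR by (simp add: norm_mult)
  qed
  also have "\<dots> = (\<integral>\<^sup>+s. ennreal (norm (G s)) \<partial>(\<Pi>\<^sub>M i\<in>{..<n}. lborel))"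
    unfolding ins by (rule product_nn_integral_insert[symmetric]) (auto simp: ins[symmetric])
  also have "\<dots> < \<infinity>" using G by (simp add: integrable_iff_bounded)
  finally have R: "integrable (lborel \<Otimes>\<^sub>M ?P) (\<lambda>(t, s). R t s)"
    by (intro integrableI_bounded) auto
  show "integrable lborel (nu n f)"
    unfolding nu_R[abs_def] by (rule integrable_fst[OF R])
  have cR: "integrable (lborel \<Otimes>\<^sub>M ?P) (\<lambda>(t, s). cis (- (x * t)) * complex_of_real (R t s))"
  proof -
    have "integrable (lborel \<Otimes>\<^sub>M ?P) (\<lambda>z. cis (- (x * fst z)) * complex_of_real (case z of (t, s) \<Rightarrow> R t s))"
      by (intro integrable_cis_mult integrable_of_real R) measurable
    then show ?thesis by (simp add: case_prod_beta')
  qed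
  have "fourier (nu n f) x = (\<integral>t. (\<integral>s. cis (- (x * t)) * complex_of_real (R t s) \<partial>?P) \<partial>lborel)"
    unfolding fourier_eq_ft ft_def nu_R
    by (intro Bochner_Integration.integral_cong refl) (simp add: integral_complex_of_real)
  also have "\<dots> = (\<integral>s. (\<integral>t. cis (- (x * t)) * complex_of_real (R t s) \<partial>lborel) \<partial>?P)"
    by (rule Fubini_integral[OF cR, symmetric])
  also have "\<dots> = (\<integral>s. (\<integral>y. G (s(m := y)) \<partial>lborel) \<partial>?P)"
  proof (rule Bochner_Integration.integral_cong[OF refl])
    fix s
    show "(\<integral>t. cis (- (x * t)) * complex_of_real (R t s) \<partial>lborel) = (\<integral>y. G (s(m := y)) \<partial>lborel)"
      unfolding GR[symmetric] using lborel_integral_real_affine[of 1 "\<lambda>y. G (s(m := y))" "- (\<Sum>j<m. s j)"]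
      by (simp add: add.commute)
  qed
  also have "\<dots> = (\<integral>s. G s \<partial>(\<Pi>\<^sub>M i\<in>{..<n}. lborel))"
    unfolding ins by (rule product_integral_insert[symmetric]) (use G in \<open>auto simp: ins[symmetric]\<close>)
  also note G_eq
  finally show "fourier (nu n f) x = fact n *
      det_n n (\<lambda>i j. \<integral>t. of_real (t ^ (i + j)) * (cis (- (x * t)) * of_real (f t)) \<partial>lborel)"
    by (simp add: F_def)
qed

theorem theorem4p1:
  fixes n :: nat and f :: "real \<Rightarrow> real"
  assumes n2: "n \<ge> 2"
    and f_meas: "f \<in> borel_measurable lborel"
    and f_int: "integrable lborel f"
    and f_nonneg: "\<And>t. f t \<ge> 0"
    and f_mom: "integrable lborel (\<lambda>t. t ^ (2 * n - 2) * f t)"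
  shows "((\<forall>x::real. W n (fourier f) x \<noteq> 0) \<longleftrightarrow> translates_dense_L1 (nu n f))
       \<and> ((nu n f \<in> borel_measurable lborel \<and> integrable lborel (\<lambda>x. (nu n f x)^2)) \<longrightarrow>
            ({x::real. W n (fourier f) x = 0} \<in> null_sets lborel \<longleftrightarrow> translates_dense_L2 (nu n f)))"
proof -
  have n: "n \<ge> 1" using n2 by simp
  \<comment> \<open>Both sides are the same determinant of moments multiplied by a nonzero constant,
    a power of \<open>- \<i>\<close> on the left and \<open>fact n\<close> on the right.\<close>
  have zero: "W n (fourier f) x = 0 \<longleftrightarrow> fourier (nu n f) x = 0" for x
    unfolding W_fourier[OF f_int f_mom] fourier_nu[OF f_int f_mom n] by simp
  show ?thesis
    unfolding zero using wiener_L1 wiener_L2 integrable_nu[OF f_int f_mom n] by blast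
qed

end
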